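(* Let $d\ge2$, $p(z)=z^d$, let $\Lambda$ be a connected component of $\mathcal{D}'\subset\mathbb{C}^{D_d}$, and let $\lambda_0\in\Lambda$ be an admissible parameter. Let $S:=S_{q_{\lambda_0}}\in\mathfrak{S}_d$ be the monodromy permutation of $\{q_{\lambda_0}=0\}\cap(\mathbb{S}^1\times\mathbb{C})$. Let $h$ be the homeomorphism of $\{1,\dots,d\}^{\mathbb{N}^*}$ given by $h\big((a_n)_{n\ge1}\big)=\big(S^{\circ d^{n-1}}(a_n)\big)_{n\ge1}$. Then there exists a homeomorphism $$J(f_{\lambda_0})\simeq \mathcal{S}_\Lambda:=\big([0,1]\times\{1,\dots,d\}^{\mathbb{N}^*}\big)\big/\sim_h,\qquad (0,x)\sim_h(1,y)\Leftrightarrow h(x)=y .$$ Moreover, for any other parameter $\lambda\in\Lambda$, $J(f_\lambda)$ is also homeomorphic to $\mathcal{S}_\Lambda$.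
   Context: Family: $D_d=\frac12(d-1)(d+4)$. For $\lambda=(a_{j,k})_{0\le j\le d-2,\,0\le k\le d-j}\in\mathbb{C}^{D_d}$ put $f_\lambda(z,w)=(z^d,q_{\lambda,z}(w))$ with $q_\lambda(z,w)=q_{\lambda,z}(w)=w^d+\sum_{j=0}^{d-2}\big(\sum_{k=0}^{d-j}a_{j,k}^{\,d-j}z^k\big)w^j$. Here $p(z)=z^d$, $J_p=\mathbb{S}^1$. $J(f_\lambda)$ denotes the support of the equilibrium measure of $f_\lambda$. Sets: $Q^n_{\lambda,z}=q_{\lambda,z_{n-1}}\circ\cdots\circ q_{\lambda,z_0}$ with $z_k=p^k(z)$. $\mathcal{D}$ is the set of $\lambda$ such that for every $z\in J_p$ and every critical point $c$ of $q_{\lambda,z}$ the sequence $(Q^n_{\lambda,z}(c))_n$ is unbounded. $P(\lambda,z)=\prod_{q_{\lambda,z}'(c)=0}q_{\lambda,z}(c)$ is homogeneous in $\lambda$; $\mathbb{P}^{D_d}=\mathbb{C}^{D_d}\sqcup\mathbb{P}^{D_d-1}_\infty$, and $E=\bigcup_{z\in J_p}\{[\lambda]\in\mathbb{P}^{D_d-1}_\infty:P(\lambda,z)=0\}$. $\mathcal{D}'$ is the set of $\lambda\in\mathcal{D}$ that can be joined by a continuous path inside $\mathcal{D}$ to a point of $\mathbb{P}^{D_d-1}_\infty\setminus E$ (the endpoint being at infinity). Admissible: $\lambda\in\mathcal{D}$ is admissible if there is $R>0$ such that, with $\mathcal{M}=J_p\times\mathbb{D}_R$ ($\mathbb{D}_R$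 the open disc of radius $R$ centred at $0$) and $\mathcal{M}_n=f_\lambda^{-n}(\mathcal{M})$: $\mathcal{M}_{n+1}\Subset\mathcal{M}_n$ for all $n\ge0$; $f_\lambda:\mathcal{M}_1\to\mathcal{M}$ is a $d^2$-fold covering map; and $J(f_\lambda)=\bigcap_{n\ge0}\mathcal{M}_n$. Permutation: for $K=\{q_{\lambda_0}=0\}\cap(\mathbb{S}^1\times\mathbb{C})$, the first projection $K\to\mathbb{S}^1$ is an unramified $d$-fold covering; $S_{q_{\lambda_0}}$ is the permutation of the $d$ roots of $q_{\lambda_0,1}$ given by monodromy along one positive turn of $\mathbb{S}^1$, viewed in $\mathfrak{S}_d$ after an arbitrary labelling of the roots by $1,\dots,d$. *)

theory Defs
  imports
    "HOL-Probability.Probability"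
    "HOL-Computational_Algebra.Polynomial"
    "HOL-Combinatorics.Permutations"
begin

section \<open>Quotient spaces and mapping tori\<close>

text \<open>The quotient topology on the image of \<open>f\<close>; for \<open>f\<close> sending a point to its equivalence class,
  this is the quotient space.\<close>

definition quotient_topology :: "'a topology \<Rightarrow> ('a \<Rightarrow> 'b) \<Rightarrow> 'b topology" where
  "quotient_topology X f =
     topology (\<lambda>U. U \<subseteq> f ` topspace X \<and> openin X {x \<in> topspace X. f x \<in> U})"

lemma openin_quotient_topology:
  "openin (quotient_topology X f) U \<longleftrightarrow>
     U \<subseteq> f ` topspace X \<and> openin X {x \<in> topspace X. f x \<in> U}"
proof -
  have "istopology (\<lambda>U. U \<subseteq> f ` topspace X \<and> openin X {x \<in> topspace X. f x \<in> U})"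
    unfolding istopology_def
  proof (intro conjI allI impI)
    fix U V
    assume U: "U \<subseteq> f ` topspace X \<and> openin X {x \<in> topspace X. f x \<in> U}"
      and V: "V \<subseteq> f ` topspace X \<and> openin X {x \<in> topspace X. f x \<in> V}"
    show "U \<inter> V \<subseteq> f ` topspace X"
      by (rule le_infI1) (rule conjunct1[OF U])
    have "{x \<in> topspace X. f x \<in> U \<inter> V} =
        {x \<in> topspace X. f x \<in> U} \<inter> {x \<in> topspace X. f x \<in> V}" by auto
    then show "openin X {x \<in> topspace X. f x \<in> U \<inter> V}"
      using openin_Int[OF conjunct2[OF U] conjunct2[OF V]] by (simp only:)
  next
    fix K
    assume K: "\<forall>U\<in>K. U \<subseteq> f ` topspace X \<and> openin X {x \<in> topspace X. f x \<in> U}"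
    show "\<Union>K \<subseteq> f ` topspace X"
      by (rule Union_least) (use K in simp)
    have "{x \<in> topspace X. f x \<in> \<Union>K} = (\<Union>U\<in>K. {x \<in> topspace X. f x \<in> U})" by auto
    moreover have "openin X (\<Union>U\<in>K. {x \<in> topspace X. f x \<in> U})"
      using K by (intro openin_Union) blast
    ultimately show "openin X {x \<in> topspace X. f x \<in> \<Union>K}" by (simp only:)
  qed
  then show ?thesis
    by (simp only: quotient_topology_def topology_inverse')
qed

lemma topspace_quotient_topology: "topspace (quotient_topology X f) = f ` topspace X"
proof
  show "topspace (quotient_topology X f) \<subseteq> f ` topspace X"
    using openin_topspace[of "quotient_topology X f"]
    by (rule conjunct1[OF iffD1[OF openin_quotient_topology]])
  have "{x \<in> topspace X. f x \<in> f ` topspace X} = topspace X" by auto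
  then have "openin (quotient_topology X f) (f ` topspace X)"
    by (simp add: openin_quotient_topology)
  then show "f ` topspace X \<subseteq> topspace (quotient_topology X f)"
    by (rule openin_subset)
qed

lemma quotient_map_quotient_topology: "quotient_map X (quotient_topology X f) f"
  by (simp add: quotient_map_def topspace_quotient_topology openin_quotient_topology)

text \<open>\<open>([0,1] \<times> X) / \<sim>\<close> for the equivalence relation generated by \<open>(0, x) \<sim> (1, h x)\<close>.\<close>

definition torus_glue :: "'a topology \<Rightarrow> ('a \<Rightarrow> 'a) \<Rightarrow> real \<times> 'a \<Rightarrow> real \<times> 'a \<Rightarrow> bool" where
  "torus_glue X h p p' \<longleftrightarrow> (\<exists>x \<in> topspace X. p = (0, x) \<and> p' = (1, h x))"

definition mapping_torus :: "'a topology \<Rightarrow> ('a \<Rightarrow> 'a) \<Rightarrow> (real \<times> 'a) set topology" where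
  "mapping_torus X h =
     quotient_topology (prod_topology (top_of_set {0..1}) X)
       (\<lambda>p. {p'. equivclp (torus_glue X h) p p'})"

section \<open>The equilibrium measure\<close>

text \<open>The complex Jacobian determinant of a holomorphic self-map of \<open>\<complex>\<^sup>2\<close>.\<close>

definition complex_jacobian :: "(complex \<times> complex \<Rightarrow> complex \<times> complex) \<Rightarrow> complex \<times> complex \<Rightarrow> complex" where
  "complex_jacobian F = (\<lambda>(z, w).
     deriv (\<lambda>u. fst (F (u, w))) z * deriv (\<lambda>u. snd (F (z, u))) w
     - deriv (\<lambda>u. fst (F (z, u))) w * deriv (\<lambda>u. snd (F (u, w))) z)"

text \<open>For a holomorphic \<open>F\<close>, this is the measure \<open>F\<^sup>*(\<omega> \<and> \<omega>)\<close> on \<open>\<complex>\<^sup>2\<close>, where \<open>\<omega>\<close> is the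
  Fubini-Study form of the projective plane in the affine chart \<open>\<complex>\<^sup>2\<close>, normalised so that
  \<open>\<omega> \<and> \<omega>\<close> has total mass 1. In the chart, \<open>\<omega> \<and> \<omega>\<close> has Lebesgue density
  \<open>(2/\<pi>\<^sup>2) (1 + |z|\<^sup>2 + |w|\<^sup>2)\<^sup>-\<^sup>3\<close>, and pulling back a top-degree form multiplies the density by the
  squared modulus of the complex Jacobian.\<close>

definition fubini_study_pullback :: "(complex \<times> complex \<Rightarrow> complex \<times> complex) \<Rightarrow> (complex \<times> complex) measure" where
  "fubini_study_pullback F =
     density lborel (\<lambda>x. ennreal (2 / pi\<^sup>2 * (cmod (complex_jacobian F x))\<^sup>2 / (1 + (norm (F x))\<^sup>2) ^ 3))"

text \<open>Let \<open>f\<close> be a polynomial self-map of \<open>\<complex>\<^sup>2\<close> of degree \<open>d\<close> that extends holomorphically to the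
  projective plane. Its equilibrium measure is the weak limit of \<open>d\<^sup>-\<^sup>2\<^sup>n (f\<^sup>n)\<^sup>*(\<omega> \<and> \<omega>)\<close>, i.e. the
  self-intersection of the Green current, the limit of \<open>d\<^sup>-\<^sup>n (f\<^sup>n)\<^sup>*\<omega>\<close>. The line at infinity is null
  for all these measures, and the limit is a probability measure with compact support in \<open>\<complex>\<^sup>2\<close>, so
  weak convergence can be tested on \<open>\<complex>\<^sup>2\<close> against bounded continuous functions.\<close>

definition is_equilibrium_measure ::
    "nat \<Rightarrow> (complex \<times> complex \<Rightarrow> complex \<times> complex) \<Rightarrow> (complex \<times> complex) measure \<Rightarrow> bool" where
  "is_equilibrium_measure d f \<mu> \<longleftrightarrow>
     prob_space \<mu> \<and> sets \<mu> = sets borel \<and>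
     (\<forall>\<phi> :: complex \<times> complex \<Rightarrow> real. continuous_on UNIV \<phi> \<and> bounded (range \<phi>) \<longrightarrow>
        (\<lambda>n. integral\<^sup>L (fubini_study_pullback (f ^^ n)) \<phi> / real d ^ (2 * n))
          \<longlonglongrightarrow> integral\<^sup>L \<mu> \<phi>)"

definition equilibrium_measure ::
    "nat \<Rightarrow> (complex \<times> complex \<Rightarrow> complex \<times> complex) \<Rightarrow> (complex \<times> complex) measure" where
  "equilibrium_measure d f = (THE \<mu>. is_equilibrium_measure d f \<mu>)"

definition measure_support :: "'a::topological_space measure \<Rightarrow> 'a set" where
  "measure_support \<mu> = {x. \<forall>U. open U \<and> x \<in> U \<longrightarrow> emeasure \<mu> U > 0}"

definition julia_set :: "nat \<Rightarrow> (complex \<times> complex \<Rightarrow> complex \<times> complex) \<Rightarrow> (complex \<times> complex) set" where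
  "julia_set d f = measure_support (equilibrium_measure d f)"

section \<open>The family of polynomial skew products\<close>

text \<open>A point of \<open>\<complex>\<^sup>D\<close>, \<open>D = (d - 1)(d + 4)/2\<close>, is a family \<open>a (j, k)\<close> indexed by \<open>j \<le> d - 2\<close>,
  \<open>k \<le> d - j\<close>, extended by zero; the product topology of the function type induces the usual
  topology on \<open>\<complex>\<^sup>D\<close>.\<close>

type_synonym param = "nat \<times> nat \<Rightarrow> complex"

definition param_index :: "nat \<Rightarrow> (nat \<times> nat) set" where
  "param_index d = {(j, k). j \<le> d - 2 \<and> k \<le> d - j}"

definition param_space :: "nat \<Rightarrow> param set" where
  "param_space d = {a. \<forall>i. i \<notin> param_index d \<longrightarrow> a i = 0}"

definition fibre_poly :: "nat \<Rightarrow> param \<Rightarrow> complex \<Rightarrow> complex poly" where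
  "fibre_poly d a z =
     monom 1 d + (\<Sum>j\<le>d - 2. monom (\<Sum>k\<le>d - j. a (j, k) ^ (d - j) * z ^ k) j)"

definition skew_product :: "nat \<Rightarrow> param \<Rightarrow> complex \<times> complex \<Rightarrow> complex \<times> complex" where
  "skew_product d a = (\<lambda>(z, w). (z ^ d, poly (fibre_poly d a z) w))"

text \<open>The Julia set of \<open>z \<mapsto> z ^ d\<close>.\<close>

abbreviation base_julia :: "complex set" where
  "base_julia \<equiv> sphere 0 1"

fun fibre_iterate :: "nat \<Rightarrow> param \<Rightarrow> complex \<Rightarrow> nat \<Rightarrow> complex \<Rightarrow> complex" where
  "fibre_iterate d a z 0 w = w"
| "fibre_iterate d a z (Suc n) w =
     poly (fibre_poly d a (((\<lambda>u. u ^ d) ^^ n) z)) (fibre_iterate d a z n w)"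

definition escape_locus :: "nat \<Rightarrow> param set" where
  "escape_locus d =
     {a \<in> param_space d. \<forall>z \<in> base_julia. \<forall>c. poly (pderiv (fibre_poly d a z)) c = 0 \<longrightarrow>
        \<not> bounded (range (\<lambda>n. fibre_iterate d a z n c))}"

section \<open>The parameters accessible from infinity\<close>

text \<open>The projective completion of the parameter space: a point of \<open>\<complex> \<times> \<complex>\<^sup>D - {0}\<close> is sent to the
  punctured line through it. The parameter \<open>a\<close> is embedded as \<open>[1 : a]\<close>, and the hyperplane at
  infinity consists of the points \<open>[0 : a]\<close>.\<close>

definition nonzero_vectors :: "nat \<Rightarrow> (complex \<times> param) set" where
  "nonzero_vectors d = {(t, a). a \<in> param_space d \<and> (t \<noteq> 0 \<or> a \<noteq> (\<lambda>_. 0))}"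

definition proj_class :: "complex \<times> param \<Rightarrow> (complex \<times> param) set" where
  "proj_class = (\<lambda>(t, a). {(s * t, \<lambda>i. s * a i) | s. s \<noteq> 0})"

definition proj_param_space :: "nat \<Rightarrow> (complex \<times> param) set topology" where
  "proj_param_space d = quotient_topology (top_of_set (nonzero_vectors d)) proj_class"

definition hyperplane_at_infinity :: "nat \<Rightarrow> (complex \<times> param) set set" where
  "hyperplane_at_infinity d = {proj_class (0, a) | a. (0, a) \<in> nonzero_vectors d}"

text \<open>The product of the critical values of the fibre polynomial, critical points being counted with
  multiplicity.\<close>

definition critical_value_product :: "nat \<Rightarrow> param \<Rightarrow> complex \<Rightarrow> complex" where
  "critical_value_product d a z =
     (\<Prod>c\<in>#proots (pderiv (fibre_poly d a z)). poly (fibre_poly d a z) c)"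

definition exceptional_at_infinity :: "nat \<Rightarrow> (complex \<times> param) set set" where
  "exceptional_at_infinity d =
     (\<Union>z \<in> base_julia.
        {proj_class (0, a) | a. (0, a) \<in> nonzero_vectors d \<and> critical_value_product d a z = 0})"

definition accessible_locus :: "nat \<Rightarrow> param set" where
  "accessible_locus d =
     {a \<in> escape_locus d. \<exists>\<gamma>. pathin (proj_param_space d) \<gamma> \<and> \<gamma> 0 = proj_class (1, a) \<and>
        (\<forall>t \<in> {0..<1}. \<gamma> t \<in> (\<lambda>b. proj_class (1, b)) ` escape_locus d) \<and>
        \<gamma> 1 \<in> hyperplane_at_infinity d - exceptional_at_infinity d}"

section \<open>Admissible parameters and monodromy\<close>

definition tube :: "nat \<Rightarrow> param \<Rightarrow> real \<Rightarrow> nat \<Rightarrow> (complex \<times> complex) set" where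
  "tube d a R n = {x. (skew_product d a ^^ n) x \<in> base_julia \<times> ball 0 R}"

definition admissible :: "nat \<Rightarrow> param \<Rightarrow> bool" where
  "admissible d a \<longleftrightarrow> a \<in> escape_locus d \<and>
     (\<exists>R>0. (\<forall>n. compact (closure (tube d a R (Suc n))) \<and>
                 closure (tube d a R (Suc n)) \<subseteq> tube d a R n) \<and>
            covering_space (tube d a R 1) (skew_product d a) (tube d a R 0) \<and>
            (\<forall>y \<in> tube d a R 0. card {x \<in> tube d a R 1. skew_product d a x = y} = d\<^sup>2) \<and>
            julia_set d (skew_product d a) = (\<Inter>n. tube d a R n))"

text \<open>The end point of the lift, starting at the root \<open>w\<close> over \<open>z = 1\<close>, of one positive turn of the
  unit circle to \<open>{(z, w). |z| = 1 \<and> q(z, w) = 0}\<close>.\<close>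

definition root_monodromy :: "nat \<Rightarrow> param \<Rightarrow> complex \<Rightarrow> complex" where
  "root_monodromy d a w =
     (THE w'. \<exists>\<gamma>. continuous_on {0..1} \<gamma> \<and> \<gamma> 0 = w \<and> \<gamma> 1 = w' \<and>
        (\<forall>t \<in> {0..1}. poly (fibre_poly d a (cis (2 * pi * t))) (\<gamma> t) = 0))"

definition root_labelling :: "nat \<Rightarrow> param \<Rightarrow> (nat \<Rightarrow> complex) \<Rightarrow> bool" where
  "root_labelling d a r \<longleftrightarrow> bij_betw r {1..d} {w. poly (fibre_poly d a 1) w = 0}"

definition monodromy_perm :: "nat \<Rightarrow> param \<Rightarrow> (nat \<Rightarrow> complex) \<Rightarrow> nat \<Rightarrow> nat" where
  "monodromy_perm d a r i =
     (if i \<in> {1..d} then inv_into {1..d} r (root_monodromy d a (r i)) else i)"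

definition symbol_space :: "nat \<Rightarrow> (nat \<Rightarrow> nat) topology" where
  "symbol_space d = product_topology (\<lambda>_. discrete_topology {1..d}) {1..}"

definition symbol_map :: "nat \<Rightarrow> (nat \<Rightarrow> nat) \<Rightarrow> (nat \<Rightarrow> nat) \<Rightarrow> (nat \<Rightarrow> nat)" where
  "symbol_map d S x = (\<lambda>n\<in>{1..}. (S ^^ (d ^ (n - 1))) (x n))"

end

theory Submission
  imports Defs "HOL-Complex_Analysis.Complex_Analysis" "HOL-Computational_Algebra.Fundamental_Theorem_Algebra"
begin

text \<open>Over the escape locus the fibre maps expand uniformly: inverse branches strictly contract the
  Kobayashi metric of the tubes. Three consequences carry the proof.

  First, preimages \<open>Q\<^sup>-\<^sup>m(v)\<close> and \<open>Q\<^sup>-\<^sup>m(v')\<close> in a common fibre can be matched with small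
  displacement, and \<open>z\<^sup>N = z\<^sub>0\<close> has equidistributed solutions, so the averages of a continuous
  function over all preimages under the iterates of \<open>f\<close> converge to a limit that does not depend on
  the base point. By the area formula they converge weakly to the equilibrium measure, which
  charges each neighbourhood of each point with bounded fibre orbit over the circle. Hence the
  Julia set is the filled set \<open>{(z, w). |z| = 1, Q\<^sup>n(z, w) bounded}\<close>.

  Second, for nearby parameters each bounded orbit of one map is shadowed by exactly one bounded
  orbit of the other with the same base point. Shadowing gives a homeomorphism of the filled sets,
  so their homeomorphism type is constant on connected subsets of the escape locus.

  Third, at an admissible parameter the covering of the solid torus pulls back to
  \<open>\<real> \<times> D\<^sub>R\<close>, where it splits into \<open>d\<close> branches labelled by the roots of \<open>q\<^sub>1\<close>. A point
  over \<open>e\<^sup>2\<^sup>\<pi>\<^sup>i\<^sup>t\<close> is coded by the branches that its orbit follows; contraction makes the code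
  bijective for fixed \<open>t\<close>. The branch at time \<open>n\<close> is taken over the parameter \<open>d\<^sup>n t\<close>, so
  replacing \<open>t\<close> by \<open>t + 1\<close> applies \<open>S\<close> exactly \<open>d\<^sup>n\<close> times to the \<open>n\<close>-th letter, which is the
  gluing map of the mapping torus.\<close>

section \<open>Roots of complex polynomials\<close>

text \<open>The equilibrium measure is defined through integrals over all of C^2, so preimages of
  every base point (z0, v) have to be controlled, although expansion is available only over the unit
  circle. Two devices bridge the gap. Preimages are multisets of roots: their number is constant and
  they vary continuously across critical values, where no inverse branches exist; closeness of two
  families is a perfect matching, expressed by \<open>rel_mset\<close>. And for z0 \<noteq> 0 the
  solutions of z^(d^n) = z0 tend to the circle, so the deepest levels of the backward tree, the only
  ones that a test function sees, lie over base points near the circle. The fibre z0 = 0 is left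
  over and has measure zero.

  In all three parts the quantitative input is a positive margin between a tube and its preimage. It
  is obtained by compactness for escaping parameters and read off from relative compactness of the
  tubes for admissible ones.\<close>

lemma poly_eq_prod_proots:
  fixes p :: "complex poly"
  assumes "lead_coeff p = 1"
  shows "poly p x = (\<Prod>u\<in>#proots p. x - u)"
proof -
  have "poly p x = poly (smult (lead_coeff p) (\<Prod>u\<in>#proots p. [:-u, 1:])) x"
    by (simp only: complex_poly_decompose_multiset)
  then show ?thesis using assms by (simp add: poly_prod_mset)
qed

lemma prod_mset_norm_ge_power:
  fixes f :: "'a \<Rightarrow> complex"
  assumes "\<forall>u\<in>#M. c \<le> norm (f u)" "0 \<le> c"
  shows "c ^ size M \<le> norm (\<Prod>u\<in>#M. f u)"
  using assms(1)
proof (induction M)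
  case (add x M)
  then have "c * c ^ size M \<le> norm (f x) * norm (\<Prod>u\<in>#M. f u)"
    using assms(2) by (intro mult_mono) auto
  then show ?case by (simp add: norm_mult)
qed simp

lemma degree_diff_const [simp]: "degree (p - [:v:]) = degree (p :: 'a :: comm_ring_1 poly)"
proof (cases "degree p = 0")
  case False
  then show ?thesis
    using degree_add_eq_left[of "[:-v:]" p] by (simp add: diff_conv_add_uminus del: add_uminus_conv_diff)
next
  case True
  then obtain c where "p = [:c:]" by (metis degree_eq_zeroE)
  then show ?thesis by simp
qed

text \<open>|p(x)| is the product of the distances from x to the roots, and none of these is smaller
  than the distance to the nearest root.\<close>

lemma monic_root_near:
  fixes p :: "complex poly"
  assumes "lead_coeff p = 1" "degree p > 0"
  obtains u where "poly p u = 0" "norm (x - u) ^ degree p \<le> norm (poly p x)"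
proof -
  have p0: "p \<noteq> 0" using assms(1) by auto
  define W where "W = {u. poly p u = 0}"
  have fin: "finite W" unfolding W_def using p0 by (rule poly_roots_finite)
  have "W \<noteq> {}"
    using fundamental_theorem_of_algebra[of p] assms(2) constant_degree[of p] by (auto simp: W_def)
  then obtain u where u: "u \<in> W" "\<forall>v\<in>W. norm (x - u) \<le> norm (x - v)"
    using fin by (metis arg_min_if_finite(1) arg_min_least[of W _ "\<lambda>v. norm (x - v)"])
  have "norm (x - u) ^ size (proots p) \<le> norm (\<Prod>v\<in>#proots p. x - v)"
    using u p0 by (intro prod_mset_norm_ge_power) (auto simp: W_def)
  then show ?thesis
    using that[of u] u poly_eq_prod_proots[OF assms(1), of x] by (simp add: size_proots_complex W_def)
qed

text \<open>Induction on the degree by splitting off one root. A root \<open>r\<close> of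
  \<open>Q\<close> is approximated by roots \<open>u i\<close> of \<open>P i\<close>, because
  \<open>P i\<close> takes small values at \<open>r\<close> (\<open>monic_root_near\<close>); the
  quotients by the linear factors again have convergent coefficients. Working with multisets keeps
  track of multiplicities.\<close>

lemma proots_tendsto:
  fixes P :: "nat \<Rightarrow> complex poly"
  assumes "\<And>i. degree (P i) = n" "\<And>i. lead_coeff (P i) = 1"
    and "degree Q = n" "lead_coeff Q = 1"
    and "\<And>j. (\<lambda>i. coeff (P i) j) \<longlonglongrightarrow> coeff Q j"
    and "0 < \<epsilon>"
  shows "\<forall>\<^sub>F i in sequentially. rel_mset (\<lambda>x y. dist x y \<le> \<epsilon>) (proots (P i)) (proots Q)"
  using assms(1-5)
proof (induction n arbitrary: P Q)
  case 0
  have "proots (P i) = {#}" for i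
    using size_proots_complex[of "P i"] "0.prems"(1)[of i] by simp
  moreover have "proots Q = {#}"
    using size_proots_complex[of Q] "0.prems"(3) by simp
  ultimately show ?case by (simp add: rel_mset_Zero)
next
  case (Suc n)
  note Pdeg = Suc.prems(1) and Plc = Suc.prems(2) and Qdeg = Suc.prems(3) and Qlc = Suc.prems(4)
    and lim = Suc.prems(5)
  obtain r where r: "poly Q r = 0"
    using fundamental_theorem_of_algebra[of Q] Qdeg constant_degree[of Q] by auto
  have "\<exists>u. poly (P i) u = 0 \<and> norm (r - u) ^ Suc n \<le> norm (poly (P i) r)" for i
    using monic_root_near[of "P i" r] Pdeg[of i] Plc[of i] by auto
  then obtain u where u: "\<And>i. poly (P i) (u i) = 0"
    "\<And>i. norm (r - u i) ^ Suc n \<le> norm (poly (P i) r)" by metis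
  have "(\<lambda>i. poly (P i) r) \<longlonglongrightarrow> poly Q r"
    unfolding poly_altdef Pdeg Qdeg by (intro tendsto_sum tendsto_mult tendsto_const lim)
  then have "(\<lambda>i. norm (poly (P i) r)) \<longlonglongrightarrow> 0" using r by (simp add: tendsto_norm_zero)
  then have "(\<lambda>i. norm (r - u i) ^ Suc n) \<longlonglongrightarrow> 0"
    by (rule tendsto_sandwich[of "\<lambda>_. 0", rotated 2, OF tendsto_const]) (use u(2) in auto)
  then have "(\<lambda>i. root (Suc n) (norm (r - u i) ^ Suc n)) \<longlonglongrightarrow> root (Suc n) 0"
    by (rule tendsto_real_root)
  moreover have "root (Suc n) (norm (r - u i) ^ Suc n) = norm (r - u i)" for i
    by (rule real_root_power_cancel) auto
  ultimately have "(\<lambda>i. norm (r - u i)) \<longlonglongrightarrow> 0" by (simp only: real_root_zero)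
  then have ulim: "u \<longlonglongrightarrow> r"
    by (intro LIM_zero_cancel[of u] tendsto_norm_zero_cancel[of "\<lambda>i. u i - r"]) (simp add: norm_minus_commute)
  have "\<exists>S. P i = [:- u i, 1:] * S" for i using u(1)[of i] by (simp add: poly_eq_0_iff_dvd dvd_def)
  then obtain S where S: "\<And>i. P i = [:- u i, 1:] * S i" by metis
  obtain T where T: "Q = [:- r, 1:] * T" using r by (auto simp: poly_eq_0_iff_dvd dvd_def)
  have S0: "S i \<noteq> 0" for i using Plc[of i] S[of i] by auto
  have T0: "T \<noteq> 0" using Qlc T by auto
  have Sdeg: "degree (S i) = n" for i
    using Pdeg[of i] S0[of i] unfolding S by (subst (asm) degree_mult_eq) auto
  have Tdeg: "degree T = n"
    using Qdeg T0 unfolding T by (subst (asm) degree_mult_eq) auto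
  have Slc: "lead_coeff (S i) = 1" for i
    using Plc[of i] unfolding S lead_coeff_mult by simp
  have Tlc: "lead_coeff T = 1"
    using Qlc unfolding T lead_coeff_mult by simp
  \<comment> \<open>Synthetic division: each coefficient of the quotient is determined by the next
    higher one. Hence \<open>Slim\<close> descends from the degree, by induction on
    \<open>Suc n - j\<close>.\<close>
  have crec: "coeff R j = coeff ([:- c, 1:] * R) (Suc j) + c * coeff R (Suc j)" for c :: complex and R j
    by simp
  have Slim: "(\<lambda>i. coeff (S i) j) \<longlonglongrightarrow> coeff T j" for j
  proof (induction "Suc n - j" arbitrary: j)
    case 0
    then have "coeff (S i) j = 0" "coeff T j = 0" for i
      using Sdeg Tdeg by (auto intro!: coeff_eq_0)
    then show ?case by simp
  next
    case (Suc m)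
    then have IH: "(\<lambda>i. coeff (S i) (Suc j)) \<longlonglongrightarrow> coeff T (Suc j)" by simp
    have "(\<lambda>i. coeff (P i) (Suc j) + u i * coeff (S i) (Suc j)) \<longlonglongrightarrow> coeff Q (Suc j) + r * coeff T (Suc j)"
      by (intro tendsto_add tendsto_mult lim ulim IH)
    then show ?case by (simp only: T S crec[symmetric])
  qed
  have "\<forall>\<^sub>F i in sequentially. rel_mset (\<lambda>x y. dist x y \<le> \<epsilon>) (proots (S i)) (proots T)"
    by (rule Suc.IH) (use Sdeg Tdeg Slc Tlc Slim in auto)
  moreover have "\<forall>\<^sub>F i in sequentially. dist (u i) r < \<epsilon>"
    using ulim \<open>0 < \<epsilon>\<close> by (rule tendstoD)
  ultimately show ?case
  proof eventually_elim
    case (elim i)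
    have "proots (P i) = add_mset (u i) (proots (S i))" "proots Q = add_mset r (proots T)"
      unfolding S T using S0 T0 by (simp_all add: proots_mult del: mult_pCons_left)
    then show ?case using elim by (simp add: rel_mset_Plus)
  qed
qed

lemma proots_simple:
  fixes p :: "complex poly"
  assumes "\<And>w. poly p w = 0 \<Longrightarrow> poly (pderiv p) w \<noteq> 0" "p \<noteq> 0"
  shows "proots p = mset_set {w. poly p w = 0}" "card {w. poly p w = 0} = degree p"
proof -
  have "rsquarefree p" using assms by (auto simp: rsquarefree_roots)
  then have "order w p = (if poly p w = 0 then 1 else 0)" for w
    using assms(2) rsquarefree_root_order[of p w] by (auto simp: order_root)
  then show *: "proots p = mset_set {w. poly p w = 0}"
    using assms(2) poly_roots_finite[of p]
    by (intro multiset_eqI) (auto simp: count_mset_set')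
  show "card {w. poly p w = 0} = degree p"
    using arg_cong[OF *, of size] by (simp add: size_proots_complex)
qed

section \<open>Polynomials as covering maps\<close>

lemma deriv_poly: "deriv (poly p) w = poly (pderiv p) (w :: complex)"
  by (rule DERIV_imp_deriv) (rule poly_DERIV)

text \<open>Over \<open>v0\<close> there are \<open>degree p\<close> simple preimages, with disjoint
  discs around them on which \<open>p\<close> is injective. A point of the common image
  \<open>T\<close> has one preimage in each disc, and these are already \<open>degree p\<close>
  many, so no preimage lies elsewhere: the count of roots takes the place of properness.\<close>

lemma covering_space_poly:
  fixes p :: "complex poly"
  assumes deg: "degree p > 0" and V: "open V"
    and nz: "\<And>w. poly p w \<in> V \<Longrightarrow> poly (pderiv p) w \<noteq> 0"
  shows "covering_space (poly p -` V) (poly p) V"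
proof
  show "continuous_on (poly p -` V) (poly p)" by (intro continuous_intros)
  show "poly p ` (poly p -` V) = V"
  proof -
    have "\<exists>w. poly p w = v" for v
    proof -
      have "\<not> constant (poly (p - [:v:]))" using deg by (subst constant_degree) (simp add: degree_diff_const)
      then obtain w where "poly (p - [:v:]) w = 0" using fundamental_theorem_of_algebra by blast
      then show ?thesis by auto
    qed
    then show ?thesis by (auto simp: image_iff) metis
  qed
next
  fix v0 assume v0: "v0 \<in> V"
  define W where "W = {w. poly p w = v0}"
  have p0: "p - [:v:] \<noteq> 0" for v using deg by (metis degree_pCons_0 eq_iff_diff_eq_0 less_irrefl)
  note dg = degree_diff_const
  have Weq: "W = {w. poly (p - [:v0:]) w = 0}" by (auto simp: W_def)
  have finW: "finite W" unfolding Weq by (rule poly_roots_finite[OF p0])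
  have "poly (pderiv (p - [:v0:])) w \<noteq> 0" if "poly (p - [:v0:]) w = 0" for w
    using that nz[of w] v0 by (simp add: pderiv_diff pderiv_pCons)
  then have cardW: "card W = degree p"
    using proots_simple(2)[OF _ p0[of v0]] unfolding Weq dg by blast
  have "\<exists>r>0. inj_on (poly p) (ball w r) \<and> (\<forall>w'\<in>W. w' \<noteq> w \<longrightarrow> 2 * r \<le> dist w w')" if wW: "w \<in> W" for w
  proof -
    obtain r1 where r1: "r1 > 0" "inj_on (poly p) (ball w r1)"
      using has_complex_derivative_locally_injective[of "poly p" UNIV w] poly_holomorphic_on[OF holomorphic_on_ident, of p UNIV] nz[of w] wW v0
      by (auto simp: deriv_poly W_def)
    obtain r2 where r2: "r2 > 0" "\<forall>x\<in>W. x \<noteq> w \<longrightarrow> r2 \<le> dist w x"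
      using finite_set_avoid[OF finW] by blast
    have "inj_on (poly p) (ball w (min r1 (r2/2)))"
      using r1(2) by (rule inj_on_subset) auto
    moreover have "\<forall>w'\<in>W. w' \<noteq> w \<longrightarrow> 2 * min r1 (r2/2) \<le> dist w w'"
      using r2(2) by (auto simp: min_def)
    ultimately show ?thesis using r1 r2 by (intro exI[of _ "min r1 (r2/2)"]) auto
  qed
  then obtain r where r: "\<And>w. w \<in> W \<Longrightarrow> r w > 0" "\<And>w. w \<in> W \<Longrightarrow> inj_on (poly p) (ball w (r w))"
    "\<And>w w'. w \<in> W \<Longrightarrow> w' \<in> W \<Longrightarrow> w' \<noteq> w \<Longrightarrow> 2 * r w \<le> dist w w'" by metis
  have disj: "w = w'" if "w \<in> W" "w' \<in> W" "x \<in> ball w (r w)" "x \<in> ball w' (r w')" for w w' x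
  proof (rule ccontr)
    assume "w \<noteq> w'"
    then have "2 * r w \<le> dist w w'" "2 * r w' \<le> dist w w'"
      using r(3)[of w w'] r(3)[of w' w] that by (auto simp: dist_commute)
    moreover have "dist w w' < r w + r w'"
      using that dist_triangle[of w w' x] by (simp add: dist_commute)
    ultimately show False by simp
  qed
  define T where "T = V \<inter> (\<Inter>w\<in>W. poly p ` ball w (r w))"
  have op: "open (poly p ` U)" if "open U" "U \<subseteq> ball w (r w)" "w \<in> W" for U w
    using that r(2)[of w] by (intro open_mapping_thm3) (auto intro!: holomorphic_intros intro: inj_on_subset)
  have openT: "open T" unfolding T_def using V finW op by (intro open_Int open_INT) auto
  have v0T: "v0 \<in> T" using v0 r(1) by (auto simp: T_def W_def intro!: image_eqI)
  define B where "B w = ball w (r w) \<inter> poly p -` T" for w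
  have Bopen: "open (B w)" for w
    unfolding B_def by (intro open_Int open_ball open_vimage openT continuous_intros)
  have cover: "poly p -` T \<subseteq> (\<Union>w\<in>W. B w)"
  proof
    fix y assume y: "y \<in> poly p -` T"
    have "\<exists>x. x \<in> ball w (r w) \<and> poly p x = poly p y" if "w \<in> W" for w
    proof -
      have "poly p y \<in> poly p ` ball w (r w)" using y that unfolding T_def by blast
      then show ?thesis by (metis imageE)
    qed
    then obtain g where g: "\<And>w. w \<in> W \<Longrightarrow> g w \<in> ball w (r w)" "\<And>w. w \<in> W \<Longrightarrow> poly p (g w) = poly p y"
      by metis
    have "inj_on g W" using g(1) disj by (metis inj_onI)
    then have c: "card (g ` W) = degree p" using cardW by (simp add: card_image)
    let ?Y = "{x. poly (p - [:poly p y:]) x = 0}"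
    have "finite ?Y" using p0 by (rule poly_roots_finite)
    moreover have "card ?Y \<le> degree p" using card_poly_roots_bound[OF p0[of "poly p y"]] unfolding degree_diff_const .
    moreover have "g ` W \<subseteq> ?Y" using g by auto
    ultimately have "g ` W = ?Y" using c by (intro card_seteq) simp_all
    moreover have "y \<in> ?Y" by simp
    ultimately have "y \<in> g ` W" by (simp only:)
    then obtain w where "w \<in> W" "y = g w" by (rule imageE)
    then show "y \<in> (\<Union>w\<in>W. B w)" using g(1)[of w] y unfolding B_def by blast
  qed
  show "\<exists>T. v0 \<in> T \<and> openin (top_of_set V) T \<and>
          (\<exists>v. \<Union>v = poly p -` V \<inter> poly p -` T \<and> (\<forall>u\<in>v. openin (top_of_set (poly p -` V)) u) \<and>
               pairwise disjnt v \<and> (\<forall>u\<in>v. \<exists>q. homeomorphism u T (poly p) q))"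
  proof (intro exI[of _ T] exI[of _ "B ` W"] conjI ballI)
    show "v0 \<in> T" by fact
    show "openin (top_of_set V) T"
      using openT by (intro open_subset) (auto simp: T_def)
    show "\<Union> (B ` W) = poly p -` V \<inter> poly p -` T"
      using cover by (auto simp: B_def T_def)
    show "openin (top_of_set (poly p -` V)) u" if "u \<in> B ` W" for u
      using that Bopen by (intro open_subset) (auto simp: B_def T_def)
    show "pairwise disjnt (B ` W)"
    proof (rule pairwiseI)
      fix X Y assume "X \<in> B ` W" "Y \<in> B ` W" "X \<noteq> Y"
      then obtain w w' where "w \<in> W" "w' \<in> W" "X = B w" "Y = B w'" "w \<noteq> w'" by blast
      then show "disjnt X Y" using disj[of w w'] unfolding disjnt_def B_def by blast
    qed
    fix u assume "u \<in> B ` W"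
    then obtain w where w: "w \<in> W" "u = B w" by auto
    have "T \<subseteq> poly p ` ball w (r w)" using w by (auto simp: T_def)
    then have im: "poly p ` u = T" using w by (auto simp: B_def)
    have sub: "u \<subseteq> ball w (r w)" using w by (auto simp: B_def)
    have ou: "open u" using w Bopen by simp
    show "\<exists>q. homeomorphism u T (poly p) q"
    proof (rule homeomorphism_injective_open_map)
      show "continuous_on u (poly p)" by (intro continuous_intros)
      show "poly p ` u = T" by fact
      show "inj_on (poly p) u" using r(2)[OF w(1)] sub by (rule inj_on_subset)
      fix U assume "openin (top_of_set u) U"
      then have "open U" "U \<subseteq> u" using ou by (auto simp: openin_open_eq)
      then show "openin (top_of_set T) (poly p ` U)"
        using op[of U w] sub w im by (intro open_subset) auto
    qed auto
  qed
qed

text \<open>A disc is simply connected, so \<open>g\<close> lifts through the covering, and a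
  continuous lift through a holomorphic covering is holomorphic.\<close>

lemma holomorphic_lift_poly:
  fixes p :: "complex poly"
  assumes "degree p > 0" "open V" "\<And>w. poly p w \<in> V \<Longrightarrow> poly (pderiv p) w \<noteq> 0"
    and g: "g holomorphic_on ball c s" "g ` ball c s \<subseteq> V" "g c = poly p w" "s > 0"
  obtains h where "h holomorphic_on ball c s" "h c = w" "\<And>x. x \<in> ball c s \<Longrightarrow> poly p (h x) = g x"
proof -
  note cov = covering_space_poly[OF assms(1-3)]
  have "c \<in> ball c s" using g by auto
  moreover from this have "w \<in> poly p -` V" using g(2)[unfolded image_subset_iff] g(3) by (metis vimageI2)
  moreover have "g \<in> ball c s \<rightarrow> V" using g by auto
  ultimately obtain h where h: "continuous_on (ball c s) h" "h \<in> ball c s \<rightarrow> poly p -` V" "h c = w"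
    "\<And>y. y \<in> ball c s \<Longrightarrow> poly p (h y) = g y"
    using covering_space_lift_strong[OF cov _ _ _ _ holomorphic_on_imp_continuous_on[OF g(1)], of w c]
    using convex_imp_simply_connected[OF convex_ball] convex_imp_locally_path_connected[OF convex_ball] g(3)
    by metis
  have "h holomorphic_on ball c s"
    by (rule covering_space_lift_is_holomorphic[OF cov _ _ g(1) _ h(2,1,4)])
      (use g in \<open>auto intro!: holomorphic_intros open_vimage continuous_intros assms\<close>)
  then show ?thesis using that h by blast
qed

section \<open>Iterates of the fibre polynomials\<close>

lemma iterate_power: "((\<lambda>u::complex. u ^ d) ^^ n) z = z ^ (d ^ n)"
  by (induction n) (simp_all add: power_mult[symmetric] mult.commute)

lemma fibre_iterate_Suc:
  "fibre_iterate d a z (Suc n) w = poly (fibre_poly d a (z ^ (d ^ n))) (fibre_iterate d a z n w)"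
  by (simp add: iterate_power)

declare fibre_iterate.simps(2) [simp del]
declare fibre_iterate_Suc [simp]

lemma power_power_add: "(z ^ (d ^ m)) ^ (d ^ n) = (z :: complex) ^ (d ^ (m + n))"
  by (simp add: power_mult[symmetric] power_add)

lemma fibre_iterate_add:
  "fibre_iterate d a z (m + n) w = fibre_iterate d a (z ^ (d ^ m)) n (fibre_iterate d a z m w)"
  by (induction n) (simp_all add: power_power_add)

lemma fibre_iterate_rec:
  "fibre_iterate d a z (Suc n) w = fibre_iterate d a (z ^ d) n (poly (fibre_poly d a z) w)"
  using fibre_iterate_add[of d a z 1 n w] by simp

lemma skew_product_iterate:
  "(skew_product d a ^^ n) (z, w) = (z ^ (d ^ n), fibre_iterate d a z n w)"
  by (induction n) (auto simp: skew_product_def power_mult[symmetric] mult.commute)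

text \<open>The iterate as a polynomial gives access to its roots with multiplicity and to an
  algebraic derivative.\<close>

primrec fibre_iterate_poly :: "nat \<Rightarrow> param \<Rightarrow> complex \<Rightarrow> nat \<Rightarrow> complex poly" where
  "fibre_iterate_poly d a z 0 = [:0, 1:]"
| "fibre_iterate_poly d a z (Suc n) = fibre_poly d a (z ^ (d ^ n)) \<circ>\<^sub>p fibre_iterate_poly d a z n"

lemma poly_fibre_iterate_poly [simp]: "poly (fibre_iterate_poly d a z n) w = fibre_iterate d a z n w"
  by (induction n) (simp_all add: poly_pcompose)

lemma poly_fibre_poly:
  "poly (fibre_poly d a z) w = w ^ d + (\<Sum>j\<le>d - 2. (\<Sum>k\<le>d - j. a (j, k) ^ (d - j) * z ^ k) * w ^ j)"
  by (simp add: fibre_poly_def poly_sum poly_monom)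

lemma
  assumes "d \<ge> 2"
  shows degree_fibre_poly: "degree (fibre_poly d a z) = d"
    and lead_coeff_fibre_poly: "lead_coeff (fibre_poly d a z) = 1"
proof -
  let ?s = "\<Sum>j\<le>d - 2. monom (\<Sum>k\<le>d - j. a (j, k) ^ (d - j) * z ^ k) j"
  have "degree ?s \<le> d - 2"
    by (intro degree_sum_le order.trans[OF degree_monom_le]) auto
  then have lt: "degree ?s < degree (monom (1::complex) d)" using assms by (simp add: degree_monom_eq)
  show "degree (fibre_poly d a z) = d"
    unfolding fibre_poly_def using degree_add_eq_left[OF lt] by (simp add: degree_monom_eq)
  show "lead_coeff (fibre_poly d a z) = 1"
    unfolding fibre_poly_def add.commute[of "monom 1 d"] lead_coeff_add_le[OF lt]
    by (simp add: degree_monom_eq)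
qed

lemma
  assumes "d \<ge> 2"
  shows degree_fibre_iterate_poly: "degree (fibre_iterate_poly d a z n) = d ^ n"
    and lead_coeff_fibre_iterate_poly: "lead_coeff (fibre_iterate_poly d a z n) = 1"
proof -
  show *: "degree (fibre_iterate_poly d a z n) = d ^ n" for n
    by (induction n) (simp_all add: degree_pcompose degree_fibre_poly assms)
  show "lead_coeff (fibre_iterate_poly d a z n) = 1"
  proof (induction n)
    case (Suc n)
    then show ?case
      using assms lead_coeff_fibre_poly[OF assms] by (simp add: lead_coeff_comp * del: One_nat_def)
  qed simp
qed

abbreviation fibre_deriv :: "nat \<Rightarrow> param \<Rightarrow> complex \<Rightarrow> nat \<Rightarrow> complex \<Rightarrow> complex" where
  "fibre_deriv d a z n w \<equiv> poly (pderiv (fibre_iterate_poly d a z n)) w"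

lemma fibre_deriv_Suc:
  "fibre_deriv d a z (Suc n) w =
     poly (pderiv (fibre_poly d a (z ^ (d ^ n)))) (fibre_iterate d a z n w) * fibre_deriv d a z n w"
  by (simp add: pderiv_pcompose poly_pcompose)

lemma fibre_iterate_DERIV:
  "(fibre_iterate d a z n has_field_derivative fibre_deriv d a z n w) (at w within S)"
proof -
  have "fibre_iterate d a z n = poly (fibre_iterate_poly d a z n)" by auto
  then show ?thesis by (metis DERIV_subset poly_DERIV subset_UNIV)
qed

lemma continuous_on_fibre_poly [continuous_intros]:
  assumes "continuous_on S f" "continuous_on S g" "continuous_on S h"
  shows "continuous_on S (\<lambda>x. poly (fibre_poly d (f x) (g x)) (h x))"
  unfolding poly_fibre_poly
  by (intro continuous_intros assms continuous_on_product_then_coordinatewise[OF assms(1)])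

lemma pderiv_sum: "pderiv (\<Sum>i\<in>A. f i) = (\<Sum>i\<in>A. pderiv (f i))"
  by (induction A rule: infinite_finite_induct) (simp_all add: pderiv_add)

lemma continuous_on_pderiv_fibre_poly [continuous_intros]:
  assumes "continuous_on S f" "continuous_on S g" "continuous_on S h"
  shows "continuous_on S (\<lambda>x. poly (pderiv (fibre_poly d (f x) (g x))) (h x))"
  unfolding fibre_poly_def pderiv_add pderiv_sum pderiv_monom poly_add poly_sum poly_monom
  by (intro continuous_intros assms continuous_on_product_then_coordinatewise[OF assms(1)])

lemma continuous_on_fibre_iterate [continuous_intros]:
  assumes "continuous_on S f" "continuous_on S g" "continuous_on S h"
  shows "continuous_on S (\<lambda>x. fibre_iterate d (f x) (g x) n (h x))"
proof (induction n)
  case (Suc n)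
  then show ?case unfolding fibre_iterate_Suc by (intro continuous_intros assms)
qed (simp add: assms)

lemma continuous_on_fibre_deriv [continuous_intros]:
  assumes "continuous_on S f" "continuous_on S g" "continuous_on S h"
  shows "continuous_on S (\<lambda>x. fibre_deriv d (f x) (g x) n (h x))"
proof (induction n)
  case 0
  then show ?case by (simp add: pderiv_pCons)
next
  case (Suc n)
  then show ?case unfolding fibre_deriv_Suc by (intro continuous_intros assms)
qed

subsection \<open>Escape radii\<close>

text \<open>Base points range over a disc and not just over the circle, because averages over
  preimages are also taken at base points off the circle.\<close>

definition escape_radius :: "nat \<Rightarrow> param \<Rightarrow> real \<Rightarrow> real \<Rightarrow> bool" where
  "escape_radius d a B R \<longleftrightarrow> R > 0 \<and>
     (\<forall>z w. cmod z \<le> B \<longrightarrow> R \<le> cmod w \<longrightarrow> 2 * cmod w \<le> cmod (poly (fibre_poly d a z) w))"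

lemma escape_radius_mono: "escape_radius d a B R \<Longrightarrow> B' \<le> B \<Longrightarrow> R \<le> R' \<Longrightarrow> escape_radius d a B' R'"
  unfolding escape_radius_def by auto

text \<open>Apart from w^d the fibre polynomial has degree at most d - 2 in w, so the rest is
  bounded by C |w|^(d-2), with C uniform for coefficients within distance 1 of those of
  \<open>a\<close>. These are finitely many conditions, so \<open>U\<close> is open in the product
  topology.\<close>

lemma ex_escape_radius:
  assumes d: "d \<ge> 2" and B: "B \<ge> 1"
  obtains U R where "open U" "a \<in> U" "\<And>b. b \<in> U \<Longrightarrow> escape_radius d b B R"
proof -
  define U where "U = (\<Inter>i\<in>param_index d. {b::param. cmod (b i) < cmod (a i) + 1})"
  have "param_index d \<subseteq> {..d} \<times> {..d}" by (auto simp: param_index_def)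
  then have "finite (param_index d)" by (rule finite_subset) auto
  moreover have "open {b::param. cmod (b i) < cmod (a i) + 1}" for i
    by (intro open_Collect_less continuous_intros continuous_on_product_coordinates)
  ultimately have U: "open U" unfolding U_def by (intro open_INT) auto
  define C where "C = (\<Sum>j\<le>d - 2. \<Sum>k\<le>d - j. (cmod (a (j, k)) + 1) ^ (d - j) * B ^ k)"
  have C0: "C \<ge> 0" unfolding C_def using B by (intro sum_nonneg mult_nonneg_nonneg) auto
  \<comment> \<open>From |w| \<ge> 3 + C follows |w|^2 \<ge> 3|w| + C|w|, and C|w| \<ge> C, so |w|^2
    - C \<ge> 2|w|; the remaining factor |w|^(d-2) is at least 1.\<close>
  have "escape_radius d b B (3 + C)" if b: "b \<in> U" for b
    unfolding escape_radius_def
  proof (intro conjI allI impI)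
    fix z w assume z: "cmod z \<le> B" and w: "3 + C \<le> cmod w"
    have w1: "1 \<le> cmod w" using w C0 by simp
    have "cmod (\<Sum>j\<le>d - 2. (\<Sum>k\<le>d - j. b (j, k) ^ (d - j) * z ^ k) * w ^ j)
       \<le> (\<Sum>j\<le>d - 2. (\<Sum>k\<le>d - j. (cmod (a (j, k)) + 1) ^ (d - j) * B ^ k) * cmod w ^ (d - 2))"
    proof (rule sum_norm_le)
      fix j assume j: "j \<in> {..d - 2}"
      have "cmod (\<Sum>k\<le>d - j. b (j, k) ^ (d - j) * z ^ k)
          \<le> (\<Sum>k\<le>d - j. (cmod (a (j, k)) + 1) ^ (d - j) * B ^ k)"
      proof (rule sum_norm_le)
        fix k assume k: "k \<in> {..d - j}"
        have "cmod (b (j, k)) \<le> cmod (a (j, k)) + 1"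
          using b j k unfolding U_def param_index_def by fastforce
        then show "cmod (b (j, k) ^ (d - j) * z ^ k) \<le> (cmod (a (j, k)) + 1) ^ (d - j) * B ^ k"
          unfolding norm_mult norm_power using z B by (intro mult_mono power_mono) auto
      qed
      moreover from this have "0 \<le> (\<Sum>k\<le>d - j. (cmod (a (j, k)) + 1) ^ (d - j) * B ^ k)"
        by (rule order.trans[OF norm_ge_zero])
      moreover have "cmod w ^ j \<le> cmod w ^ (d - 2)" using j w1 by (intro power_increasing) auto
      ultimately show "cmod ((\<Sum>k\<le>d - j. b (j, k) ^ (d - j) * z ^ k) * w ^ j)
          \<le> (\<Sum>k\<le>d - j. (cmod (a (j, k)) + 1) ^ (d - j) * B ^ k) * cmod w ^ (d - 2)"
        unfolding norm_mult norm_power by (intro mult_mono) auto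
    qed
    also have "\<dots> = C * cmod w ^ (d - 2)" by (simp add: C_def sum_distrib_right)
    finally have low: "cmod (poly (fibre_poly d b z) w - w ^ d) \<le> C * cmod w ^ (d - 2)"
      by (simp add: poly_fibre_poly)
    have "d - 2 + 2 = d" using d by simp
    then have wd: "cmod (w ^ d) = cmod w ^ 2 * cmod w ^ (d - 2)"
      by (metis norm_power power_add mult.commute)
    have "(3 + C) * cmod w \<le> cmod w * cmod w" using w by (intro mult_right_mono) auto
    moreover have "C * 1 \<le> C * cmod w" using w1 C0 by (intro mult_left_mono) auto
    ultimately have *: "2 * cmod w \<le> cmod w ^ 2 - C" using w1 by (simp add: power2_eq_square algebra_simps)
    have "2 * cmod w * 1 \<le> (cmod w ^ 2 - C) * cmod w ^ (d - 2)"
      using * w1 by (intro mult_mono) (auto simp: one_le_power)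
    also have "\<dots> = cmod (w ^ d) - C * cmod w ^ (d - 2)" unfolding wd by (simp add: algebra_simps)
    also have "\<dots> \<le> cmod (poly (fibre_poly d b z) w)"
      using low norm_triangle_ineq2[of "w ^ d" "poly (fibre_poly d b z) w"] by (simp add: norm_minus_commute)
    finally show "2 * cmod w \<le> cmod (poly (fibre_poly d b z) w)" by simp
  qed (use C0 in simp)
  moreover have "a \<in> U" by (auto simp: U_def)
  ultimately show ?thesis using that U by blast
qed

text \<open>A base orbit that ends in a disc of radius B \<ge> 1 was there all the time; this
  supplies the hypothesis on base points in \<open>escape_backward\<close>.\<close>

lemma norm_power_le:
  assumes "B \<ge> 1" "cmod (z ^ M) \<le> B" "m \<le> M"
  shows "cmod (z ^ m) \<le> B"
proof (cases "cmod z \<le> 1")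
  case True
  then have "cmod z ^ m \<le> 1" by (intro power_le_one) auto
  then show ?thesis using assms by (simp add: norm_power)
next
  case False
  then have "cmod z ^ m \<le> cmod z ^ M" using assms by (intro power_increasing) auto
  then show ?thesis using assms by (simp add: norm_power)
qed

lemma escape_doubling:
  assumes "escape_radius d a B R" "R \<le> cmod (fibre_iterate d a z n w)"
    and "\<And>j. j < k \<Longrightarrow> cmod (z ^ (d ^ (n + j))) \<le> B"
  shows "2 ^ k * R \<le> cmod (fibre_iterate d a z (n + k) w)"
  using assms(3)
proof (induction k)
  case (Suc k)
  then have IH: "2 ^ k * R \<le> cmod (fibre_iterate d a z (n + k) w)" by auto
  have R: "R > 0" using assms(1) by (simp add: escape_radius_def)
  have "R * 1 \<le> R * 2 ^ k" using R by (intro mult_left_mono) auto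
  then have "R \<le> cmod (fibre_iterate d a z (n + k) w)" using IH by (simp add: mult.commute)
  then have "2 * cmod (fibre_iterate d a z (n + k) w) \<le> cmod (fibre_iterate d a z (n + Suc k) w)"
    using assms(1) Suc.prems[of k] by (simp add: escape_radius_def)
  then show ?case using IH by simp
qed (use assms in simp)

lemma escape_backward:
  assumes "escape_radius d a B R" "cmod (fibre_iterate d a z (n + k) w) < R"
    and "\<And>j. j < k \<Longrightarrow> cmod (z ^ (d ^ (n + j))) \<le> B"
  shows "cmod (fibre_iterate d a z n w) < R"
proof (rule ccontr)
  assume "\<not> ?thesis"
  then have "2 ^ k * R \<le> cmod (fibre_iterate d a z (n + k) w)"
    using escape_doubling[OF assms(1) _ assms(3)] by simp
  moreover have "1 * R \<le> 2 ^ k * R" using assms(1) by (intro mult_right_mono) (auto simp: escape_radius_def)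
  ultimately show False using assms(2) by simp
qed

lemma escape_backward_circle:
  assumes "escape_radius d a 1 R" "cmod z = 1" "cmod (fibre_iterate d a z (n + k) w) < R"
  shows "cmod (fibre_iterate d a z n w) < R"
  using escape_backward[OF assms(1,3)] assms(2) by (simp add: norm_power)

lemma bounded_orbit_iff:
  assumes "escape_radius d a 1 R" "cmod z = 1"
  shows "bounded (range (\<lambda>n. fibre_iterate d a z n w)) \<longleftrightarrow> (\<forall>n. cmod (fibre_iterate d a z n w) < R)"
proof
  assume "\<forall>n. cmod (fibre_iterate d a z n w) < R"
  then show "bounded (range (\<lambda>n. fibre_iterate d a z n w))" by (auto intro!: boundedI less_imp_le)
next
  assume "bounded (range (\<lambda>n. fibre_iterate d a z n w))"
  then obtain C where C: "\<And>n. cmod (fibre_iterate d a z n w) \<le> C" by (auto simp: bounded_iff)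
  show "\<forall>n. cmod (fibre_iterate d a z n w) < R"
  proof (rule ccontr)
    assume "\<not> ?thesis"
    then obtain n where n: "R \<le> cmod (fibre_iterate d a z n w)" by (auto simp: not_less)
    have R: "R > 0" using assms(1) by (simp add: escape_radius_def)
    obtain k where "C / R < 2 ^ k" using real_arch_pow[of 2 "C / R"] by auto
    then have "C < 2 ^ k * R" using R by (simp add: field_simps)
    moreover have "2 ^ k * R \<le> cmod (fibre_iterate d a z (n + k) w)"
      using escape_doubling[OF assms(1) n] assms(2) by (simp add: norm_power)
    ultimately show False using C[of "n + k"] by simp
  qed
qed

definition filled_set :: "nat \<Rightarrow> param \<Rightarrow> (complex \<times> complex) set" where
  "filled_set d a = {(z, w). cmod z = 1 \<and> bounded (range (\<lambda>n. fibre_iterate d a z n w))}"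

lemma filled_set_eq:
  assumes "escape_radius d a 1 R"
  shows "filled_set d a = {(z, w). cmod z = 1 \<and> (\<forall>n. cmod (fibre_iterate d a z n w) < R)}"
  unfolding filled_set_def using bounded_orbit_iff[OF assms] by auto

section \<open>Expansion in the fibres\<close>

text \<open>A holomorphic disc in \<open>V\<close> lifts through \<open>q\<close> to a disc that keeps the distance \<open>s\<close> from
  the complement of \<open>V\<close>, so it can be enlarged by the factor \<open>1 + s / (2 R)\<close>. This is the strict
  contraction of the Kobayashi metric by inverse branches.\<close>

lemma fibre_deriv_disc:
  assumes d: "d \<ge> 2"
    and V: "\<And>z. cmod z = 1 \<Longrightarrow> open (V z)" "\<And>z. cmod z = 1 \<Longrightarrow> V z \<subseteq> ball 0 R"
    and s: "s > 0" and R: "R > 0"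
    and step: "\<And>z w. cmod z = 1 \<Longrightarrow> poly (fibre_poly d a z) w \<in> V (z ^ d) \<Longrightarrow>
        ball w s \<subseteq> V z \<and> poly (pderiv (fibre_poly d a z)) w \<noteq> 0"
    and z: "cmod z = 1"
    and g: "g holomorphic_on ball 0 1" "g ` ball 0 1 \<subseteq> V (z ^ (d ^ k))" "g 0 = fibre_iterate d a z k w"
  shows "cmod (deriv g 0) * (1 + s / (2 * R)) ^ k \<le> 2 * R * cmod (fibre_deriv d a z k w)"
  using g
proof (induction k arbitrary: g)
  case 0
  have im: "g x \<in> ball 0 R" if "x \<in> ball 0 1" for x
  proof -
    have "g x \<in> V z" using 0 that by auto
    then show ?thesis using V(2)[OF z] by blast
  qed
  \<comment> \<open>Cauchy's estimate on the closed disc of radius 1/2, which lies in the domain of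
    \<open>g\<close>; this is where 2R instead of R comes from.\<close>
  have "cmod ((deriv ^^ 1) g 0) \<le> fact 1 * R / (1/2) ^ 1"
    by (rule Cauchy_inequality) (use im in \<open>auto simp: less_imp_le intro!: holomorphic_on_subset[OF 0(1)]
        holomorphic_on_imp_continuous_on[OF holomorphic_on_subset[OF 0(1)]]\<close>)
  then show ?case using 0 by (simp add: pderiv_pCons)
next
  case (Suc k)
  define z' where "z' = z ^ (d ^ k)"
  have z': "cmod z' = 1" using z by (simp add: z'_def norm_power)
  have z'd: "z ^ (d ^ Suc k) = z' ^ d" by (simp add: z'_def power_mult[symmetric] mult.commute)
  let ?p = "fibre_poly d a z'"
  let ?w = "fibre_iterate d a z k w"
  have "cmod (z' ^ d) = 1" using z' by (simp add: norm_power)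
  then have oV: "open (V (z' ^ d))" by (rule V)
  have "g 0 = poly ?p ?w" using Suc.prems(3) by (simp add: z'_def)
  moreover have "degree ?p > 0" using d by (simp add: degree_fibre_poly)
  moreover have "g ` ball 0 1 \<subseteq> V (z' ^ d)" using Suc.prems(2) by (simp only: z'd)
  moreover have "poly (pderiv ?p) w \<noteq> 0" if "poly ?p w \<in> V (z' ^ d)" for w
    using step[OF z' that] by blast
  ultimately obtain h where h: "h holomorphic_on ball 0 1" "h 0 = ?w" "\<And>x. x \<in> ball 0 1 \<Longrightarrow> poly ?p (h x) = g x"
    using holomorphic_lift_poly[OF _ oV _ Suc.prems(1) _ _ zero_less_one] by blast
  have sub: "ball (h x) s \<subseteq> V z'" if "x \<in> ball 0 1" for x
  proof -
    have "g x \<in> V (z' ^ d)" using Suc.prems(2) that unfolding z'd by blast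
    then show ?thesis using step[OF z', of "h x"] h(3)[OF that] by simp
  qed
  have hR: "cmod (h x) < R" if "x \<in> ball 0 1" for x
    using sub[OF that] V(2)[OF z'] s by (auto dest!: subsetD[of _ _ "h x"])
  \<comment> \<open>Scaling \<open>h\<close> about its centre by 1 + \<eta> moves \<open>h x\<close>
    by \<eta> |h(x) - h(0)| < s, so \<open>g2\<close> still takes values in \<open>V\<close> and the
    induction hypothesis applies to it.\<close>
  define \<eta> where "\<eta> = complex_of_real (s / (2 * R))"
  define g2 where "g2 x = h x + \<eta> * (h x - h 0)" for x
  have "g2 holomorphic_on ball 0 1" unfolding g2_def by (intro holomorphic_intros h)
  moreover have "g2 ` ball 0 1 \<subseteq> V (z ^ (d ^ k))"
  proof safe
    fix x :: complex assume x: "x \<in> ball 0 1"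
    have "cmod (h x - h 0) < 2 * R"
      using hR[OF x] hR[of 0] norm_triangle_ineq4[of "h x" "h 0"] by simp
    then have "s / (2 * R) * cmod (h x - h 0) < s / (2 * R) * (2 * R)"
      using s R by (intro mult_strict_left_mono) auto
    then have "dist (h x) (g2 x) < s"
      using s R by (simp add: g2_def \<eta>_def dist_norm norm_mult norm_divide)
    then show "g2 x \<in> V (z ^ (d ^ k))" using sub[OF x] by (auto simp: z'_def)
  qed
  moreover have "g2 0 = ?w" by (simp add: g2_def h)
  ultimately have IH: "cmod (deriv g2 0) * (1 + s / (2 * R)) ^ k \<le> 2 * R * cmod (fibre_deriv d a z k w)"
    by (rule Suc.IH)
  have hd: "(h has_field_derivative deriv h 0) (at 0)"
    using h(1) by (intro holomorphic_derivI[of _ "ball 0 1"]) auto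
  have "(g2 has_field_derivative (1 + \<eta>) * deriv h 0) (at 0)"
    unfolding g2_def by (auto intro!: derivative_eq_intros hd simp: algebra_simps)
  then have g2d: "deriv g2 0 = (1 + \<eta>) * deriv h 0" by (rule DERIV_imp_deriv)
  have "((\<lambda>x. poly ?p (h x)) has_field_derivative deriv h 0 * poly (pderiv ?p) (h 0)) (at 0)"
    by (rule DERIV_chain2[OF poly_DERIV hd, THEN DERIV_cong]) simp
  then have "(g has_field_derivative deriv h 0 * poly (pderiv ?p) (h 0)) (at 0)"
    by (rule has_field_derivative_transform_within[where d=1]) (use h(3) in auto)
  then have gd: "deriv g 0 = deriv h 0 * poly (pderiv ?p) (h 0)" by (rule DERIV_imp_deriv)
  have n1: "cmod (1 + \<eta>) = 1 + s / (2 * R)"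
  proof -
    have "1 + \<eta> = complex_of_real (1 + s / (2 * R))" by (simp add: \<eta>_def)
    then show ?thesis using s R by (simp only: norm_of_real) simp
  qed
  have "cmod (deriv g 0) * (1 + s / (2 * R)) ^ Suc k
      = cmod (poly (pderiv ?p) ?w) * (cmod (deriv g2 0) * (1 + s / (2 * R)) ^ k)"
    by (simp add: gd g2d h norm_mult n1)
  also have "\<dots> \<le> cmod (poly (pderiv ?p) ?w) * (2 * R * cmod (fibre_deriv d a z k w))"
    by (intro mult_left_mono IH) auto
  also have "\<dots> = 2 * R * cmod (fibre_deriv d a z (Suc k) w)"
    unfolding fibre_deriv_Suc by (simp add: norm_mult z'_def)
  finally show ?case .
qed

text \<open>Apply \<open>fibre_deriv_disc\<close> to the affine disc x \<mapsto> Q^k(w) + s x, whose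
  derivative is s.\<close>

lemma fibre_deriv_growth:
  assumes d: "d \<ge> 2"
    and V: "\<And>z. cmod z = 1 \<Longrightarrow> open (V z)" "\<And>z. cmod z = 1 \<Longrightarrow> V z \<subseteq> ball 0 R"
    and s: "s > 0" and R: "R > 0"
    and step: "\<And>z w. cmod z = 1 \<Longrightarrow> poly (fibre_poly d a z) w \<in> V (z ^ d) \<Longrightarrow>
        ball w s \<subseteq> V z \<and> poly (pderiv (fibre_poly d a z)) w \<noteq> 0"
    and z: "cmod z = 1" and ball: "ball (fibre_iterate d a z k w) s \<subseteq> V (z ^ (d ^ k))"
  shows "s * (1 + s / (2 * R)) ^ k \<le> 2 * R * cmod (fibre_deriv d a z k w)"
proof -
  define g where "g x = fibre_iterate d a z k w + of_real s * x" for x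
  have "(g has_field_derivative of_real s) (at 0)"
    unfolding g_def by (auto intro!: derivative_eq_intros)
  then have dg: "deriv g 0 = of_real s" by (rule DERIV_imp_deriv)
  have "g ` ball 0 1 \<subseteq> ball (fibre_iterate d a z k w) s"
    using s by (auto simp: g_def dist_norm norm_mult)
  then have im: "g ` ball 0 1 \<subseteq> V (z ^ (d ^ k))" using ball by (rule order.trans)
  have hol: "g holomorphic_on ball 0 1" unfolding g_def by (intro holomorphic_intros)
  have "g 0 = fibre_iterate d a z k w" by (simp add: g_def)
  from fibre_deriv_disc[OF d V s R step z hol im this]
  have "cmod (complex_of_real s) * (1 + s / (2 * R)) ^ k \<le> 2 * R * cmod (fibre_deriv d a z k w)"
    unfolding dg .
  then show ?thesis using s by (simp only: norm_of_real abs_of_pos)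
qed

lemma escape_step:
  assumes "escape_radius d a 1 R" "cmod z = 1" "R \<le> cmod (fibre_iterate d a z n w)"
  shows "2 * R \<le> cmod (fibre_iterate d a z (Suc n) w)"
  using escape_doubling[OF assms(1,3), of 1] assms(2) by (simp add: norm_power)

lemma escape_mono:
  assumes "escape_radius d a 1 R" "cmod z = 1" "R \<le> cmod (fibre_iterate d a z n w)" "n \<le> m"
  shows "R \<le> cmod (fibre_iterate d a z m w)"
proof -
  have "2 ^ (m - n) * R \<le> cmod (fibre_iterate d a z (n + (m - n)) w)"
    using assms(2) by (intro escape_doubling[OF assms(1,3)]) (simp add: norm_power)
  moreover have "1 * R \<le> 2 ^ (m - n) * R"
    using assms(1) by (intro mult_right_mono) (auto simp: escape_radius_def)
  ultimately show ?thesis using assms(4) by simp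
qed

text \<open>The critical points over the circle inside the closed disc of radius R form a compact
  set, covered by the open sets where the n-th iterate exceeds R in modulus. Finitely many n
  suffice, and since an escaped orbit never returns, their maximum serves for all.\<close>

lemma critical_points_escape:
  assumes "a \<in> escape_locus d" and R: "escape_radius d a 1 R"
  obtains N where "\<And>z c. cmod z = 1 \<Longrightarrow> poly (pderiv (fibre_poly d a z)) c = 0 \<Longrightarrow>
      R \<le> cmod (fibre_iterate d a z N c)"
proof -
  have R0: "R > 0" using R by (simp add: escape_radius_def)
  define K where "K = (sphere 0 1 \<times> cball 0 R) \<inter> {x. poly (pderiv (fibre_poly d a (fst x))) (snd x) = 0}"
  have "compact K" unfolding K_def
    by (intro compact_Int_closed compact_Times closed_Collect_eq continuous_intros) auto
  define G where "G n = {x. R < cmod (fibre_iterate d a (fst x) n (snd x))}" for n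
  have openG: "open (G n)" for n unfolding G_def by (intro open_Collect_less continuous_intros)
  have "K \<subseteq> (\<Union>n\<in>UNIV. G n)"
  proof
    fix x assume x: "x \<in> K"
    obtain z c where zc: "x = (z, c)" by (cases x)
    then have z: "cmod z = 1" and "poly (pderiv (fibre_poly d a z)) c = 0"
      using x by (auto simp: K_def)
    then have "\<not> bounded (range (\<lambda>n. fibre_iterate d a z n c))"
      using assms(1) by (auto simp: escape_locus_def)
    then obtain n where "R \<le> cmod (fibre_iterate d a z n c)"
      using bounded_orbit_iff[OF R z] by (auto simp: not_less)
    then have "2 * R \<le> cmod (fibre_iterate d a z (Suc n) c)" by (rule escape_step[OF R z])
    then have "R < cmod (fibre_iterate d a z (Suc n) c)" using R0 by linarith
    then show "x \<in> (\<Union>n\<in>UNIV. G n)" unfolding G_def zc by (intro UN_I[of "Suc n"]) simp_all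
  qed
  then obtain C where "C \<subseteq> UNIV" and C: "finite C" "K \<subseteq> (\<Union>n\<in>C. G n)"
    by (rule compactE_image[OF \<open>compact K\<close> openG])
  \<comment> \<open>The 0 covers the case of an empty subcover; critical points outside the disc
    have escaped at time 0.\<close>
  have "R \<le> cmod (fibre_iterate d a z (Max (insert 0 C)) c)"
    if z: "cmod z = 1" and c: "poly (pderiv (fibre_poly d a z)) c = 0" for z c
  proof (cases "cmod c \<le> R")
    case True
    then have "(z, c) \<in> K" using z c by (auto simp: K_def)
    then obtain n where n: "n \<in> C" "R < cmod (fibre_iterate d a z n c)" using C(2) by (auto simp: G_def)
    show ?thesis by (rule escape_mono[OF R z less_imp_le[OF n(2)]]) (use n(1) C(1) in auto)
  next
    case False
    show ?thesis by (rule escape_mono[OF R z, of 0]) (use False in auto)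
  qed
  then show ?thesis by (rule that)
qed

text \<open>Compactness again: over the circle the set |Q^(N+1)| \<le> R is compact and contained in
  the open set |Q^N| < R, because |Q^N| \<ge> R would force |Q^(N+1)| \<ge> 2R.\<close>

lemma tube_margin:
  assumes R: "escape_radius d a 1 R"
  obtains s where "s > 0" "\<And>z w. cmod z = 1 \<Longrightarrow> cmod (fibre_iterate d a z (Suc N) w) \<le> R \<Longrightarrow>
      ball w s \<subseteq> {v. cmod (fibre_iterate d a z N v) < R}"
proof -
  have R0: "R > 0" using R by (simp add: escape_radius_def)
  define K where "K = (sphere 0 1 \<times> cball 0 R) \<inter> {x. cmod (fibre_iterate d a (fst x) (Suc N) (snd x)) \<le> R}"
  have "compact K" unfolding K_def
    by (intro compact_Int_closed compact_Times closed_Collect_le continuous_intros) auto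
  define W where "W = {x. cmod (fibre_iterate d a (fst x) N (snd x)) < R}"
  have "open W" unfolding W_def by (intro open_Collect_less continuous_intros)
  have small: "cmod (fibre_iterate d a z n w) < R"
    if "cmod z = 1" "cmod (fibre_iterate d a z (Suc N) w) \<le> R" "n \<le> N" for z w n
  proof (rule ccontr)
    assume "\<not> ?thesis"
    then have "R \<le> cmod (fibre_iterate d a z N w)" using escape_mono[OF R that(1) _ that(3)] by simp
    then have "2 * R \<le> cmod (fibre_iterate d a z (Suc N) w)" by (rule escape_step[OF R that(1)])
    then show False using that R0 by linarith
  qed
  have "K \<subseteq> W" using small by (auto simp: K_def W_def)
  then obtain s where s: "s > 0" "(\<Union>x\<in>K. ball x s) \<subseteq> W"
    using compact_subset_open_imp_ball_epsilon_subset[OF \<open>compact K\<close> \<open>open W\<close>] by blast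
  have "ball w s \<subseteq> {v. cmod (fibre_iterate d a z N v) < R}"
    if z: "cmod z = 1" and w: "cmod (fibre_iterate d a z (Suc N) w) \<le> R" for z w
  proof
    fix v assume "v \<in> ball w s"
    then have "(z, v) \<in> ball (z, w) s" by (simp add: dist_prod_def)
    moreover have "(z, w) \<in> K" using small[OF z w, of 0] z w unfolding K_def by auto
    ultimately have "(z, v) \<in> W" using s(2) by blast
    then show "v \<in> {v. cmod (fibre_iterate d a z N v) < R}" by (simp add: W_def)
  qed
  then show ?thesis using that s(1) by blast
qed

text \<open>If M is an escape time for all critical points, the tube |Q^M| < R contains none of
  them, and its preimage keeps a distance s from its complement; so
  \<open>fibre_deriv_growth\<close> gives a geometric rate. The level returned is
  \<open>k + Suc M\<close>, so that Q^k(w) still has room s in the tube over its base point.\<close>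

lemma fibre_deriv_large:
  assumes d: "d \<ge> 2" and a: "a \<in> escape_locus d" and R: "escape_radius d a 1 R"
  obtains k N where "\<And>z w. cmod z = 1 \<Longrightarrow> cmod (fibre_iterate d a z N w) \<le> R \<Longrightarrow>
      C \<le> cmod (fibre_deriv d a z k w)"
proof -
  have R0: "R > 0" using R by (simp add: escape_radius_def)
  obtain M where M: "\<And>z c. cmod z = 1 \<Longrightarrow> poly (pderiv (fibre_poly d a z)) c = 0 \<Longrightarrow>
      R \<le> cmod (fibre_iterate d a z M c)"
    using critical_points_escape[OF a R] by blast
  obtain s where s: "s > 0" "\<And>z w. cmod z = 1 \<Longrightarrow> cmod (fibre_iterate d a z (Suc M) w) \<le> R \<Longrightarrow>
      ball w s \<subseteq> {v. cmod (fibre_iterate d a z M v) < R}"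
    using tube_margin[OF R] by blast
  define V where "V z = {v. cmod (fibre_iterate d a z M v) < R}" for z
  have V1: "open (V z)" if "cmod z = 1" for z unfolding V_def by (intro open_Collect_less continuous_intros)
  have V2: "V z \<subseteq> ball 0 R" if "cmod z = 1" for z
    using escape_backward_circle[OF R that, of 0 M] by (auto simp: V_def)
  have step: "ball w s \<subseteq> V z \<and> poly (pderiv (fibre_poly d a z)) w \<noteq> 0"
    if z: "cmod z = 1" and w: "poly (fibre_poly d a z) w \<in> V (z ^ d)" for z w
  proof -
    have "cmod (fibre_iterate d a z (Suc M) w) < R" using w unfolding V_def fibre_iterate_rec by simp
    then have sub: "ball w s \<subseteq> V z" using s(2)[OF z] unfolding V_def by simp
    moreover have "w \<in> ball w s" using s(1) by simp
    ultimately have "w \<in> V z" by blast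
    then show ?thesis using sub M[OF z] unfolding V_def by force
  qed
  define \<eta> where "\<eta> = 1 + s / (2 * R)"
  have "\<eta> > 1" using s(1) R0 by (simp add: \<eta>_def)
  then obtain k where k: "2 * R * C / s < \<eta> ^ k" using real_arch_pow by blast
  have "C \<le> cmod (fibre_deriv d a z k w)"
    if z: "cmod z = 1" and w: "cmod (fibre_iterate d a z (k + Suc M) w) \<le> R" for z w
  proof -
    have z': "cmod (z ^ (d ^ k)) = 1" using z by (simp add: norm_power)
    have bl: "ball (fibre_iterate d a z k w) s \<subseteq> V (z ^ (d ^ k))"
      using s(2)[OF z'] w unfolding fibre_iterate_add V_def by simp
    have "s * \<eta> ^ k \<le> 2 * R * cmod (fibre_deriv d a z k w)"
      unfolding \<eta>_def
      by (intro fibre_deriv_growth[where V=V and d=d and a=a and z=z and k=k and w=w])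
        (fact d V1 V2 s(1) R0 step z bl)+
    moreover have "2 * R * C < s * \<eta> ^ k" using k s(1) by (simp add: field_simps)
    ultimately have "2 * R * C < 2 * R * cmod (fibre_deriv d a z k w)" by linarith
    then show ?thesis using R0 by simp
  qed
  then show ?thesis by (rule that)
qed

text \<open>The type of parameters is an infinite product and not locally compact. Uniformity near
  \<open>a\<close> therefore comes from the tube lemma over the compact set of pairs (z, w), not
  from a compact neighbourhood of \<open>a\<close>.\<close>

lemma uniform_near_parameter:
  fixes G :: "param \<Rightarrow> complex \<Rightarrow> complex \<Rightarrow> complex"
  assumes cont: "continuous_on UNIV (\<lambda>p. G (fst p) (fst (snd p)) (snd (snd p)))"
    and \<epsilon>: "\<epsilon> > 0"
  obtains U where "open U" "a \<in> U"
    "\<And>b z w. b \<in> U \<Longrightarrow> cmod z = 1 \<Longrightarrow> cmod w \<le> R \<Longrightarrow> cmod (G b z w - G a z w) < \<epsilon>"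
proof -
  define D :: "(complex \<times> complex) set" where "D = sphere 0 1 \<times> cball 0 R"
  have "compact D" unfolding D_def by (intro compact_Times) auto
  have "continuous_on UNIV (\<lambda>p::param \<times> complex \<times> complex. (a, snd p))" by (intro continuous_intros)
  then have "continuous_on UNIV (\<lambda>p::param \<times> complex \<times> complex. G a (fst (snd p)) (snd (snd p)))"
    using continuous_on_compose2[OF cont, of UNIV "\<lambda>p. (a, snd p)"] by simp
  then have op: "open {p. cmod (G (fst p) (fst (snd p)) (snd (snd p)) - G a (fst (snd p)) (snd (snd p))) < \<epsilon>}"
    by (intro open_Collect_less continuous_intros cont)
  have "\<exists>X0. a \<in> X0 \<and> open X0 \<and> X0 \<times> D \<subseteq>
      {p. cmod (G (fst p) (fst (snd p)) (snd (snd p)) - G a (fst (snd p)) (snd (snd p))) < \<epsilon>}"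
    by (rule Elementary_Topology.tube_lemma[OF \<open>compact D\<close> op]) (use \<epsilon> in auto)
  then obtain U where U: "a \<in> U" "open U" "U \<times> D \<subseteq>
      {p. cmod (G (fst p) (fst (snd p)) (snd (snd p)) - G a (fst (snd p)) (snd (snd p))) < \<epsilon>}" by blast
  have "cmod (G b z w - G a z w) < \<epsilon>" if "b \<in> U" "cmod z = 1" "cmod w \<le> R" for b z w
    using subsetD[OF U(3), of "(b, z, w)"] that by (simp add: D_def)
  then show ?thesis using that U by blast
qed

text \<open>The constants serve a whole neighbourhood \<open>U\<close> of \<open>a\<close>, since
  shadowing compares two maps with the same constants. The escape radius R / 2 leaves room for
  perturbing the tubes of radius R.\<close>

lemma fibre_expansion:
  assumes d: "d \<ge> 2" and a: "a \<in> escape_locus d"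
  obtains R1 where "R1 > 0"
    "\<And>R. R1 \<le> R \<Longrightarrow> \<exists>k N \<delta> U. \<delta> > 0 \<and> open U \<and> a \<in> U \<and>
      (\<forall>b\<in>U. escape_radius d b 1 (R / 2)) \<and>
      (\<forall>b\<in>U. \<forall>z w y1 y2. cmod z = 1 \<longrightarrow> cmod (fibre_iterate d b z N w) < R \<longrightarrow>
         dist w y1 \<le> \<delta> \<longrightarrow> dist w y2 \<le> \<delta> \<longrightarrow>
         4 * dist y1 y2 \<le> dist (fibre_iterate d b z k y1) (fibre_iterate d b z k y2)) \<and>
      (\<forall>b\<in>U. \<forall>c\<in>U. \<forall>z w. cmod z = 1 \<longrightarrow> cmod w \<le> R \<longrightarrow>
         dist (fibre_iterate d b z k w) (fibre_iterate d c z k w) \<le> \<delta> / 2 \<and>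
         dist (fibre_iterate d b z N w) (fibre_iterate d c z N w) \<le> R / 4)"
proof -
  obtain U0 R0 where U0: "open U0" "a \<in> U0" "\<And>b. b \<in> U0 \<Longrightarrow> escape_radius d b 1 R0"
    using ex_escape_radius[OF d, of 1 a] by auto
  have R0: "R0 > 0" using U0(3)[OF U0(2)] by (simp add: escape_radius_def)
  show ?thesis
  proof (rule that[of "2 * R0"])
    fix R assume RR: "2 * R0 \<le> R"
    have R: "R > 0" using RR R0 by linarith
    have esc2: "escape_radius d b 1 (R / 2)" if "b \<in> U0" for b
      using escape_radius_mono[OF U0(3)[OF that]] RR by simp
    have esc: "escape_radius d b 1 R" if "b \<in> U0" for b
      using escape_radius_mono[OF esc2[OF that]] R by simp
    \<comment> \<open>8 leaves slack: the variation of the derivative with the parameter and over a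
      disc of radius \<delta> costs at most 2, and the remaining 6 exceeds the asserted factor
      4.\<close>
    obtain k N where kN: "\<And>z w. cmod z = 1 \<Longrightarrow> cmod (fibre_iterate d a z N w) \<le> R \<Longrightarrow>
        8 \<le> cmod (fibre_deriv d a z k w)"
      by (rule fibre_deriv_large[where C = 8, OF d a esc[OF U0(2)]]) (rule that)
    define D' :: "(complex \<times> complex) set" where "D' = sphere 0 1 \<times> cball 0 (R + 1)"
    have "compact D'" unfolding D'_def by (intro compact_Times) auto
    then have "uniformly_continuous_on D' (\<lambda>x. fibre_deriv d a (fst x) k (snd x))"
      by (rule compact_uniformly_continuous[rotated]) (intro continuous_intros)
    then have "\<forall>e>0. \<exists>\<delta>0>0. \<forall>x\<in>D'. \<forall>y\<in>D'. dist y x < \<delta>0 \<longrightarrow>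
        dist (fibre_deriv d a (fst y) k (snd y)) (fibre_deriv d a (fst x) k (snd x)) < e"
      unfolding uniformly_continuous_on_def .
    from this[THEN spec, of 1]
    obtain \<delta>0 where \<delta>0: "\<delta>0 > 0" "\<forall>x\<in>D'. \<forall>y\<in>D'. dist y x < \<delta>0 \<longrightarrow>
        dist (fibre_deriv d a (fst y) k (snd y)) (fibre_deriv d a (fst x) k (snd x)) < 1"
      using zero_less_one by metis
    define \<delta> where "\<delta> = min 1 (\<delta>0 / 2)"
    have \<delta>: "\<delta> > 0" "\<delta> \<le> 1" "\<delta> < \<delta>0" using \<delta>0(1) by (auto simp: \<delta>_def)
    have cD: "continuous_on UNIV (\<lambda>p. fibre_deriv d (fst p) (fst (snd p)) k (snd (snd p)))"
      by (rule continuous_on_fibre_deriv; intro continuous_intros)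
    have cF: "continuous_on UNIV (\<lambda>p. fibre_iterate d (fst p) (fst (snd p)) n (snd (snd p)))" for n
      by (rule continuous_on_fibre_iterate; intro continuous_intros)
    have pos: "\<delta> / 4 > 0" "R / 2 > 0" "R / 8 > 0" using \<delta> R by auto
    obtain U1 where U1: "open U1" "a \<in> U1" "\<And>b z w. b \<in> U1 \<Longrightarrow> cmod z = 1 \<Longrightarrow> cmod w \<le> R + 1 \<Longrightarrow>
        cmod (fibre_deriv d b z k w - fibre_deriv d a z k w) < 1"
      by (rule uniform_near_parameter[where a = a and R = "R + 1", OF cD zero_less_one]) (rule that)
    obtain U2 where U2: "open U2" "a \<in> U2" "\<And>b z w. b \<in> U2 \<Longrightarrow> cmod z = 1 \<Longrightarrow> cmod w \<le> R \<Longrightarrow>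
        cmod (fibre_iterate d b z k w - fibre_iterate d a z k w) < \<delta> / 4"
      by (rule uniform_near_parameter[where a = a and R = R, OF cF pos(1)]) (rule that)
    obtain U3 where U3: "open U3" "a \<in> U3" "\<And>b z w. b \<in> U3 \<Longrightarrow> cmod z = 1 \<Longrightarrow> cmod w \<le> R \<Longrightarrow>
        cmod (fibre_iterate d b z N w - fibre_iterate d a z N w) < R / 2"
      by (rule uniform_near_parameter[where a = a and R = R, OF cF pos(2)]) (rule that)
    obtain U4 where U4: "open U4" "a \<in> U4" "\<And>b z w. b \<in> U4 \<Longrightarrow> cmod z = 1 \<Longrightarrow> cmod w \<le> R \<Longrightarrow>
        cmod (fibre_iterate d b z (Suc N) w - fibre_iterate d a z (Suc N) w) < R / 8"
      by (rule uniform_near_parameter[where a = a and R = R, OF cF pos(3)]) (rule that)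
    define U where "U = U0 \<inter> U1 \<inter> U2 \<inter> U3 \<inter> U4"
    have exp: "4 * dist y1 y2 \<le> dist (fibre_iterate d b z k y1) (fibre_iterate d b z k y2)"
      if b: "b \<in> U" and z: "cmod z = 1" and w: "cmod (fibre_iterate d b z (Suc N) w) < R"
        and y: "dist w y1 \<le> \<delta>" "dist w y2 \<le> \<delta>" for b z w y1 y2
    proof -
      have b': "b \<in> U0" "b \<in> U1" "b \<in> U3" using b by (auto simp: U_def)
      \<comment> \<open>In the tube of \<open>b\<close> at level \<open>Suc N\<close> one has |Q^N|
        < R / 2; the change of parameter adds less than R / 2, so \<open>w\<close> is in the tube of
        \<open>a\<close> at level \<open>N\<close>, where \<open>kN\<close> applies.\<close>
      have "cmod (fibre_iterate d b z N w) < R / 2"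
        using escape_step[OF esc2[OF b'(1)] z, of N w] w by fastforce
      then have wR: "cmod w < R / 2" and "cmod (fibre_iterate d b z N w) < R / 2"
        using escape_backward_circle[OF esc2[OF b'(1)] z, of 0 N w] by auto
      moreover have "cmod (fibre_iterate d b z N w - fibre_iterate d a z N w) < R / 2"
        using wR R by (intro U3(3) b' z) linarith
      ultimately have "cmod (fibre_iterate d a z N w) \<le> R"
        using norm_triangle_ineq2[of "fibre_iterate d a z N w" "fibre_iterate d b z N w"]
        by (simp add: norm_minus_commute)
      then have big: "8 \<le> cmod (fibre_deriv d a z k w)" by (rule kN[OF z])
      define D where "D = fibre_deriv d a z k w"
      have near: "cmod (fibre_deriv d b z k x - D) \<le> 2" if x: "x \<in> cball w \<delta>" for x
      proof -
        have xR: "cmod x \<le> R + 1"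
          using x wR R \<delta>(2) norm_triangle_ineq2[of x w] by (simp add: dist_norm norm_minus_commute)
        have "cmod (fibre_deriv d b z k x - fibre_deriv d a z k x) < 1" by (rule U1(3)[OF b'(2) z xR])
        moreover have "dist (fibre_deriv d a z k x) D < 1"
        proof -
          have "(z, w) \<in> D'" "(z, x) \<in> D'" using z xR wR R by (auto simp: D'_def)
          moreover have "dist (z, x) (z, w) < \<delta>0" using x \<delta>(3) by (simp add: dist_prod_def dist_commute)
          ultimately show ?thesis using \<delta>0(2) unfolding D_def by fastforce
        qed
        ultimately show ?thesis
          using norm_triangle_ineq[of "fibre_deriv d b z k x - fibre_deriv d a z k x" "fibre_deriv d a z k x - D"]
          by (simp add: dist_norm)
      qed
      \<comment> \<open>Mean value inequality on a convex disc for Q^k(x) - D x, whose derivative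
        has modulus at most 2.\<close>
      have "cmod ((fibre_iterate d b z k y1 - D * y1) - (fibre_iterate d b z k y2 - D * y2)) \<le> 2 * cmod (y1 - y2)"
      proof (rule field_differentiable_bound[of "cball w \<delta>"])
        fix x assume x: "x \<in> cball w \<delta>"
        show "((\<lambda>x. fibre_iterate d b z k x - D * x) has_field_derivative fibre_deriv d b z k x - D) (at x within cball w \<delta>)"
          by (auto intro!: derivative_eq_intros fibre_iterate_DERIV)
        show "cmod (fibre_deriv d b z k x - D) \<le> 2" by (rule near[OF x])
      qed (use y in auto)
      moreover have "8 * cmod (y1 - y2) \<le> cmod (D * (y1 - y2))"
        using big by (simp add: norm_mult mult_right_mono D_def)
      moreover have "cmod (D * (y1 - y2)) \<le> cmod (fibre_iterate d b z k y1 - fibre_iterate d b z k y2) +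
          cmod ((fibre_iterate d b z k y1 - D * y1) - (fibre_iterate d b z k y2 - D * y2))"
        by (rule order.trans[OF _ norm_triangle_ineq4]) (simp add: algebra_simps)
      moreover have "0 \<le> cmod (y1 - y2)" by simp
      ultimately show ?thesis unfolding dist_norm by linarith
    qed
    have close: "dist (fibre_iterate d b z k w) (fibre_iterate d c z k w) \<le> \<delta> / 2 \<and>
        dist (fibre_iterate d b z (Suc N) w) (fibre_iterate d c z (Suc N) w) \<le> R / 4"
      if "b \<in> U" "c \<in> U" "cmod z = 1" "cmod w \<le> R" for b c z w
    proof
      have "dist (fibre_iterate d b z k w) (fibre_iterate d a z k w) < \<delta> / 4"
        "dist (fibre_iterate d c z k w) (fibre_iterate d a z k w) < \<delta> / 4"
        using U2(3) that by (auto simp: U_def dist_norm)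
      then show "dist (fibre_iterate d b z k w) (fibre_iterate d c z k w) \<le> \<delta> / 2"
        using dist_triangle2[of "fibre_iterate d b z k w" "fibre_iterate d c z k w" "fibre_iterate d a z k w"]
        by simp
      have "dist (fibre_iterate d b z (Suc N) w) (fibre_iterate d a z (Suc N) w) < R / 8"
        "dist (fibre_iterate d c z (Suc N) w) (fibre_iterate d a z (Suc N) w) < R / 8"
        using U4(3) that by (simp_all only: U_def dist_norm Int_iff)
      then show "dist (fibre_iterate d b z (Suc N) w) (fibre_iterate d c z (Suc N) w) \<le> R / 4"
        using dist_triangle2[of "fibre_iterate d b z (Suc N) w" "fibre_iterate d c z (Suc N) w" "fibre_iterate d a z (Suc N) w"]
        by linarith
    qed
    have "open U" "a \<in> U" using U0 U1 U2 U3 U4 by (auto simp: U_def intro!: open_Int)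
    moreover have "\<forall>b\<in>U. escape_radius d b 1 (R / 2)" using esc2 by (auto simp: U_def)
    ultimately show "\<exists>k N \<delta> U. \<delta> > 0 \<and> open U \<and> a \<in> U \<and>
      (\<forall>b\<in>U. escape_radius d b 1 (R / 2)) \<and>
      (\<forall>b\<in>U. \<forall>z w y1 y2. cmod z = 1 \<longrightarrow> cmod (fibre_iterate d b z N w) < R \<longrightarrow>
         dist w y1 \<le> \<delta> \<longrightarrow> dist w y2 \<le> \<delta> \<longrightarrow>
         4 * dist y1 y2 \<le> dist (fibre_iterate d b z k y1) (fibre_iterate d b z k y2)) \<and>
      (\<forall>b\<in>U. \<forall>c\<in>U. \<forall>z w. cmod z = 1 \<longrightarrow> cmod w \<le> R \<longrightarrow>
         dist (fibre_iterate d b z k w) (fibre_iterate d c z k w) \<le> \<delta> / 2 \<and>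
         dist (fibre_iterate d b z N w) (fibre_iterate d c z N w) \<le> R / 4)"
      using exp close \<delta>(1) by (intro exI[of _ k] exI[of _ "Suc N"] exI[of _ \<delta>] exI[of _ U]) blast
  qed (use R0 in simp)
qed

section \<open>Preimages as multisets\<close>

lemma rel_mset_union:
  assumes "rel_mset S A B" "rel_mset S C D"
  shows "rel_mset S (A + C) (B + D)"
  using assms by (induction rule: rel_mset_induct) (simp_all add: rel_mset_Plus)

lemma rel_mset_sum_mset:
  assumes "rel_mset S A B" "\<And>x y. x \<in># A \<Longrightarrow> y \<in># B \<Longrightarrow> S x y \<Longrightarrow> rel_mset T (f x) (g y)"
  shows "rel_mset T (\<Sum>x\<in>#A. f x) (\<Sum>y\<in>#B. g y)"
  using assms
proof (induction rule: rel_mset_induct)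
  case (add S a b M N)
  then have "rel_mset T (f a) (g b)" "rel_mset T (\<Sum>x\<in>#M. f x) (\<Sum>y\<in>#N. g y)" by auto
  then show ?case by (simp add: rel_mset_union)
qed (simp add: rel_mset_Zero)

lemma rel_mset_dist_trans:
  assumes "rel_mset (\<lambda>x y. dist x y \<le> e1) A B" "rel_mset (\<lambda>x y. dist x y \<le> e2) B C"
  shows "rel_mset (\<lambda>x y. dist x y \<le> e1 + e2) A C"
proof -
  have "rel_mset ((\<lambda>x y. dist x y \<le> e1) OO (\<lambda>x y. dist x y \<le> e2)) A C"
    using assms by (subst multiset.rel_compp) blast
  then show ?thesis
  proof (rule multiset.rel_mono_strong)
    fix x z assume "((\<lambda>x y. dist x y \<le> e1) OO (\<lambda>x y. dist x y \<le> e2)) x z"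
    then obtain y where "dist x y \<le> e1" "dist y z \<le> e2" by auto
    then show "dist x z \<le> e1 + e2" using dist_triangle[of x z y] by simp
  qed
qed

lemma rel_mset_dist_sym:
  assumes "rel_mset (\<lambda>x y. dist x y \<le> e) A B" shows "rel_mset (\<lambda>x y. dist x y \<le> e) B A"
proof -
  have "rel_mset (\<lambda>x y. dist x y \<le> e)\<inverse>\<inverse> B A" using assms by (simp add: multiset.rel_conversep)
  then show ?thesis by (rule multiset.rel_mono_strong) (simp add: dist_commute)
qed

lemma rel_mset_dist_mono:
  assumes "rel_mset (\<lambda>x y. dist x y \<le> e) A B" "e \<le> e'"
  shows "rel_mset (\<lambda>x y. dist x y \<le> e') A B"
  using assms(1) by (rule multiset.rel_mono_strong) (use assms(2) in auto)

lemma rel_mset_obtain: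
  assumes "rel_mset S A B" "x \<in># A"
  obtains y where "y \<in># B" "S x y"
  using assms by (induction arbitrary: thesis rule: rel_mset_induct) auto

text \<open>With multiplicity the number of preimages is the same for every \<open>v\<close>, so
  that \<open>rel_mset\<close> of a closeness relation can pair off two families
  bijectively.\<close>

definition fibre_preimages :: "nat \<Rightarrow> param \<Rightarrow> complex \<Rightarrow> nat \<Rightarrow> complex \<Rightarrow> complex multiset" where
  "fibre_preimages d a z n v = proots (fibre_iterate_poly d a z n - [:v:])"

lemma fibre_iterate_poly_diff_nz:
  assumes "d \<ge> 2" shows "fibre_iterate_poly d a z n - [:v:] \<noteq> 0"
proof
  assume "fibre_iterate_poly d a z n - [:v:] = 0"
  then have "degree (fibre_iterate_poly d a z n) = 0" by (simp add: degree_pCons_0)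
  then show False using assms by (simp add: degree_fibre_iterate_poly)
qed

lemma set_fibre_preimages: "d \<ge> 2 \<Longrightarrow> w \<in># fibre_preimages d a z n v \<longleftrightarrow> fibre_iterate d a z n w = v"
  unfolding fibre_preimages_def using set_count_proots[OF fibre_iterate_poly_diff_nz[of d a z n v]] by simp

lemma size_fibre_preimages: "d \<ge> 2 \<Longrightarrow> size (fibre_preimages d a z n v) = d ^ n"
  by (simp add: fibre_preimages_def size_proots_complex degree_fibre_iterate_poly)

lemma lead_coeff_diff_const: "degree p > 0 \<Longrightarrow> lead_coeff (p - [:v:]) = lead_coeff (p :: complex poly)"
  by (cases "degree p") (auto simp: coeff_pCons split: nat.splits)

lemma lead_coeff_fibre_iterate_poly_diff:
  "d \<ge> 2 \<Longrightarrow> lead_coeff (fibre_iterate_poly d a z n - [:v:]) = 1"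
  using lead_coeff_fibre_iterate_poly[of d a z n]
  by (subst lead_coeff_diff_const) (simp_all add: degree_fibre_iterate_poly)

lemma proots_prod_image_mset:
  fixes f :: "'a \<Rightarrow> complex poly"
  assumes "\<And>x. x \<in># A \<Longrightarrow> f x \<noteq> 0"
  shows "proots (\<Prod>x\<in>#A. f x) = (\<Sum>x\<in>#A. proots (f x))"
  using assms
proof (induction A)
  case (add x A)
  have "(\<Prod>x\<in>#A. f x) \<noteq> 0" using add.prems by (auto simp: prod_mset_zero_iff)
  then show ?case using add by (simp add: proots_mult)
qed simp

text \<open>Q^n - v splits into linear factors; substituting Q^m turns it into the product of Q^m -
  y over the preimages y, which accounts for multiplicities.\<close>

lemma fibre_preimages_add:
  assumes d: "d \<ge> 2"
  shows "fibre_preimages d a z (m + n) v =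
    (\<Sum>y\<in>#fibre_preimages d a (z ^ (d ^ m)) n v. fibre_preimages d a z m y)"
proof -
  let ?A = "fibre_preimages d a (z ^ (d ^ m)) n v"
  have eq: "fibre_iterate_poly d a z (m + n) - [:v:] = (\<Prod>y\<in>#?A. fibre_iterate_poly d a z m - [:y:])"
  proof (rule poly_ext)
    fix x
    show "poly (fibre_iterate_poly d a z (m + n) - [:v:]) x = poly (\<Prod>y\<in>#?A. fibre_iterate_poly d a z m - [:y:]) x"
      using poly_eq_prod_proots[OF lead_coeff_fibre_iterate_poly_diff[OF d], of a "z ^ (d ^ m)" n v "fibre_iterate d a z m x"]
      by (simp add: poly_prod_mset fibre_iterate_add fibre_preimages_def)
  qed
  show ?thesis
    unfolding fibre_preimages_def[of d a z "m + n"] eq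
    by (subst proots_prod_image_mset) (simp_all add: fibre_preimages_def[symmetric] fibre_iterate_poly_diff_nz[OF d] del: right_minus_eq)
qed

section \<open>Continuous dependence of preimages on the base point\<close>

lemma continuous_on_coeff_power:
  assumes "\<And>i. continuous_on S (\<lambda>x. coeff (q x) i)"
  shows "continuous_on S (\<lambda>x. coeff (q x ^ n) j :: complex)"
proof (induction n arbitrary: j)
  case (Suc n)
  then show ?case by (simp add: coeff_mult) (intro continuous_intros assms)
qed simp

lemma pcompose_as_sum: "pcompose p q = (\<Sum>i\<le>degree p. smult (coeff p i) (q ^ i))"
  for p q :: "complex poly"
  by (rule poly_ext) (simp add: poly_pcompose poly_sum poly_altdef[of p])

lemma continuous_on_coeff_pcompose:
  fixes p q :: "'a::topological_space \<Rightarrow> complex poly"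
  assumes "\<And>i. continuous_on S (\<lambda>x. coeff (p x) i)" "\<And>i. continuous_on S (\<lambda>x. coeff (q x) i)"
    and "\<And>x. degree (p x) = n"
  shows "continuous_on S (\<lambda>x. coeff (pcompose (p x) (q x)) j)"
  unfolding pcompose_as_sum assms(3) coeff_sum coeff_smult
  by (intro continuous_intros assms(1) continuous_on_coeff_power assms(2))

lemma continuous_on_coeff_fibre_poly:
  "continuous_on UNIV (\<lambda>z. coeff (fibre_poly d a z) j)"
proof -
  have "continuous_on UNIV (\<lambda>z. coeff (monom (\<Sum>k\<le>d - i. a (i, k) ^ (d - i) * z ^ k) i) j)" for i
    by (cases "i = j") (auto intro!: continuous_intros)
  then show ?thesis unfolding fibre_poly_def coeff_add coeff_sum by (intro continuous_intros)
qed

lemma continuous_on_coeff_fibre_iterate_poly: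
  assumes "d \<ge> 2"
  shows "continuous_on UNIV (\<lambda>z. coeff (fibre_iterate_poly d a z n) j)"
proof (induction n arbitrary: j)
  case (Suc n)
  have "continuous_on UNIV (\<lambda>z. coeff (fibre_poly d a (z ^ (d ^ n))) i)" for i
    by (rule continuous_on_compose2[OF continuous_on_coeff_fibre_poly]) (auto intro!: continuous_intros)
  then show ?case
    unfolding fibre_iterate_poly.simps
    by (rule continuous_on_coeff_pcompose[OF _ Suc degree_fibre_poly[OF assms]])
qed simp

lemma fibre_preimages_tendsto:
  fixes z v :: "nat \<Rightarrow> complex"
  assumes d: "d \<ge> 2" and "z \<longlonglongrightarrow> z0" "v \<longlonglongrightarrow> v0" "\<epsilon> > 0"
  shows "\<forall>\<^sub>F i in sequentially.
    rel_mset (\<lambda>x y. dist x y \<le> \<epsilon>) (fibre_preimages d a (z i) n (v i)) (fibre_preimages d a z0 n v0)"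
  unfolding fibre_preimages_def
proof (rule proots_tendsto)
  fix j
  have "(\<lambda>i. coeff (fibre_iterate_poly d a (z i) n) j) \<longlonglongrightarrow> coeff (fibre_iterate_poly d a z0 n) j"
    using continuous_on_coeff_fibre_iterate_poly[OF d] assms(2)
    by (auto intro!: continuous_on_tendsto_compose[of UNIV "\<lambda>z. coeff (fibre_iterate_poly d a z n) j"])
  moreover have "(\<lambda>i. coeff [:v i:] j) \<longlonglongrightarrow> coeff [:v0:] j"
    using assms(3) by (cases j) auto
  ultimately show "(\<lambda>i. coeff (fibre_iterate_poly d a (z i) n - [:v i:]) j) \<longlonglongrightarrow>
      coeff (fibre_iterate_poly d a z0 n - [:v0:]) j"
    unfolding coeff_diff by (rule tendsto_diff)
qed (use assms(4) lead_coeff_fibre_iterate_poly_diff[OF d] degree_fibre_iterate_poly[OF d] in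
    \<open>simp_all only: degree_diff_const\<close>)

text \<open>Uniform continuity of roots by contradiction: along a subsequence of violating triples,
  \<open>v\<close> and \<open>v'\<close> have the same limit, and both families of preimages
  converge to the one over it.\<close>

lemma fibre_preimages_uniform:
  assumes d: "d \<ge> 2" and \<epsilon>: "\<epsilon> > 0"
  shows "\<exists>\<tau>>0. \<forall>z v v'. cmod z = 1 \<longrightarrow> cmod v \<le> R \<longrightarrow> dist v v' \<le> \<tau> \<longrightarrow>
    rel_mset (\<lambda>x y. dist x y \<le> \<epsilon>) (fibre_preimages d a z n v) (fibre_preimages d a z n v')"
proof (rule ccontr)
  assume neg: "\<not> ?thesis"
  have "\<exists>z v v'. cmod z = 1 \<and> cmod v \<le> R \<and> dist v v' \<le> inverse (Suc i) \<and>
      \<not> rel_mset (\<lambda>x y. dist x y \<le> \<epsilon>) (fibre_preimages d a z n v) (fibre_preimages d a z n v')" for i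
  proof (rule ccontr)
    assume "\<not> ?thesis"
    then have "inverse (real (Suc i)) > 0 \<and> (\<forall>z v v'. cmod z = 1 \<longrightarrow> cmod v \<le> R \<longrightarrow> dist v v' \<le> inverse (Suc i) \<longrightarrow>
      rel_mset (\<lambda>x y. dist x y \<le> \<epsilon>) (fibre_preimages d a z n v) (fibre_preimages d a z n v'))" by auto
    then show False using neg by blast
  qed
  then obtain z v v' where zv: "\<And>i. cmod (z i) = 1" "\<And>i. cmod (v i) \<le> R" "\<And>i. dist (v i) (v' i) \<le> inverse (Suc i)"
      "\<And>i. \<not> rel_mset (\<lambda>x y. dist x y \<le> \<epsilon>) (fibre_preimages d a (z i) n (v i)) (fibre_preimages d a (z i) n (v' i))"
    by metis
  have "compact (sphere (0::complex) 1 \<times> cball (0::complex) R)" by (intro compact_Times) auto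
  moreover have "\<forall>i. (z i, v i) \<in> sphere 0 1 \<times> cball 0 R" using zv by auto
  ultimately obtain l s where l: "l \<in> sphere 0 1 \<times> cball (0::complex) R" "strict_mono s"
      "((\<lambda>i. (z i, v i)) \<circ> s) \<longlonglongrightarrow> l"
    using seq_compactE[OF compact_imp_seq_compact, of "sphere 0 1 \<times> cball 0 R" "\<lambda>i. (z i, v i)"] by metis
  have zl: "(\<lambda>i. z (s i)) \<longlonglongrightarrow> fst l" and vl: "(\<lambda>i. v (s i)) \<longlonglongrightarrow> snd l"
    using tendsto_fst[OF l(3)] tendsto_snd[OF l(3)] by (auto simp: o_def)
  have "(\<lambda>i. dist (v i) (v' i)) \<longlonglongrightarrow> 0"
    by (rule tendsto_sandwich[OF _ _ tendsto_const LIMSEQ_inverse_real_of_nat]) (use zv(3) in auto)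
  then have "(\<lambda>i. dist (v' i) (v i)) \<longlonglongrightarrow> 0" by (simp add: dist_commute)
  then have "(\<lambda>i. v' i - v i) \<longlonglongrightarrow> 0" by (simp add: dist_norm tendsto_norm_zero_iff)
  then have "(\<lambda>i. v' (s i) - v (s i)) \<longlonglongrightarrow> 0" using LIMSEQ_subseq_LIMSEQ[OF _ l(2)] by (fastforce simp: o_def)
  then have v'l: "(\<lambda>i. v' (s i)) \<longlonglongrightarrow> snd l" using tendsto_add[OF vl] by fastforce
  have "\<epsilon> / 2 > 0" using \<epsilon> by simp
  note fibre_preimages_tendsto[OF d zl vl this, of a n] fibre_preimages_tendsto[OF d zl v'l this, of a n]
  then have "\<forall>\<^sub>F i in sequentially. False"
  proof eventually_elim
    case (elim i)
    have "rel_mset (\<lambda>x y. dist x y \<le> \<epsilon>/2 + \<epsilon>/2) (fibre_preimages d a (z (s i)) n (v (s i))) (fibre_preimages d a (z (s i)) n (v' (s i)))"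
      using elim by (intro rel_mset_dist_trans[OF _ rel_mset_dist_sym])
    then show False using zv(4) by simp
  qed
  then show False by simp
qed

section \<open>Matching of preimages\<close>

text \<open>The conclusion of \<open>fibre_expansion\<close> for a single parameter. Only
  \<open>w\<close> has to lie in the tube; \<open>y1\<close> and \<open>y2\<close> are merely within
  \<delta> of it, so expansion can be used on points not yet known to be in the tube.\<close>

locale expanding_fibres =
  fixes d :: nat and a :: param and R :: real and k N :: nat and \<delta> :: real
  assumes d: "d \<ge> 2" and escape: "escape_radius d a 1 R" and \<delta>: "\<delta> > 0"
    and expand: "\<And>z w y1 y2. cmod z = 1 \<Longrightarrow> cmod (fibre_iterate d a z N w) < R \<Longrightarrow>
      dist w y1 \<le> \<delta> \<Longrightarrow> dist w y2 \<le> \<delta> \<Longrightarrow>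
      4 * dist y1 y2 \<le> dist (fibre_iterate d a z k y1) (fibre_iterate d a z k y2)"
begin

lemma R_pos: "R > 0" using escape by (simp add: escape_radius_def)

lemma inj_on_fibre_iterate:
  assumes "cmod z = 1" "cmod (fibre_iterate d a z N u) < R"
  shows "inj_on (fibre_iterate d a z k) (ball u \<delta>)"
proof (rule inj_onI)
  fix x y assume "x \<in> ball u \<delta>" "y \<in> ball u \<delta>" "fibre_iterate d a z k x = fibre_iterate d a z k y"
  then show "x = y" using expand[OF assms, of x y] by simp
qed

lemma holo_fibre_iterate: "fibre_iterate d a z n holomorphic_on S"
  by (rule holomorphic_on_subset[of _ UNIV])
    (auto simp: holomorphic_on_def field_differentiable_def intro!: exI fibre_iterate_DERIV)

text \<open>Q^k is open on the disc of radius \<delta> about \<open>u\<close> and sends its boundary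
  circle to distance at least 4 \<delta> from Q^k(u), so the image covers the disc of that
  radius.\<close>

lemma inverse_step:
  assumes "cmod z = 1" "cmod (fibre_iterate d a z N u) < R" "dist (fibre_iterate d a z k u) y < 4 * \<delta>"
  obtains u' where "dist u u' < \<delta>" "fibre_iterate d a z k u' = y"
proof -
  have "ball (fibre_iterate d a z k u) (4 * \<delta>) \<subseteq> fibre_iterate d a z k ` ball u \<delta>"
  proof (rule ball_subset_open_map_image)
    show "continuous_on (closure (ball u \<delta>)) (fibre_iterate d a z k)" by (intro continuous_intros)
    show "open (fibre_iterate d a z k ` interior (ball u \<delta>))"
      using open_mapping_thm3[OF holo_fibre_iterate open_ball inj_on_fibre_iterate[OF assms(1,2)]] by simp
    fix x assume "x \<in> frontier (ball u \<delta>)"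
    then have "dist u x = \<delta>" using \<delta> by simp
    then show "4 * \<delta> \<le> norm (fibre_iterate d a z k x - fibre_iterate d a z k u)"
      using expand[OF assms(1,2), of x u] \<delta> by (simp add: dist_norm norm_minus_commute)
  qed (use \<delta> in auto)
  then show ?thesis using assms(3) that by (auto simp: subset_iff image_iff)
qed

text \<open>All preimages of \<open>y\<close> are simple, being in the tube, and each can be
  followed to a preimage of \<open>y'\<close> at distance at most \<epsilon> / 4. No two are
  followed to the same point, since they would be within \<delta> of each other, where Q^k is
  injective. Counting shows that no preimage of \<open>y'\<close> is missed.\<close>

lemma match_step:
  assumes z: "cmod z = 1" and tube: "\<And>u. fibre_iterate d a z k u = y \<Longrightarrow> cmod (fibre_iterate d a z N u) < R"
    and y: "dist y y' \<le> \<epsilon>" "\<epsilon> \<le> \<delta>"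
  shows "rel_mset (\<lambda>x y. dist x y \<le> \<epsilon> / 4) (fibre_preimages d a z k y) (fibre_preimages d a z k y')"
proof -
  define A where "A = {u. fibre_iterate d a z k u = y}"
  let ?p = "fibre_iterate_poly d a z k - [:y:]"
  have fin: "finite A" using poly_roots_finite[OF fibre_iterate_poly_diff_nz[OF d], of a z k y] by (simp add: A_def)
  have nz: "poly (pderiv ?p) u \<noteq> 0" if "poly ?p u = 0" for u
  proof -
    have u: "fibre_iterate d a z k u = y" using that by simp
    have "deriv (fibre_iterate d a z k) u \<noteq> 0"
      using holomorphic_injective_imp_regular[OF holo_fibre_iterate open_ball inj_on_fibre_iterate[OF z tube[OF u]], of u] \<delta>
      by simp
    then show ?thesis
      using DERIV_imp_deriv[OF fibre_iterate_DERIV[of d a z k u UNIV]] by (simp add: pderiv_diff pderiv_pCons)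
  qed
  have fA: "fibre_preimages d a z k y = mset_set A"
    unfolding fibre_preimages_def A_def using proots_simple(1)[OF nz fibre_iterate_poly_diff_nz[OF d]] by simp
  have "\<exists>u'. dist u u' < \<delta> \<and> fibre_iterate d a z k u' = y'" if "u \<in> A" for u
  proof -
    have "dist (fibre_iterate d a z k u) y' < 4 * \<delta>" using that y \<delta> by (simp add: A_def)
    then show ?thesis using inverse_step[OF z tube, of u y'] that unfolding A_def by blast
  qed
  then obtain g where g: "\<And>u. u \<in> A \<Longrightarrow> dist u (g u) < \<delta>" "\<And>u. u \<in> A \<Longrightarrow> fibre_iterate d a z k (g u) = y'" by metis
  have gd: "dist u (g u) \<le> \<epsilon> / 4" if "u \<in> A" for u
    using expand[OF z tube, of u u "g u"] that g[OF that] y \<delta> by (simp add: A_def)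
  have inj: "inj_on g A"
  proof (rule inj_onI)
    fix u1 u2 assume u: "u1 \<in> A" "u2 \<in> A" "g u1 = g u2"
    have "dist u1 u2 \<le> \<delta>"
      using gd[OF u(1)] gd[OF u(2)] u(3) y(2) \<delta> dist_triangle2[of u1 u2 "g u1"] by simp
    then show "u1 = u2" using expand[OF z tube, of u1 u1 u2] u \<delta> by (simp add: A_def)
  qed
  have sub: "mset_set (g ` A) \<subseteq># fibre_preimages d a z k y'"
  proof (rule mset_subset_eqI)
    fix x show "count (mset_set (g ` A)) x \<le> count (fibre_preimages d a z k y') x"
    proof (cases "x \<in> g ` A")
      case True
      then have "x \<in># fibre_preimages d a z k y'" using g by (auto simp: set_fibre_preimages[OF d])
      then show ?thesis using fin True by (simp add: count_mset_set' Suc_leI)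
    qed (simp add: count_mset_set')
  qed
  have "size (mset_set (g ` A)) = size (fibre_preimages d a z k y')"
    using arg_cong[OF fA, of size] by (simp add: size_fibre_preimages[OF d] card_image[OF inj])
  then have "mset_set (g ` A) = fibre_preimages d a z k y'"
    using sub by (metis mset_subset_size subset_mset.le_less order_less_irrefl)
  then have gA: "fibre_preimages d a z k y' = image_mset g (mset_set A)"
    by (simp add: image_mset_mset_set[OF inj])
  have "rel_mset (\<lambda>x y. dist x (g y) \<le> \<epsilon> / 4) (mset_set A) (mset_set A)"
    using gd fin by (intro multiset.rel_refl_strong) auto
  then show ?thesis unfolding fA gA multiset.rel_map(2) by simp
qed

text \<open>Pulling back \<open>k\<close> levels at a time divides the distance of matched points by
  4. The tube condition is imposed on \<open>v\<close> alone: it passes to all preimages of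
  \<open>v\<close> by \<open>escape_backward_circle\<close>, while those of \<open>v'\<close> are
  reached by closeness.\<close>

lemma match_iterate:
  assumes z: "cmod z = 1" and v: "cmod (fibre_iterate d a (z ^ (d ^ (k * j))) N v) < R" "dist v v' \<le> \<delta>"
  shows "rel_mset (\<lambda>x y. dist x y \<le> \<delta> / 4 ^ j) (fibre_preimages d a z (k * j) v) (fibre_preimages d a z (k * j) v')"
  using z v(1)
proof (induction j arbitrary: z)
  case 0
  have "proots (fibre_iterate_poly d a z 0 - [:x:]) = {#x#}" for x
  proof -
    have "fibre_iterate_poly d a z 0 - [:x:] = [:-x, 1:]" by simp
    then show ?thesis by (simp only: proots_linear_factor minus_minus)
  qed
  then show ?case using v(2) by (simp add: fibre_preimages_def rel_mset_Plus rel_mset_Zero del: fibre_iterate_poly.simps)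
next
  case (Suc j)
  define z' where "z' = z ^ (d ^ k)"
  have z': "cmod z' = 1" using Suc.prems by (simp add: z'_def norm_power)
  have pw: "z ^ (d ^ (k * Suc j)) = z' ^ (d ^ (k * j))" by (simp add: z'_def power_power_add)
  have IH: "rel_mset (\<lambda>x y. dist x y \<le> \<delta> / 4 ^ j) (fibre_preimages d a z' (k * j) v) (fibre_preimages d a z' (k * j) v')"
    using Suc.prems(2) unfolding pw by (rule Suc.IH[OF z'])
  have small: "\<delta> / 4 ^ j \<le> \<delta>" using \<delta> by (simp add: field_simps)
  have "rel_mset (\<lambda>x y. dist x y \<le> \<delta> / 4 ^ j / 4) (fibre_preimages d a z (k + k * j) v) (fibre_preimages d a z (k + k * j) v')"
    unfolding fibre_preimages_add[OF d] z'_def[symmetric]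
  proof (rule rel_mset_sum_mset[OF IH], rule match_step[OF Suc.prems(1) _ _ small])
    fix y y' u
    assume y: "y \<in># fibre_preimages d a z' (k * j) v" "fibre_iterate d a z k u = y"
    then have "fibre_iterate d a z (k * Suc j) u = v"
      by (simp add: set_fibre_preimages[OF d] fibre_iterate_add z'_def)
    then have "cmod (fibre_iterate d a z (k * Suc j + N) u) < R"
      using Suc.prems(2) by (simp only: fibre_iterate_add)
    then show "cmod (fibre_iterate d a z N u) < R"
      by (subst (asm) add.commute) (rule escape_backward_circle[OF escape Suc.prems(1)])
  qed
  then show ?case by (simp add: mult.commute)
qed

text \<open>Two obstacles: \<open>v\<close> may be a critical value, expansion being available only
  deeper in the tube, and \<open>v\<close> and \<open>v'\<close> may be far apart. The
  \<open>N\<close> levels next to \<open>v\<close> are therefore crossed by uniform continuity of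
  roots, and the segment from \<open>v\<close> to \<open>v'\<close> is cut into \<open>T\<close>
  pieces of length at most \<tau>, whose errors \<delta> / 4^j add up to at most \<epsilon>.\<close>

lemma matching:
  assumes \<epsilon>: "\<epsilon> > 0"
  obtains m where "\<And>z v v'. cmod z = 1 \<Longrightarrow> cmod v < R \<Longrightarrow> cmod v' < R \<Longrightarrow>
    rel_mset (\<lambda>x y. dist x y \<le> \<epsilon>) (fibre_preimages d a z m v) (fibre_preimages d a z m v')"
proof -
  obtain \<tau> where \<tau>: "\<tau> > 0" "\<And>z v v'. cmod z = 1 \<Longrightarrow> cmod v \<le> R \<Longrightarrow> dist v v' \<le> \<tau> \<Longrightarrow>
    rel_mset (\<lambda>x y. dist x y \<le> \<delta>) (fibre_preimages d a z N v) (fibre_preimages d a z N v')"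
    using fibre_preimages_uniform[OF d \<delta>, of R a N] by blast
  obtain T where "2 * R / \<tau> < real T" using reals_Archimedean2 by blast
  moreover from this have "T > 0" using R_pos \<tau>(1) by (intro Nat.gr0I) (auto simp: field_simps)
  ultimately have T: "T > 0" "2 * R / T \<le> \<tau>" using \<tau>(1) by (auto simp: field_simps)
  obtain j where "real T * \<delta> / \<epsilon> < 4 ^ j" using real_arch_pow[of 4] by auto
  then have j: "real T * (\<delta> / 4 ^ j) \<le> \<epsilon>" using \<epsilon> by (simp add: field_simps)
  have near: "rel_mset (\<lambda>x y. dist x y \<le> \<delta> / 4 ^ j) (fibre_preimages d a z (k * j + N) v) (fibre_preimages d a z (k * j + N) v')"
    if z: "cmod z = 1" and v: "cmod v < R" "dist v v' \<le> \<tau>" for z v v'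
    unfolding fibre_preimages_add[OF d]
  proof (rule rel_mset_sum_mset)
    have "cmod (z ^ (d ^ (k * j))) = 1" using z by (simp add: norm_power)
    then show "rel_mset (\<lambda>x y. dist x y \<le> \<delta>) (fibre_preimages d a (z ^ (d ^ (k * j))) N v) (fibre_preimages d a (z ^ (d ^ (k * j))) N v')"
      using v by (intro \<tau>(2)) auto
    fix y y' assume "y \<in># fibre_preimages d a (z ^ (d ^ (k * j))) N v" "dist y y' \<le> \<delta>"
    then show "rel_mset (\<lambda>x y. dist x y \<le> \<delta> / 4 ^ j) (fibre_preimages d a z (k * j) y) (fibre_preimages d a z (k * j) y')"
      using v(1) by (intro match_iterate[OF z]) (simp_all add: set_fibre_preimages[OF d])
  qed
  have "rel_mset (\<lambda>x y. dist x y \<le> \<epsilon>) (fibre_preimages d a z (k * j + N) v) (fibre_preimages d a z (k * j + N) v')"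
    if z: "cmod z = 1" and v: "cmod v < R" "cmod v' < R" for z v v'
  proof -
    define c where "c i = v + of_real (real i / real T) * (v' - v)" for i
    have cR: "cmod (c i) < R" if "i \<le> T" for i
    proof -
      have "v + of_real s * (v' - v) = (1 - s) *\<^sub>R v + s *\<^sub>R v'" for s
        by (simp add: scaleR_conv_of_real algebra_simps)
      then have "c i = (1 - real i / real T) *\<^sub>R v + (real i / real T) *\<^sub>R v'"
        by (simp only: c_def)
      then have "c i \<in> ball 0 R"
        using v T that by (simp only:) (rule convexD_alt[OF convex_ball], auto)
      then show ?thesis by simp
    qed
    have cstep: "dist (c i) (c (Suc i)) \<le> \<tau>" for i
    proof -
      have "c i - c (Suc i) = of_real (1 / real T) * (v - v')"
        by (simp add: c_def algebra_simps add_divide_distrib minus_divide_left)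
      then have "dist (c i) (c (Suc i)) = (1 / real T) * cmod (v - v')"
        by (simp only: dist_norm norm_mult norm_of_real) simp
      also have "\<dots> \<le> (1 / real T) * (2 * R)"
        using norm_triangle_ineq4[of v v'] v by (intro mult_left_mono) auto
      finally show ?thesis using T(2) by simp
    qed
    have "rel_mset (\<lambda>x y. dist x y \<le> real i * (\<delta> / 4 ^ j)) (fibre_preimages d a z (k * j + N) v) (fibre_preimages d a z (k * j + N) (c i))"
      if "i \<le> T" for i
      using that
    proof (induction i)
      case 0
      then show ?case by (simp add: c_def multiset.rel_refl)
    next
      case (Suc i)
      have "rel_mset (\<lambda>x y. dist x y \<le> real i * (\<delta> / 4 ^ j) + \<delta> / 4 ^ j) (fibre_preimages d a z (k * j + N) v) (fibre_preimages d a z (k * j + N) (c (Suc i)))"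
        using Suc by (intro rel_mset_dist_trans[OF Suc.IH near] z cR cstep) auto
      moreover have "real i * (\<delta> / 4 ^ j) + \<delta> / 4 ^ j = real (Suc i) * (\<delta> / 4 ^ j)" by (simp add: field_simps)
      ultimately show ?case by (simp only:)
    qed
    from this[of T] have "rel_mset (\<lambda>x y. dist x y \<le> real T * (\<delta> / 4 ^ j)) (fibre_preimages d a z (k * j + N) v) (fibre_preimages d a z (k * j + N) v')"
      using T(1) by (simp add: c_def)
    then show ?thesis using j by (rule rel_mset_dist_mono)
  qed
  then show ?thesis by (rule that)
qed

end

lemma ex_expanding_fibres:
  assumes d: "d \<ge> 2" and a: "a \<in> escape_locus d"
  obtains R1 where "R1 > 0" "\<And>R. R1 \<le> R \<Longrightarrow> \<exists>k N \<delta>. expanding_fibres d a R k N \<delta>"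
proof -
  obtain R1 where R1: "R1 > 0" "\<And>R. R1 \<le> R \<Longrightarrow> \<exists>k N \<delta> U. \<delta> > 0 \<and> open U \<and> a \<in> U \<and>
      (\<forall>b\<in>U. escape_radius d b 1 (R / 2)) \<and>
      (\<forall>b\<in>U. \<forall>z w y1 y2. cmod z = 1 \<longrightarrow> cmod (fibre_iterate d b z N w) < R \<longrightarrow>
         dist w y1 \<le> \<delta> \<longrightarrow> dist w y2 \<le> \<delta> \<longrightarrow>
         4 * dist y1 y2 \<le> dist (fibre_iterate d b z k y1) (fibre_iterate d b z k y2)) \<and>
      (\<forall>b\<in>U. \<forall>c\<in>U. \<forall>z w. cmod z = 1 \<longrightarrow> cmod w \<le> R \<longrightarrow>
         dist (fibre_iterate d b z k w) (fibre_iterate d c z k w) \<le> \<delta> / 2 \<and>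
         dist (fibre_iterate d b z N w) (fibre_iterate d c z N w) \<le> R / 4)"
    by (rule fibre_expansion[OF d a]) (rule that)
  have "\<exists>k N \<delta>. expanding_fibres d a R k N \<delta>" if "R1 \<le> R" for R
  proof -
    from R1(2)[OF that] obtain k N \<delta> U where *: "\<delta> > 0" "a \<in> U" "\<forall>b\<in>U. escape_radius d b 1 (R / 2)"
      "\<forall>b\<in>U. \<forall>z w y1 y2. cmod z = 1 \<longrightarrow> cmod (fibre_iterate d b z N w) < R \<longrightarrow>
         dist w y1 \<le> \<delta> \<longrightarrow> dist w y2 \<le> \<delta> \<longrightarrow>
         4 * dist y1 y2 \<le> dist (fibre_iterate d b z k y1) (fibre_iterate d b z k y2)"
      by (elim exE conjE) (rule that)
    have "escape_radius d a 1 R"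
      using * R1(1) that escape_radius_mono[of d a 1 "R/2" 1 R] by auto
    then have "expanding_fibres d a R k N \<delta>"
      using * d by unfold_locales blast+
    then show ?thesis by blast
  qed
  then show ?thesis using that R1(1) by blast
qed

section \<open>Equidistribution of iterated preimages\<close>

lemma sum_mset_rel_le:
  fixes f g :: "'a \<Rightarrow> real"
  assumes "rel_mset S A B" "\<And>x y. x \<in># A \<Longrightarrow> y \<in># B \<Longrightarrow> S x y \<Longrightarrow> \<bar>f x - g y\<bar> \<le> \<eta>"
  shows "\<bar>(\<Sum>x\<in>#A. f x) - (\<Sum>y\<in>#B. g y)\<bar> \<le> \<eta> * real (size A)"
  using assms
proof (induction rule: rel_mset_induct)
  case (add S a b M N)
  have "\<bar>f a - g b\<bar> \<le> \<eta>" "\<bar>(\<Sum>x\<in>#M. f x) - (\<Sum>y\<in>#N. g y)\<bar> \<le> \<eta> * real (size M)"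
    using add by auto
  then show ?case by (simp add: algebra_simps)
qed simp

lemma sum_mset_const_diff_le:
  fixes f :: "'a \<Rightarrow> real"
  assumes "\<And>x. x \<in># A \<Longrightarrow> \<bar>f x - c\<bar> \<le> \<eta>"
  shows "\<bar>(\<Sum>x\<in>#A. f x) - c * real (size A)\<bar> \<le> \<eta> * real (size A)"
  using assms
proof (induction A)
  case (add x A)
  have "\<bar>f x - c\<bar> \<le> \<eta>" "\<bar>(\<Sum>x\<in>#A. f x) - c * real (size A)\<bar> \<le> \<eta> * real (size A)"
    using add by auto
  then show ?case by (simp add: algebra_simps)
qed simp

definition fibre_average ::
    "nat \<Rightarrow> param \<Rightarrow> nat \<Rightarrow> (complex \<times> complex \<Rightarrow> real) \<Rightarrow> complex \<Rightarrow> complex \<Rightarrow> real" where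
  "fibre_average d a n \<phi> z v = (\<Sum>u\<in>#fibre_preimages d a z n v. \<phi> (z, u)) / real (d ^ n)"

text \<open>The normalised counting measure on f^(-n)(z0, v), tested on \<phi>. Taking
  \<open>proots\<close> in the base keeps total mass 1 and continuity at z0 = 0, where all roots
  collapse.\<close>

definition pullback_average ::
    "nat \<Rightarrow> param \<Rightarrow> nat \<Rightarrow> (complex \<times> complex \<Rightarrow> real) \<Rightarrow> complex \<times> complex \<Rightarrow> real" where
  "pullback_average d a n \<phi> = (\<lambda>(z0, v). (\<Sum>z\<in>#proots (monom 1 (d ^ n) - [:z0:]). fibre_average d a n \<phi> z v) / real (d ^ n))"

lemma pullback_average_eq:
  assumes "d \<ge> 2" "z0 \<noteq> 0"
  shows "pullback_average d a n \<phi> (z0, v) = (\<Sum>z | z ^ (d ^ n) = z0. fibre_average d a n \<phi> z v) / real (d ^ n)"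
proof -
  have D: "d ^ n > 0" using assms(1) by simp
  have "proots (monom 1 (d ^ n) - [:z0:]) = mset_set {z. poly (monom 1 (d ^ n) - [:z0:]) z = 0}"
  proof (rule proots_simple(1))
    show "monom 1 (d ^ n) - [:z0:] \<noteq> 0"
      using D by (metis degree_diff_const degree_0 degree_monom_eq less_irrefl one_neq_zero)
    show "poly (pderiv (monom 1 (d ^ n) - [:z0:])) z \<noteq> 0" if "poly (monom 1 (d ^ n) - [:z0:]) z = 0" for z
      using that assms D by (auto simp: pderiv_diff pderiv_monom pderiv_pCons poly_monom)
  qed
  then show ?thesis by (simp add: pullback_average_def poly_monom sum_unfold_sum_mset)
qed

lemma fibre_average_add:
  assumes "d \<ge> 2"
  shows "fibre_average d a (m + k) \<phi> z v =
    (\<Sum>y\<in>#fibre_preimages d a (z ^ (d ^ m)) k v. fibre_average d a m \<phi> z y) / real (d ^ k)"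
proof -
  have "(\<Sum>u\<in>#(\<Sum>y\<in>#A. f y). g u) = (\<Sum>y\<in>#A. \<Sum>u\<in>#f y. g u)" for A and f :: "complex \<Rightarrow> complex multiset" and g :: "complex \<Rightarrow> real"
    by (induction A) auto
  moreover have "(\<Sum>y\<in>#A. f y / c) = (\<Sum>y\<in>#A. f y) / c" for A and f :: "complex \<Rightarrow> real" and c
    by (induction A) (auto simp: add_divide_distrib)
  ultimately show ?thesis
    by (simp add: fibre_average_def fibre_preimages_add[OF assms] power_add)
qed

lemma fibre_average_diff_le:
  assumes "d \<ge> 2"
    and "\<And>y. y \<in># fibre_preimages d a (z ^ (d ^ m)) k v \<Longrightarrow> \<bar>fibre_average d a m \<phi> z y - c\<bar> \<le> \<eta>"
  shows "\<bar>fibre_average d a (m + k) \<phi> z v - c\<bar> \<le> \<eta>"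
proof -
  have D: "real (d ^ k) > 0" using assms(1) by simp
  have "\<bar>(\<Sum>y\<in>#fibre_preimages d a (z ^ (d ^ m)) k v. fibre_average d a m \<phi> z y) - c * real (d ^ k)\<bar> \<le> \<eta> * real (d ^ k)"
    using sum_mset_const_diff_le[where f = "fibre_average d a m \<phi> z" and A = "fibre_preimages d a (z ^ (d ^ m)) k v" and c = c and \<eta> = \<eta>, OF assms(2)]
    by (simp add: size_fibre_preimages[OF assms(1)])
  then have "\<bar>(\<Sum>y\<in>#fibre_preimages d a (z ^ (d ^ m)) k v. fibre_average d a m \<phi> z y) - c * real (d ^ k)\<bar> / real (d ^ k) \<le> \<eta>"
    using D by (simp add: field_simps)
  moreover have "fibre_average d a (m + k) \<phi> z v - c =
      ((\<Sum>y\<in>#fibre_preimages d a (z ^ (d ^ m)) k v. fibre_average d a m \<phi> z y) - c * real (d ^ k)) / real (d ^ k)"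
    unfolding fibre_average_add[OF assms(1)] using D by (simp add: field_simps)
  ultimately show ?thesis using D by (simp add: abs_divide)
qed

lemma sum_mset_tendsto:
  fixes \<phi> :: "complex \<times> complex \<Rightarrow> real"
  assumes rel: "\<And>\<epsilon>. \<epsilon> > 0 \<Longrightarrow> \<forall>\<^sub>F i in sequentially. rel_mset (\<lambda>x y. dist x y \<le> \<epsilon>) (A i) B"
    and \<phi>: "continuous_on UNIV \<phi>" and y: "y \<longlonglongrightarrow> y0"
  shows "(\<lambda>i. \<Sum>u\<in>#A i. \<phi> (u, y i)) \<longlonglongrightarrow> (\<Sum>u\<in>#B. \<phi> (u, y0))"
proof (rule tendstoI)
  fix e :: real assume e: "e > 0"
  define e' where "e' = e / real (Suc (size B))"
  have e': "e' > 0" "e' * real (size B) < e" using e by (auto simp: e'_def field_simps)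
  have "\<forall>u\<in>set_mset B. \<exists>s>0. \<forall>y. dist y (u, y0) < s \<longrightarrow> dist (\<phi> y) (\<phi> (u, y0)) < e'"
    using \<phi> e' unfolding continuous_on_iff by fast
  then obtain s where s: "\<And>u. u \<in># B \<Longrightarrow> s u > 0"
    "\<And>u y. u \<in># B \<Longrightarrow> dist y (u, y0) < s u \<Longrightarrow> dist (\<phi> y) (\<phi> (u, y0)) < e'" by metis
  define t where "t = Min (insert 1 (s ` set_mset B))"
  have t: "t > 0" "\<And>u. u \<in># B \<Longrightarrow> t \<le> s u" using s(1) by (auto simp: t_def)
  have "t / 4 > 0" using t by simp
  note rel[OF this] tendstoD[OF y this]
  then show "\<forall>\<^sub>F i in sequentially. dist (\<Sum>u\<in>#A i. \<phi> (u, y i)) (\<Sum>u\<in>#B. \<phi> (u, y0)) < e"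
  proof eventually_elim
    case (elim i)
    have "\<bar>(\<Sum>u\<in>#A i. \<phi> (u, y i)) - (\<Sum>u\<in>#B. \<phi> (u, y0))\<bar> \<le> e' * real (size (A i))"
    proof (rule sum_mset_rel_le[OF elim(1)])
      fix u' u assume u: "u \<in># B" "dist u' u \<le> t / 4"
      have "dist (u', y i) (u, y0) \<le> dist u' u + dist (y i) y0"
        unfolding dist_prod_def fst_conv snd_conv by (rule sqrt_sum_squares_le_sum) auto
      then have "dist (u', y i) (u, y0) < s u" using u elim(2) t(1) t(2)[OF u(1)] by linarith
      then have "dist (\<phi> (u', y i)) (\<phi> (u, y0)) < e'" by (rule s(2)[OF u(1)])
      then show "\<bar>\<phi> (u', y i) - \<phi> (u, y0)\<bar> \<le> e'" by (simp add: dist_real_def)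
    qed
    then show ?case using e'(2) rel_mset_size[OF elim(1)] by (simp add: dist_real_def)
  qed
qed

lemma continuous_on_fibre_average:
  assumes d: "d \<ge> 2" and \<phi>: "continuous_on UNIV \<phi>"
  shows "continuous_on UNIV (\<lambda>x. fibre_average d a n \<phi> (fst x) (snd x))"
proof -
  have "(\<lambda>i. fibre_average d a n \<phi> (fst (x i)) (snd (x i))) \<longlonglongrightarrow> fibre_average d a n \<phi> z0 v0"
    if x: "x \<longlonglongrightarrow> (z0, v0)" for x :: "nat \<Rightarrow> complex \<times> complex" and z0 v0
  proof -
    have zl: "(\<lambda>i. fst (x i)) \<longlonglongrightarrow> z0" and vl: "(\<lambda>i. snd (x i)) \<longlonglongrightarrow> v0"
      using tendsto_fst[OF x] tendsto_snd[OF x] by auto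
    have "continuous_on UNIV (\<lambda>y. \<phi> (snd y, fst y))"
      by (rule continuous_on_compose2[OF \<phi>]) (auto intro!: continuous_intros)
    from sum_mset_tendsto[OF fibre_preimages_tendsto[OF d zl vl, of _ a n] this zl]
    have "(\<lambda>i. \<Sum>u\<in>#fibre_preimages d a (fst (x i)) n (snd (x i)). \<phi> (fst (x i), u)) \<longlonglongrightarrow>
        (\<Sum>u\<in>#fibre_preimages d a z0 n v0. \<phi> (z0, u))" by simp
    then show ?thesis unfolding fibre_average_def by (intro tendsto_divide tendsto_const) (use d in auto)
  qed
  then show ?thesis by (auto simp: continuous_on_sequentially o_def)
qed

lemma norm_cis_diff_le: "cmod (cis x - cis y) \<le> \<bar>x - y\<bar>"
proof -
  have "cis x - cis y = cis y * (exp (\<i> * of_real (x - y)) - 1)"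
    by (simp add: cis_conv_exp exp_add[symmetric] algebra_simps)
  then have "cmod (cis x - cis y) = 2 * \<bar>sin ((x - y) / 2)\<bar>"
    by (simp only: norm_mult norm_cis dist_exp_i_1 mult_1)
  also have "\<dots> \<le> 2 * \<bar>(x - y) / 2\<bar>" by (intro mult_left_mono abs_sin_x_le_abs_x) auto
  finally show ?thesis by simp
qed

lemma filterlim_nat_power:
  assumes "d \<ge> (2::nat)" shows "filterlim (\<lambda>n. d ^ n) at_top sequentially"
proof (rule filterlim_at_top_mono[OF filterlim_ident always_eventually], rule allI)
  fix n
  have "n < 2 ^ n" by (rule less_exp)
  also have "2 ^ n \<le> d ^ n" using assms by (intro power_mono) auto
  finally show "n \<le> d ^ n" by simp
qed

text \<open>The solutions have modulus tending to 1 and equally spaced arguments, so the average is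
  a Riemann sum up to the modulus of continuity of \<open>g\<close>.\<close>

lemma roots_equidistributed:
  fixes g :: "complex \<Rightarrow> real"
  assumes d: "d \<ge> 2" and g: "continuous_on UNIV g" and z0: "z0 \<noteq> 0"
  shows "(\<lambda>n. (\<Sum>z | z ^ (d ^ n) = z0. g z) / real (d ^ n)) \<longlonglongrightarrow> integral {0..1} (\<lambda>t. g (cis (2 * pi * t)))"
proof (rule tendstoI)
  fix e :: real assume e: "e > 0"
  let ?G = "\<lambda>t. g (cis (2 * pi * t))"
  have contG: "continuous_on S ?G" for S
    by (rule continuous_on_compose2[OF g]) (auto intro!: continuous_intros)
  have "uniformly_continuous_on (cball 0 2) g"
    by (rule compact_uniformly_continuous[OF continuous_on_subset[OF g]]) auto
  then have "\<forall>e>0. \<exists>s>0. \<forall>x\<in>cball 0 2. \<forall>y\<in>cball 0 2. dist y x < s \<longrightarrow> dist (g y) (g x) < e"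
    unfolding uniformly_continuous_on_def .
  from this[rule_format, of "e / 2"] e obtain s where s: "s > 0"
    "\<forall>x\<in>cball 0 2. \<forall>y\<in>cball 0 2. dist y x < s \<longrightarrow> dist (g y) (g x) < e / 2" by auto
  note Dlim = filterlim_nat_power[OF d]
  have "(\<lambda>n. root (d ^ n) (cmod z0)) \<longlonglongrightarrow> 1"
    using filterlim_compose[OF LIMSEQ_root_const[of "cmod z0"] Dlim] z0 by simp
  then have ev1: "\<forall>\<^sub>F n in sequentially. dist (root (d ^ n) (cmod z0)) 1 < min 1 (s / 2)"
    using s(1) by (intro tendstoD) auto
  \<comment> \<open>With N = d^n, this bounds the difference of arguments: pi / N from
    \<open>Arg z0 / N\<close>, and 2 pi / N from the position of t in its interval of length 1 /
    N.\<close>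
  have "(\<lambda>n. 3 * pi / real (d ^ n)) \<longlonglongrightarrow> 0"
    by (intro tendsto_divide_0[OF tendsto_const] filterlim_at_top_imp_at_infinity filterlim_compose[OF filterlim_real_sequentially Dlim])
  then have ev2: "\<forall>\<^sub>F n in sequentially. 3 * pi / real (d ^ n) < s / 2"
    using s(1) by (intro order_tendstoD(2)) auto
  from ev1 ev2 show "\<forall>\<^sub>F n in sequentially.
      dist ((\<Sum>z | z ^ (d ^ n) = z0. g z) / real (d ^ n)) (integral {0..1} ?G) < e"
  proof eventually_elim
    case (elim n)
    define N where "N = d ^ n"
    have N: "N > 0" using d by (simp add: N_def)
    define \<rho> where "\<rho> = root N (cmod z0)"
    define c' where "c' = of_real \<rho> * cis (Arg z0 / N)"
    define w where "w j = c' * cis (2 * pi * real j / real N)" for j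
    have \<rho>: "\<bar>\<rho> - 1\<bar> < 1" "\<bar>\<rho> - 1\<bar> < s / 2" using elim(1) by (auto simp: \<rho>_def N_def dist_real_def)
    have "bij_betw (\<lambda>z. c' * z) {z. z ^ N = 1} {z. z ^ N = z0}"
      unfolding c'_def \<rho>_def by (rule bij_betw_nth_root_unity[OF z0 N])
    then have "bij_betw ((\<lambda>z. c' * z) \<circ> (\<lambda>k. cis (2 * pi * real k / real N))) {..<N} {z. z ^ N = z0}"
      by (rule bij_betw_trans[OF Complex.bij_betw_roots_unity[OF N]])
    then have sumeq: "(\<Sum>z | z ^ N = z0. g z) = (\<Sum>j<N. g (w j))"
      unfolding w_def o_def by (rule sum.reindex_bij_betw[symmetric])
    have wn: "w j \<in> cball 0 2" for j using \<rho> by (simp add: w_def c'_def norm_mult)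
    have close: "\<bar>?G t - g (w j)\<bar> \<le> e / 2" if t: "real j / N \<le> t" "t \<le> real (Suc j) / N" for j t
    proof -
      define x where "x = Arg z0 / N + 2 * pi * real j / N"
      have wj: "w j = of_real \<rho> * cis x" by (simp add: w_def c'_def x_def cis_mult)
      have "x - 2 * pi * t = Arg z0 / N + 2 * pi * (real j / N - t)" by (simp add: x_def algebra_simps)
      moreover have "\<bar>Arg z0 / N\<bar> \<le> pi / N"
      proof -
        have "\<bar>Arg z0\<bar> \<le> pi" using Arg_bounded[of z0] by linarith
        then show ?thesis by (simp add: abs_divide divide_right_mono)
      qed
      moreover have "\<bar>2 * pi * (real j / N - t)\<bar> \<le> 2 * pi * (1 / N)"
        unfolding abs_mult using t by (intro mult_mono) (auto simp: abs_if add_divide_distrib)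
      ultimately have "\<bar>x - 2 * pi * t\<bar> \<le> pi / N + 2 * pi * (1 / N)" by linarith
      also have "\<dots> = 3 * pi / N" by (simp add: field_simps)
      finally have "cmod (cis x - cis (2 * pi * t)) < s / 2"
        using norm_cis_diff_le[of x "2 * pi * t"] elim(2) by (simp add: N_def)
      moreover have "cmod (w j - cis x) < s / 2"
      proof -
        have "w j - cis x = of_real (\<rho> - 1) * cis x" by (simp add: wj algebra_simps)
        then show ?thesis using \<rho>(2) by (simp only: norm_mult norm_of_real norm_cis) simp
      qed
      ultimately have "dist (cis (2 * pi * t)) (w j) < s"
        using norm_triangle_ineq[of "w j - cis x" "cis x - cis (2 * pi * t)"] by (simp add: dist_norm norm_minus_commute)
      then have "dist (?G t) (g (w j)) < e / 2" using s(2) wn[of j] by simp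
      then show ?thesis by (simp add: dist_real_def)
    qed
    have "\<bar>integral {0..real k / N} ?G - (\<Sum>j<k. g (w j)) / N\<bar> \<le> real k * (e / 2 / N)" for k
    proof (induction k)
      case (Suc k)
      have "integral {0..real k / N} ?G + integral {real k / N..real (Suc k) / N} ?G = integral {0..real (Suc k) / N} ?G"
        using N by (intro Henstock_Kurzweil_Integration.integral_combine integrable_continuous_interval contG) (auto simp: divide_right_mono)
      moreover have "\<bar>integral {real k / N..real (Suc k) / N} ?G - g (w k) / N\<bar> \<le> e / 2 / N"
      proof -
        have le: "real k / N \<le> real (Suc k) / N" by (simp add: divide_right_mono)
        have "integral {real k / N..real (Suc k) / N} (\<lambda>t. ?G t - g (w k)) =
            integral {real k / N..real (Suc k) / N} ?G - g (w k) / N"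
          using N le by (subst integral_diff) (auto intro!: integrable_continuous_interval contG simp: add_divide_distrib)
        moreover have "norm (integral {real k / N..real (Suc k) / N} (\<lambda>t. ?G t - g (w k)))
            \<le> e / 2 * (real (Suc k) / N - real k / N)"
          using close[of k] by (intro integral_bound le continuous_intros contG) auto
        ultimately show ?thesis by (simp add: add_divide_distrib)
      qed
      moreover have "(\<Sum>j<Suc k. g (w j)) / N = (\<Sum>j<k. g (w j)) / N + g (w k) / N"
        by (simp add: add_divide_distrib)
      moreover have "real (Suc k) * (e / 2 / N) = real k * (e / 2 / N) + e / 2 / N" by (simp add: algebra_simps add_divide_distrib)
      ultimately show ?case using Suc.IH by linarith
    qed simp
    from this[of N] show ?case
      using N e sumeq by (simp add: N_def[symmetric] dist_real_def abs_minus_commute)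
  qed
qed

text \<open>Only the deepest \<open>m\<close> levels matter. The average \<open>H z v\<close> over
  them hardly depends on \<open>v\<close>, over the circle by matching and near the circle by
  continuity. The other n - m levels merely average such values, and the base points z
  equidistribute; so \<open>c\<close> is the circle average of \<open>H z 0\<close>, for all base
  points in the disc at once.\<close>

lemma pullback_average_near_constant:
  assumes d: "d \<ge> 2" and a: "a \<in> escape_locus d" and \<phi>: "continuous_on UNIV \<phi>" and e: "e > 0"
  shows "\<exists>c. \<forall>z0 v. z0 \<noteq> 0 \<longrightarrow> cmod z0 \<le> B \<longrightarrow> cmod v \<le> B \<longrightarrow>
    (\<forall>\<^sub>F n in sequentially. \<bar>pullback_average d a n \<phi> (z0, v) - c\<bar> \<le> e)"
proof -
  define B' where "B' = max 1 B"
  have B': "B' \<ge> 1" "B \<le> B'" by (auto simp: B'_def)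
  obtain U R0 where UR0: "open U" "a \<in> U" "\<And>b. b \<in> U \<Longrightarrow> escape_radius d b B' R0"
    by (rule ex_escape_radius[OF d B'(1)]) (rule that)
  obtain R1 where R1: "R1 > 0" "\<And>R. R1 \<le> R \<Longrightarrow> \<exists>k N \<delta>. expanding_fibres d a R k N \<delta>"
    by (rule ex_expanding_fibres[OF d a]) (rule that)
  \<comment> \<open>\<open>R\<close> has to exceed |v|, to admit expansion, and to be an escape
    radius for all base points in the disc of radius \<open>B'\<close>, so that iterated preimages
    of \<open>v\<close> never leave the disc of radius \<open>R\<close>.\<close>
  define R where "R = Max {R0, R1, B' + 1}"
  have R: "R0 \<le> R" "R1 \<le> R" "B' < R" by (auto simp: R_def)
  have esc: "escape_radius d a B' R" using escape_radius_mono[OF UR0(3)[OF UR0(2)]] R(1) by simp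
  have R0: "R > 0" using R B' by linarith
  have "uniformly_continuous_on (cball 0 2 \<times> cball 0 R) \<phi>"
    by (intro compact_uniformly_continuous continuous_on_subset[OF \<phi>] compact_Times) auto
  then have "\<forall>e>0. \<exists>s>0. \<forall>x\<in>cball 0 2 \<times> cball 0 R. \<forall>y\<in>cball 0 2 \<times> cball 0 R. dist y x < s \<longrightarrow> dist (\<phi> y) (\<phi> x) < e"
    unfolding uniformly_continuous_on_def .
  from this[rule_format, of "e / 4"] e obtain s where s: "s > 0"
    "\<forall>x\<in>cball 0 2 \<times> cball 0 R. \<forall>y\<in>cball 0 2 \<times> cball 0 R. dist y x < s \<longrightarrow> dist (\<phi> y) (\<phi> x) < e / 4" by auto
  have "s / 2 > 0" using s(1) by simp
  obtain k N \<delta> where "expanding_fibres d a R k N \<delta>" using R1(2)[OF R(2)] by blast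
  then interpret expanding_fibres d a R k N \<delta> .
  obtain m where m: "\<And>z v v'. cmod z = 1 \<Longrightarrow> cmod v < R \<Longrightarrow> cmod v' < R \<Longrightarrow>
    rel_mset (\<lambda>x y. dist x y \<le> s / 2) (fibre_preimages d a z m v) (fibre_preimages d a z m v')"
    by (rule matching[OF \<open>s / 2 > 0\<close>]) (rule that)
  define H where "H z v = fibre_average d a m \<phi> z v" for z v
  have Hcont: "continuous_on S (\<lambda>x. H (fst x) (snd x))" for S
    unfolding H_def by (rule continuous_on_subset[OF continuous_on_fibre_average[OF d \<phi>]]) simp
  have osc: "\<bar>H z v - H z v'\<bar> \<le> e / 4" if z: "cmod z = 1" and v: "cmod v < R" "cmod v' < R" for z v v'
  proof -
    have pre: "cmod u \<le> R" if "u \<in># fibre_preimages d a z m y" "cmod y < R" for u y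
      using escape_backward_circle[OF escape z, of 0 m u] that by (simp add: set_fibre_preimages[OF d])
    have "\<bar>(\<Sum>u\<in>#fibre_preimages d a z m v. \<phi> (z, u)) - (\<Sum>u\<in>#fibre_preimages d a z m v'. \<phi> (z, u))\<bar>
        \<le> e / 4 * real (size (fibre_preimages d a z m v))"
    proof (rule sum_mset_rel_le[OF m[OF z v]])
      fix x y assume xy: "x \<in># fibre_preimages d a z m v" "y \<in># fibre_preimages d a z m v'" "dist x y \<le> s / 2"
      have "(z, x) \<in> cball 0 2 \<times> cball 0 R" "(z, y) \<in> cball 0 2 \<times> cball 0 R" using pre[OF xy(1) v(1)] pre[OF xy(2) v(2)] z by auto
      moreover have "dist (z, x) (z, y) < s" using xy(3) s(1) by (simp add: dist_prod_def)
      ultimately have "dist (\<phi> (z, x)) (\<phi> (z, y)) < e / 4" using s(2) by blast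
      then show "\<bar>\<phi> (z, x) - \<phi> (z, y)\<bar> \<le> e / 4" by (simp add: dist_real_def)
    qed
    then show ?thesis
      using d by (simp add: H_def fibre_average_def size_fibre_preimages[OF d] dist_real_def
            diff_divide_distrib[symmetric] abs_divide field_simps)
  qed
  have "uniformly_continuous_on (cball 0 2 \<times> cball 0 R) (\<lambda>x. H (fst x) (snd x))"
    by (intro compact_uniformly_continuous Hcont compact_Times) auto
  then have "\<forall>e>0. \<exists>s>0. \<forall>x\<in>cball 0 2 \<times> cball 0 R. \<forall>y\<in>cball 0 2 \<times> cball 0 R. dist y x < s \<longrightarrow>
      dist (H (fst y) (snd y)) (H (fst x) (snd x)) < e"
    unfolding uniformly_continuous_on_def .
  from this[rule_format, of "e / 8"] e obtain t where t: "t > 0"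
    "\<forall>x\<in>cball 0 2 \<times> cball 0 R. \<forall>y\<in>cball 0 2 \<times> cball 0 R. dist y x < t \<longrightarrow>
      dist (H (fst y) (snd y)) (H (fst x) (snd x)) < e / 8" by auto
  have osc2: "\<bar>H z v - H z 0\<bar> \<le> e / 2" if z: "\<bar>cmod z - 1\<bar> < min 1 t" and v: "cmod v < R" for z v
  proof -
    have z0: "z \<noteq> 0" using z by auto
    \<comment> \<open>Radial projection to the circle, where \<open>osc\<close> is available; the
      distance from \<open>z\<close> is the deviation of |z| from 1.\<close>
    define z' where "z' = sgn z"
    have z': "cmod z' = 1" using z0 by (simp add: z'_def norm_sgn)
    have "z - z' = (cmod z - 1) *\<^sub>R z'" using z0 by (simp add: z'_def sgn_div_norm algebra_simps)
    then have "dist z z' = \<bar>cmod z - 1\<bar>" using z' by (simp add: dist_norm)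
    then have "dist (z, y) (z', y) < t" for y :: complex using z by (simp add: dist_prod_def)
    moreover have "(z, y) \<in> cball 0 2 \<times> cball 0 R" "(z', y) \<in> cball 0 2 \<times> cball 0 R" if "cmod y < R" for y
      using z z' that by auto
    ultimately have "dist (H z y) (H z' y) < e / 8" if "cmod y < R" for y
      using t(2) that by (metis fst_conv snd_conv)
    from this[OF v] this[of 0] R0 have "\<bar>H z v - H z' v\<bar> < e / 8" "\<bar>H z 0 - H z' 0\<bar> < e / 8"
      by (simp_all add: dist_real_def)
    moreover have "\<bar>H z' v - H z' 0\<bar> \<le> e / 4" using osc[OF z' v, of 0] R0 by simp
    ultimately show ?thesis using e by linarith
  qed
  define c where "c = integral {0..1} (\<lambda>t. H (cis (2 * pi * t)) 0)"
  have gc: "continuous_on UNIV (\<lambda>z. H z 0)"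
    using continuous_on_compose2[OF Hcont[of UNIV], of UNIV "\<lambda>z. (z, 0)"] by (simp add: continuous_on_Pair)
  have "\<forall>\<^sub>F n in sequentially. \<bar>pullback_average d a n \<phi> (z0, v) - c\<bar> \<le> e"
    if z0: "z0 \<noteq> 0" "cmod z0 \<le> B" and v: "cmod v \<le> B" for z0 v
  proof -
    have lim: "(\<lambda>n. (\<Sum>z | z ^ (d ^ n) = z0. H z 0) / real (d ^ n)) \<longlonglongrightarrow> c"
      unfolding c_def by (rule roots_equidistributed[OF d gc z0(1)])
    note Dlim = filterlim_nat_power[OF d]
    have "(\<lambda>n. root (d ^ n) (cmod z0)) \<longlonglongrightarrow> 1"
      using filterlim_compose[OF LIMSEQ_root_const[of "cmod z0"] Dlim] z0 by simp
    then have ev1: "\<forall>\<^sub>F n in sequentially. dist (root (d ^ n) (cmod z0)) 1 < min 1 t"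
      using t(1) by (intro tendstoD) auto
    have ev2: "\<forall>\<^sub>F n in sequentially. dist ((\<Sum>z | z ^ (d ^ n) = z0. H z 0) / real (d ^ n)) c < e / 2"
      using e by (intro tendstoD[OF lim]) auto
    from ev1 ev2 eventually_ge_at_top[of m] show ?thesis
    proof eventually_elim
      case (elim n)
      define k where "k = n - m"
      have n: "n = m + k" using elim(3) by (simp add: k_def)
      have dn: "d ^ n > 0" using d by simp
      have near: "\<bar>fibre_average d a n \<phi> z v - H z 0\<bar> \<le> e / 2" if z: "z ^ (d ^ n) = z0" for z
      proof -
        have "cmod z ^ (d ^ n) = cmod z0" using z by (metis norm_power)
        then have "cmod z = root (d ^ n) (cmod z0)" using dn by (metis norm_ge_zero real_root_power_cancel)
        then have zc: "\<bar>cmod z - 1\<bar> < min 1 t" using elim(1) by (simp add: dist_real_def)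
        have "cmod y < R" if y: "y \<in># fibre_preimages d a (z ^ (d ^ m)) k v" for y
        proof -
          have "cmod (fibre_iterate d a (z ^ (d ^ m)) (0 + k) y) < R"
            using y v R B' by (simp add: set_fibre_preimages[OF d])
          moreover have "cmod ((z ^ (d ^ m)) ^ (d ^ (0 + j))) \<le> B'" if "j < k" for j
            unfolding power_power_add
            by (rule norm_power_le[OF B'(1), of z "d ^ n"]) (use z z0 B' d n that in \<open>auto intro!: power_increasing\<close>)
          ultimately have "cmod (fibre_iterate d a (z ^ (d ^ m)) 0 y) < R"
            by (rule escape_backward[OF esc])
          then show ?thesis by simp
        qed
        then show ?thesis unfolding n
          by (intro fibre_average_diff_le[OF d]) (use osc2[OF zc] in \<open>auto simp: H_def\<close>)
      qed
      have "\<bar>(\<Sum>z | z ^ (d ^ n) = z0. fibre_average d a n \<phi> z v) - (\<Sum>z | z ^ (d ^ n) = z0. H z 0)\<bar>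
          \<le> (\<Sum>z | z ^ (d ^ n) = z0. e / 2)"
        unfolding sum_subtractf[symmetric] by (rule order.trans[OF sum_abs], rule sum_mono) (use near in simp)
      also have "\<dots> = e / 2 * real (d ^ n)" using card_nth_roots[OF z0(1) dn] by simp
      finally have "\<bar>pullback_average d a n \<phi> (z0, v) - (\<Sum>z | z ^ (d ^ n) = z0. H z 0) / real (d ^ n)\<bar> \<le> e / 2"
        using dn by (simp add: pullback_average_eq[OF d z0(1)] diff_divide_distrib[symmetric] abs_divide field_simps)
      then show ?case using elim(2) unfolding dist_real_def by linarith
    qed
  qed
  then show ?thesis by blast
qed

text \<open>The constants of \<open>pullback_average_near_constant\<close> depend on the error and
  on the disc; comparing each (z0, v) with (1, 0) inside one disc makes the limit common to
  all.\<close>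

lemma pullback_average_convergent:
  assumes d: "d \<ge> 2" and a: "a \<in> escape_locus d" and \<phi>: "continuous_on UNIV \<phi>"
  obtains L where "\<And>z0 v. z0 \<noteq> 0 \<Longrightarrow> (\<lambda>n. pullback_average d a n \<phi> (z0, v)) \<longlonglongrightarrow> L"
proof -
  note near = pullback_average_near_constant[OF d a \<phi>]
  have "Cauchy (\<lambda>n. pullback_average d a n \<phi> (1, 0))"
  proof (rule metric_CauchyI)
    fix e :: real assume e: "e > 0"
    then have "e / 3 > 0" by simp
    from near[OF this, of 1] obtain c where c: "\<forall>z0 v. z0 \<noteq> 0 \<longrightarrow> cmod z0 \<le> 1 \<longrightarrow> cmod v \<le> 1 \<longrightarrow>
      (\<forall>\<^sub>F n in sequentially. \<bar>pullback_average d a n \<phi> (z0, v) - c\<bar> \<le> e / 3)" by blast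
    from c[rule_format, of 1 0] have "\<forall>\<^sub>F n in sequentially. \<bar>pullback_average d a n \<phi> (1, 0) - c\<bar> \<le> e / 3"
      by simp
    then obtain M where M: "\<And>n. n \<ge> M \<Longrightarrow> \<bar>pullback_average d a n \<phi> (1, 0) - c\<bar> \<le> e / 3"
      by (auto simp: eventually_sequentially)
    have "dist (pullback_average d a n \<phi> (1, 0)) (pullback_average d a n' \<phi> (1, 0)) < e" if "n \<ge> M" "n' \<ge> M" for n n'
      using M[OF that(1)] M[OF that(2)] e unfolding dist_real_def by linarith
    then show "\<exists>M. \<forall>m\<ge>M. \<forall>n\<ge>M. dist (pullback_average d a m \<phi> (1, 0)) (pullback_average d a n \<phi> (1, 0)) < e" by blast
  qed
  then obtain L where L: "(\<lambda>n. pullback_average d a n \<phi> (1, 0)) \<longlonglongrightarrow> L"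
    using Cauchy_convergent convergent_def by blast
  have "(\<lambda>n. pullback_average d a n \<phi> (z0, v)) \<longlonglongrightarrow> L" if z0: "z0 \<noteq> 0" for z0 v
  proof (rule tendstoI)
    fix e :: real assume e: "e > 0"
    obtain c where c: "\<forall>z0' v'. z0' \<noteq> 0 \<longrightarrow> cmod z0' \<le> Max {1, cmod z0, cmod v} \<longrightarrow> cmod v' \<le> Max {1, cmod z0, cmod v} \<longrightarrow>
      (\<forall>\<^sub>F n in sequentially. \<bar>pullback_average d a n \<phi> (z0', v') - c\<bar> \<le> e / 4)"
      using near[of "e / 4" "Max {1, cmod z0, cmod v}"] e by auto
    have "\<forall>\<^sub>F n in sequentially. \<bar>pullback_average d a n \<phi> (z0, v) - c\<bar> \<le> e / 4"
      "\<forall>\<^sub>F n in sequentially. \<bar>pullback_average d a n \<phi> (1, 0) - c\<bar> \<le> e / 4"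
      using c z0 by auto
    moreover have "\<forall>\<^sub>F n in sequentially. dist (pullback_average d a n \<phi> (1, 0)) L < e / 4"
      using e by (intro tendstoD[OF L]) auto
    ultimately show "\<forall>\<^sub>F n in sequentially. dist (pullback_average d a n \<phi> (z0, v)) L < e"
    proof eventually_elim
      case (elim n)
      then show ?case using e unfolding dist_real_def by linarith
    qed
  qed
  then show ?thesis by (rule that)
qed

text \<open>By matching, every y in the disc of radius R has a preimage under Q^m close to
  \<open>u1\<close>, because \<open>u1\<close> is itself a preimage of a point of that disc. So over
  every circle point near \<open>z1\<close> at least one of d^m points falls where the bump is at
  least 1/2, whatever the other levels do.\<close>

lemma pullback_average_bump_positive:
  assumes d: "d \<ge> 2" and a: "a \<in> escape_locus d" and x: "(z1, u1) \<in> filled_set d a" and \<epsilon>: "\<epsilon> > 0"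
    and L: "(\<lambda>n. pullback_average d a n (\<lambda>y. max 0 (1 - dist y (z1, u1) / \<epsilon>)) (1, 0)) \<longlonglongrightarrow> L"
  shows "L > 0"
proof -
  define \<phi> where "\<phi> y = max 0 (1 - dist y (z1, u1) / \<epsilon>)" for y
  obtain R1 where R1: "R1 > 0" "\<And>R. R1 \<le> R \<Longrightarrow> \<exists>k N \<delta>. expanding_fibres d a R k N \<delta>"
    by (rule ex_expanding_fibres[OF d a]) (rule that)
  define R where "R = R1"
  obtain k N \<delta> where "expanding_fibres d a R k N \<delta>" using R1(2)[OF order_refl] unfolding R_def by blast
  then interpret expanding_fibres d a R k N \<delta> .
  have "\<epsilon> / 8 > 0" using \<epsilon> by simp
  obtain m where m: "\<And>z v v'. cmod z = 1 \<Longrightarrow> cmod v < R \<Longrightarrow> cmod v' < R \<Longrightarrow>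
    rel_mset (\<lambda>x y. dist x y \<le> \<epsilon> / 8) (fibre_preimages d a z m v) (fibre_preimages d a z m v')"
    by (rule matching[OF \<open>\<epsilon> / 8 > 0\<close>]) (rule that)
  have x': "cmod z1 = 1" "cmod (fibre_iterate d a z1 m u1) < R"
    using x by (auto simp: filled_set_eq[OF escape])
  have "open {z. cmod (fibre_iterate d a z m u1) < R}"
    by (intro open_Collect_less continuous_intros)
  then obtain s where s: "s > 0" "\<And>z. dist z z1 < s \<Longrightarrow> cmod (fibre_iterate d a z m u1) < R"
    using x'(2) unfolding open_dist by blast
  define \<eta> where "\<eta> = min s (\<epsilon> / 4)"
  have \<eta>: "\<eta> > 0" using s \<epsilon> by (simp add: \<eta>_def)
  \<comment> \<open>A lower bound for the fibre averages: one point of weight 1 / d^m at height 1/2,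
    cut off continuously in \<open>z\<close> so that equidistribution of roots of unity applies to
    it.\<close>
  define g where "g z = (1 / (2 * real (d ^ m))) * max 0 (1 - dist z z1 / \<eta>)" for z
  have gc: "continuous_on S g" for S
  proof -
    have "g = (\<lambda>z. (1 / (2 * real (d ^ m))) * max 0 (1 - dist z z1 * (1 / \<eta>)))" by (auto simp: g_def)
    then show ?thesis by (simp only:) (intro continuous_intros)
  qed
  have \<phi>0: "\<phi> y \<ge> 0" for y by (simp add: \<phi>_def)
  have low: "g z \<le> fibre_average d a m \<phi> z y" if z: "cmod z = 1" and y: "cmod y < R" for z y
  proof (cases "dist z z1 < \<eta>")
    case True
    then have "cmod (fibre_iterate d a z m u1) < R" using s(2) by (simp add: \<eta>_def)
    then obtain u where u: "u \<in># fibre_preimages d a z m y" "dist u1 u \<le> \<epsilon> / 8"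
      using rel_mset_obtain[OF m[OF z _ y], of "fibre_iterate d a z m u1" u1] by (auto simp: set_fibre_preimages[OF d])
    have "dist (z, u) (z1, u1) \<le> dist z z1 + dist u u1"
      unfolding dist_prod_def fst_conv snd_conv by (rule sqrt_sum_squares_le_sum) auto
    also have "\<dots> \<le> \<epsilon> / 4 + \<epsilon> / 8" using True u(2) by (simp add: \<eta>_def dist_commute)
    also have "\<dots> \<le> \<epsilon> / 2" using \<epsilon> by simp
    finally have "1 / 2 \<le> \<phi> (z, u)" using \<epsilon> by (simp add: \<phi>_def field_simps)
    also have "\<dots> \<le> (\<Sum>u\<in>#fibre_preimages d a z m y. \<phi> (z, u))"
    proof -
      obtain M where "fibre_preimages d a z m y = add_mset u M" using u(1) by (meson mset_add)
      moreover have "0 \<le> (\<Sum>u\<in>#M. \<phi> (z, u))" by (induction M) (auto simp: \<phi>0)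
      ultimately show ?thesis by simp
    qed
    finally have "1 / 2 / real (d ^ m) \<le> fibre_average d a m \<phi> z y"
      unfolding fibre_average_def by (intro divide_right_mono) auto
    moreover have "g z \<le> (1 / (2 * real (d ^ m))) * 1"
      unfolding g_def using \<eta> by (intro mult_left_mono) auto
    ultimately show ?thesis by simp
  next
    case False
    then have "g z = 0" using \<eta> by (simp add: g_def)
    moreover have "0 \<le> (\<Sum>u\<in>#A. \<phi> (z, u))" for A by (induction A) (auto simp: \<phi>0)
    ultimately show ?thesis by (simp add: fibre_average_def)
  qed
  have low2: "g z \<le> fibre_average d a (m + n) \<phi> z 0" if z: "cmod z = 1" for z n
  proof -
    let ?A = "fibre_preimages d a (z ^ (d ^ m)) n 0"
    have z': "cmod (z ^ (d ^ m)) = 1" using z by (simp add: norm_power)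
    have *: "g z * real (size A) \<le> (\<Sum>y\<in>#A. fibre_average d a m \<phi> z y)" if "\<forall>y\<in>#A. cmod y < R" for A
      using that by (induction A) (auto simp: algebra_simps intro!: add_mono low[OF z])
    have "\<forall>y\<in>#?A. cmod y < R"
      using escape_backward_circle[OF escape z', of 0 n] R_pos by (auto simp: set_fibre_preimages[OF d])
    from *[OF this] have "g z * real (d ^ n) \<le> (\<Sum>y\<in>#?A. fibre_average d a m \<phi> z y)"
      by (simp add: size_fibre_preimages[OF d])
    then show ?thesis using d by (simp add: fibre_average_add[OF d] field_simps)
  qed
  have lim: "(\<lambda>n. (\<Sum>z | z ^ (d ^ n) = 1. g z) / real (d ^ n)) \<longlonglongrightarrow> integral {0..1} (\<lambda>t. g (cis (2 * pi * t)))"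
    by (rule roots_equidistributed[OF d gc]) simp
  have "\<forall>\<^sub>F n in sequentially. (\<Sum>z | z ^ (d ^ n) = 1. g z) / real (d ^ n) \<le> pullback_average d a n \<phi> (1, 0)"
    using eventually_ge_at_top[of m]
  proof eventually_elim
    case (elim n)
    have "(\<Sum>z | z ^ (d ^ n) = 1. g z) \<le> (\<Sum>z | z ^ (d ^ n) = 1. fibre_average d a n \<phi> z 0)"
    proof (rule sum_mono)
      fix z assume "z \<in> {z. z ^ (d ^ n) = (1::complex)}"
      then have "z ^ (d ^ n) = 1" by simp
      from power_eq_1_iff[OF this] have "cmod z = 1" using d by simp
      then show "g z \<le> fibre_average d a n \<phi> z 0" using low2[of z "n - m"] elim by simp
    qed
    then show ?case by (simp add: pullback_average_eq[OF d] divide_right_mono)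
  qed
  then have le: "integral {0..1} (\<lambda>t. g (cis (2 * pi * t))) \<le> L"
    using tendsto_le[OF _ L[folded \<phi>_def] lim] by simp
  have cG: "continuous_on {0..1} (\<lambda>t. g (cis (2 * pi * t)))"
    by (rule continuous_on_compose2[OF gc[of UNIV]]) (auto intro!: continuous_intros)
  have g0: "g z \<ge> 0" for z by (simp add: g_def)
  have nn: "integral {0..1} (\<lambda>t. g (cis (2 * pi * t))) \<ge> 0"
    using g0 by (intro integral_nonneg integrable_continuous_interval cG) auto
  moreover have "integral {0..1} (\<lambda>t. g (cis (2 * pi * t))) \<noteq> 0"
  proof
    assume z: "integral {0..1} (\<lambda>t. g (cis (2 * pi * t))) = 0"
    define t1 where "t1 = Arg2pi z1 / (2 * pi)"
    have t1: "t1 \<in> {0..1}" "cis (2 * pi * t1) = z1"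
      using Arg2pi[of z1] x'(1) by (auto simp: t1_def cis_conv_exp less_imp_le is_Arg_def)
    have "((\<lambda>t. g (cis (2 * pi * t))) has_integral 0) (cbox 0 1)"
      using integrable_integral[OF integrable_continuous_interval[OF cG]] z by simp
    then have "g (cis (2 * pi * t1)) = 0"
      using has_integral_0_cbox_imp_0[of 0 1 "\<lambda>t. g (cis (2 * pi * t))" t1] cG g0 t1 by simp
    then show False using t1(2) d by (simp add: g_def)
  qed
  ultimately show "L > 0" using le by linarith
qed

section \<open>A space-filling curve and weak limits\<close>

text \<open>Discrete measures on a square lift along a space-filling curve to an interval, where Helly's
  selection theorem applies; the limit is pushed forward again.\<close>

definition schoenberg_profile :: "real \<Rightarrow> real" where
  "schoenberg_profile t = max 0 (min 1 (1/2 - cos (pi * t)))"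

text \<open>Schoenberg's curve, used with four coordinates. The profile is even with period 2,
  vanishes on [0, 1/3] and equals 1 on [2/3, 1]; at \<open>3 ^ k * t\<close> it thus reads a ternary
  digit 0 or 2 of \<open>t\<close>. Coordinate \<open>i\<close> uses the digits at positions 4 n + i
  as binary digits.\<close>

definition schoenberg_curve :: "nat \<Rightarrow> real \<Rightarrow> real" where
  "schoenberg_curve i t = (\<Sum>n. schoenberg_profile (3 ^ (4 * n + i) * t) / 2 ^ Suc n)"

lemma schoenberg_profile_bounds: "0 \<le> schoenberg_profile t" "schoenberg_profile t \<le> 1"
  by (auto simp: schoenberg_profile_def)

lemma continuous_on_schoenberg_curve: "continuous_on UNIV (schoenberg_curve i)"
proof -
  let ?g = "\<lambda>n t. schoenberg_profile (3 ^ (4 * n + i) * t) / 2 ^ Suc n"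
  have "uniform_limit UNIV (\<lambda>N t. \<Sum>n<N. ?g n t) (\<lambda>t. \<Sum>n. ?g n t) sequentially"
  proof (rule Weierstrass_m_test)
    fix n :: nat and t :: real
    show "norm (?g n t) \<le> (1/2) ^ Suc n"
      using schoenberg_profile_bounds[of "3 ^ (4 * n + i) * t"]
      by (simp add: power_one_over divide_right_mono del: power_Suc)
  next
    show "summable (\<lambda>n. (1/2::real) ^ Suc n)" by (subst summable_Suc_iff) (rule summable_geometric, simp)
  qed
  moreover have "continuous_on UNIV (\<lambda>t. \<Sum>n<N. ?g n t)" for N
    unfolding schoenberg_profile_def by (intro continuous_intros) auto
  ultimately show ?thesis
    unfolding schoenberg_curve_def by (intro uniform_limit_theorem[where F = sequentially]) auto
qed

text \<open>The digits are differences of floors, so that the partial sums telescope to floor(2^N y)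
  / 2^N.\<close>

lemma binary_expansion:
  fixes y :: real assumes y: "0 \<le> y" "y < 1"
  obtains c :: "nat \<Rightarrow> nat" where "\<And>n. c n \<in> {0, 1}" "(\<lambda>n. real (c n) / 2 ^ Suc n) sums y"
proof -
  define c where "c n = nat (\<lfloor>2 ^ Suc n * y\<rfloor> - 2 * \<lfloor>2 ^ n * y\<rfloor>)" for n
  have c: "int (c n) = \<lfloor>2 ^ Suc n * y\<rfloor> - 2 * \<lfloor>2 ^ n * y\<rfloor> \<and> c n \<in> {0, 1}" for n
  proof -
    have "2 ^ Suc n * y = 2 * (2 ^ n * y)" by simp
    then have "0 \<le> \<lfloor>2 ^ Suc n * y\<rfloor> - 2 * \<lfloor>2 ^ n * y\<rfloor>" "\<lfloor>2 ^ Suc n * y\<rfloor> - 2 * \<lfloor>2 ^ n * y\<rfloor> \<le> 1"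
      by linarith+
    then show ?thesis unfolding c_def by auto
  qed
  have part: "(\<Sum>n<N. real (c n) / 2 ^ Suc n) = real_of_int \<lfloor>2 ^ N * y\<rfloor> / 2 ^ N" for N
  proof (induction N)
    case 0
    have "\<lfloor>y\<rfloor> = 0" using y by linarith
    then show ?case by simp
  next
    case (Suc N)
    have "real (c N) = real_of_int (int (c N))" by simp
    also have "\<dots> = real_of_int \<lfloor>2 ^ Suc N * y\<rfloor> - 2 * real_of_int \<lfloor>2 ^ N * y\<rfloor>"
      using c[of N] by (simp only: of_int_diff of_int_mult of_int_numeral)
    finally have "real (c N) / 2 ^ Suc N = real_of_int \<lfloor>2 ^ Suc N * y\<rfloor> / 2 ^ Suc N - real_of_int \<lfloor>2 ^ N * y\<rfloor> / 2 ^ N"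
      by (simp add: diff_divide_distrib)
    then show ?case using Suc by (simp only: sum.lessThan_Suc)
  qed
  have "(\<lambda>N. real_of_int \<lfloor>2 ^ N * y\<rfloor> / 2 ^ N) \<longlonglongrightarrow> y"
  proof (rule tendsto_sandwich)
    show "\<forall>\<^sub>F N in sequentially. y - (1/2) ^ N \<le> real_of_int \<lfloor>2 ^ N * y\<rfloor> / 2 ^ N"
    proof (rule always_eventually, rule allI)
      fix N
      have "2 ^ N * y - 1 \<le> real_of_int \<lfloor>2 ^ N * y\<rfloor>" by linarith
      then have "(2 ^ N * y - 1) / 2 ^ N \<le> real_of_int \<lfloor>2 ^ N * y\<rfloor> / 2 ^ N" by (intro divide_right_mono) auto
      then show "y - (1/2) ^ N \<le> real_of_int \<lfloor>2 ^ N * y\<rfloor> / 2 ^ N" by (simp add: diff_divide_distrib power_one_over)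
    qed
    show "\<forall>\<^sub>F N in sequentially. real_of_int \<lfloor>2 ^ N * y\<rfloor> / 2 ^ N \<le> y"
      by (rule always_eventually) (simp add: divide_le_eq mult.commute)
    have "(\<lambda>N. y - (1/2) ^ N) \<longlonglongrightarrow> y - 0" by (intro tendsto_intros LIMSEQ_power_zero) simp
    then show "(\<lambda>N. y - (1/2) ^ N) \<longlonglongrightarrow> y" by simp
  qed simp
  then have "(\<lambda>n. real (c n) / 2 ^ Suc n) sums y" unfolding sums_def part .
  then show ?thesis using that c by blast
qed

text \<open>The parameter has ternary digits \<open>2 * b k\<close>, where \<open>b\<close>
  interleaves the binary digits of the four targets. Multiplication by 3^k shifts the digits up to
  an even integer, which the period 2 absorbs, and leaves the tail \<open>T k\<close>, in [0, 1/3]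
  or [2/3, 1] according to \<open>b k\<close>.\<close>

lemma schoenberg_curve_surj:
  assumes y: "\<And>i::nat. 0 \<le> y i" "\<And>i. y i < 1"
  obtains t where "t \<in> {0..1}" "\<And>i. i < 4 \<Longrightarrow> schoenberg_curve i t = y i"
proof -
  have "\<forall>i. \<exists>c::nat\<Rightarrow>nat. (\<forall>n. c n \<in> {0, 1}) \<and> (\<lambda>n. real (c n) / 2 ^ Suc n) sums y i"
  proof
    fix i
    obtain c :: "nat \<Rightarrow> nat" where "\<And>n. c n \<in> {0, 1}" "(\<lambda>n. real (c n) / 2 ^ Suc n) sums y i"
      by (rule binary_expansion[OF y(1)[of i] y(2)[of i]]) (rule that)
    then show "\<exists>c::nat\<Rightarrow>nat. (\<forall>n. c n \<in> {0, 1}) \<and> (\<lambda>n. real (c n) / 2 ^ Suc n) sums y i" by blast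
  qed
  from choice[OF this] obtain c :: "nat \<Rightarrow> nat \<Rightarrow> nat" where
    c': "\<forall>i. (\<forall>n. c i n \<in> {0, 1}) \<and> (\<lambda>n. real (c i n) / 2 ^ Suc n) sums y i" by (elim exE)
  have c: "c i n \<in> {0, 1}" "(\<lambda>n. real (c i n) / 2 ^ Suc n) sums y i" for i n
    using c'[THEN spec, of i] by blast+
  define b where "b k = real (c (k mod 4) (k div 4))" for k
  have b: "b k = 0 \<or> b k = 1" for k using c(1)[of "k mod 4" "k div 4"] by (auto simp: b_def)
  define f where "f k j = 2 * b (k + j) / 3 ^ Suc j" for k j
  have geo: "(\<lambda>j. 2 / 3 ^ Suc j :: real) sums 1"
  proof -
    have "(\<lambda>j. (2/3) * (1/3) ^ j :: real) sums ((2/3) * (1 / (1 - 1/3)))"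
      by (intro sums_mult geometric_sums) simp
    then show ?thesis by (simp add: power_one_over)
  qed
  have f0: "0 \<le> f k j" "f k j \<le> 2 / 3 ^ Suc j" for k j
    using b[of "k + j"] by (auto simp: f_def)
  have sf: "summable (f k)" for k
    by (rule summable_comparison_test'[OF sums_summable[OF geo], of 0]) (use f0 in auto)
  define T where "T k = suminf (f k)" for k
  have T01: "0 \<le> T k" "T k \<le> 1" for k
  proof -
    show "0 \<le> T k" unfolding T_def by (intro suminf_nonneg sf f0)
    have "T k \<le> (\<Sum>j. 2 / 3 ^ Suc j)" unfolding T_def by (intro suminf_le f0 sf sums_summable[OF geo])
    then show "T k \<le> 1" using sums_unique[OF geo] by simp
  qed
  have Trec: "T k = 2 * b k / 3 + T (Suc k) / 3" for k
  proof -
    have "T k = f k 0 + (\<Sum>j. f k (Suc j))" unfolding T_def by (simp add: suminf_split_head[OF sf])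
    moreover have "f k (Suc j) = f (Suc k) j / 3" for j by (simp add: f_def)
    ultimately show ?thesis using suminf_divide[OF sf, of "Suc k" 3] by (simp add: f_def T_def)
  qed
  have even: "\<exists>m::nat. 3 ^ k * T 0 = 2 * real m + T k" for k
  proof (induction k)
    case 0
    show ?case by (intro exI[of _ 0]) simp
  next
    case (Suc k)
    then obtain m where "3 ^ k * T 0 = 2 * real m + T k" by blast
    then have "3 ^ Suc k * T 0 = 2 * real (3 * m) + 2 * b k + T (Suc k)" using Trec[of k] by simp
    also have "\<dots> = 2 * real (3 * m + c (k mod 4) (k div 4)) + T (Suc k)" by (simp add: b_def)
    finally show ?case by blast
  qed
  have bit: "schoenberg_profile (3 ^ k * T 0) = b k" for k
  proof -
    obtain m :: nat where m: "3 ^ k * T 0 = 2 * real m + T k" using even by blast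
    have "cos (pi * (3 ^ k * T 0)) = cos (pi * T k + 2 * real m * pi)" by (simp only: m) (simp add: algebra_simps)
    also have "\<dots> = cos (pi * T k)" by (simp add: cos_add sin_times_pi_eq_0)
    finally have ce: "cos (pi * (3 ^ k * T 0)) = cos (pi * T k)" .
    show ?thesis
    proof (cases "b k = 0")
      case True
      then have "T k \<le> 1 / 3" using Trec[of k] T01(2)[of "Suc k"] by simp
      then have "cos (pi / 3) \<le> cos (pi * T k)"
        using T01(1)[of k] by (intro cos_monotone_0_pi_le) (auto simp: field_simps)
      then show ?thesis using True ce by (simp add: schoenberg_profile_def cos_60)
    next
      case False
      then have b1: "b k = 1" using b by blast
      then have "2 / 3 \<le> T k" using Trec[of k] T01(1)[of "Suc k"] by simp
      then have "cos (pi * T k) \<le> cos (2 * pi / 3)"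
        using T01(2)[of k] by (intro cos_monotone_0_pi_le) (auto simp: field_simps)
      also have "cos (2 * pi / 3) = - (1/2)" by (rule cos_120[simplified]) 
      finally show ?thesis using b1 ce by (simp add: schoenberg_profile_def)
    qed
  qed
  have "schoenberg_curve i (T 0) = y i" if "i < 4" for i
  proof -
    have "b (4 * n + i) = real (c i n)" for n using that by (simp add: b_def)
    then have "schoenberg_curve i (T 0) = (\<Sum>n. real (c i n) / 2 ^ Suc n)"
      unfolding schoenberg_curve_def bit by simp
    then show ?thesis using sums_unique[OF c(2)[of i]] by simp
  qed
  then show ?thesis using that[of "T 0"] T01[of 0] by auto
qed

lemma square_curve:
  assumes B: "B > 0"
  obtains \<pi> :: "real \<Rightarrow> complex \<times> complex" where "continuous_on UNIV \<pi>"
    "\<And>x. cmod (fst x) < B \<Longrightarrow> cmod (snd x) < B \<Longrightarrow> \<exists>t\<in>{0..1}. \<pi> t = x"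
proof -
  define g where "g i t = 2 * B * schoenberg_curve i t - B" for i t
  define \<pi> where "\<pi> t = (Complex (g 0 t) (g 1 t), Complex (g 2 t) (g 3 t))" for t
  have "continuous_on UNIV (g i)" for i
    unfolding g_def by (intro continuous_intros continuous_on_schoenberg_curve)
  then have "continuous_on UNIV \<pi>"
    unfolding \<pi>_def Complex_eq by (intro continuous_intros)
  moreover have "\<exists>t\<in>{0..1}. \<pi> t = x" if x: "cmod (fst x) < B" "cmod (snd x) < B" for x
  proof -
    define v where "v i = (if i = 0 then Re (fst x) else if i = 1 then Im (fst x) else if i = 2 then Re (snd x) else Im (snd x))" for i :: nat
    have "\<bar>v i\<bar> < B" for i
      using abs_Re_le_cmod[of "fst x"] abs_Im_le_cmod[of "fst x"] abs_Re_le_cmod[of "snd x"] abs_Im_le_cmod[of "snd x"] x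
      by (auto simp: v_def)
    then have "0 \<le> (v i + B) / (2 * B)" "(v i + B) / (2 * B) < 1" for i
      using B by (auto simp: field_simps abs_less_iff) (smt (verit))+
    then obtain t where t: "t \<in> {0..1}" "\<And>i. i < 4 \<Longrightarrow> schoenberg_curve i t = (v i + B) / (2 * B)"
      by (rule schoenberg_curve_surj[of "\<lambda>i. (v i + B) / (2 * B)"]) (rule that)
    have "g i t = v i" if "i < 4" for i using t(2)[OF that] B by (simp add: g_def)
    then have "\<pi> t = x" by (simp add: \<pi>_def v_def prod_eq_iff complex_eq_iff)
    then show ?thesis using t(1) by blast
  qed
  ultimately show ?thesis by (rule that)
qed

lemma weak_limit_of_multisets:
  fixes A :: "nat \<Rightarrow> (complex \<times> complex) multiset"
  assumes ne: "\<And>n. A n \<noteq> {#}"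
    and bd: "\<And>n x. x \<in># A n \<Longrightarrow> cmod (fst x) < B" "\<And>n x. x \<in># A n \<Longrightarrow> cmod (snd x) < B"
  obtains \<mu> s where "prob_space \<mu>" "sets \<mu> = sets borel" "strict_mono (s :: nat \<Rightarrow> nat)"
    "\<And>\<phi> :: complex \<times> complex \<Rightarrow> real. continuous_on UNIV \<phi> \<Longrightarrow> bounded (range \<phi>) \<Longrightarrow>
       (\<lambda>i. (\<Sum>x\<in>#A (s i). \<phi> x) / real (size (A (s i)))) \<longlonglongrightarrow> integral\<^sup>L \<mu> \<phi>"
proof -
  obtain x0 where "x0 \<in># A 0" using ne[of 0] by blast
  then have B: "B > 0" using bd(1)[of x0 0] norm_ge_zero[of "fst x0"] by linarith
  obtain \<pi> :: "real \<Rightarrow> complex \<times> complex" where \<pi>: "continuous_on UNIV \<pi>"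
    "\<And>x. cmod (fst x) < B \<Longrightarrow> cmod (snd x) < B \<Longrightarrow> \<exists>t\<in>{0..1}. \<pi> t = x"
    by (rule square_curve[OF B]) (rule that)
  then obtain \<tau> where \<tau>: "\<And>x. cmod (fst x) < B \<Longrightarrow> cmod (snd x) < B \<Longrightarrow> \<tau> x \<in> {0..1} \<and> \<pi> (\<tau> x) = x"
    by metis
  have "\<forall>n. \<exists>l. mset l = A n" using ex_mset by blast
  then obtain xs where xs: "\<And>n. mset (xs n) = A n" by metis
  define L where "L n = length (xs n)" for n
  have L2: "size (A n) = L n" for n unfolding L_def xs[of n, symmetric] by (rule size_mset)
  have "L n > 0" for n using ne[of n] unfolding L2[symmetric] nonempty_has_size .
  note L = this L2
  have xsb: "\<tau> (xs n ! i) \<in> {0..1}" "\<pi> (\<tau> (xs n ! i)) = xs n ! i" if "i < L n" for n i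
    using \<tau>[of "xs n ! i"] bd[of "xs n ! i" n] that nth_mem[of i "xs n"] by (auto simp: L_def xs[symmetric])
  \<comment> \<open>An index of a list enumerating \<open>A n\<close> is drawn uniformly, so
    repeated points receive their multiplicity.\<close>
  define \<nu> where "\<nu> n = distr (measure_pmf (pmf_of_set {..<L n})) borel (\<lambda>i. \<tau> (xs n ! i))" for n
  have Lset: "{..<L n} \<noteq> {}" "finite {..<L n}" for n using L(1)[of n] by auto
  have rd: "real_distribution (\<nu> n)" for n
    unfolding \<nu>_def by (intro prob_space.real_distribution_distr prob_space_measure_pmf) simp
  have tight: "tight \<nu>" unfolding tight_def
  proof (intro conjI allI impI)
    fix \<epsilon> :: real assume "\<epsilon> > 0"
    have "measure (\<nu> n) {-1<..1} = 1" for n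
    proof -
      have "measure (\<nu> n) {-1<..1} = measure (measure_pmf (pmf_of_set {..<L n})) ((\<lambda>i. \<tau> (xs n ! i)) -` {-1<..1})"
        unfolding \<nu>_def by (subst measure_distr) auto
      also have "\<dots> = 1"
      proof (subst measure_pmf.prob_eq_1)
        have "\<tau> (xs n ! i) \<in> {-1<..1}" if "i < L n" for i using xsb(1)[OF that] by simp
        then show "AE i in measure_pmf (pmf_of_set {..<L n}). i \<in> (\<lambda>i. \<tau> (xs n ! i)) -` {-1<..1}"
          by (simp add: AE_measure_pmf_iff set_pmf_of_set[OF Lset])
      qed simp
      finally show ?thesis .
    qed
    then show "\<exists>a b. a < b \<and> (\<forall>n. 1 - \<epsilon> < measure (\<nu> n) {a<..b})"
      using \<open>\<epsilon> > 0\<close> by (intro exI[of _ "-1"] exI[of _ 1]) auto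
  qed (rule rd)
  from tight_imp_convergent_subsubsequence[OF tight strict_mono_id, unfolded o_id]
  obtain s M where s: "strict_mono (s :: nat \<Rightarrow> nat)" and M: "real_distribution M" "weak_conv_m (\<nu> \<circ> s) M"
    by (elim exE conjE)
  interpret M: real_distribution M by fact
  have \<pi>m[measurable]: "\<pi> \<in> borel_measurable borel" using \<pi>(1) by (rule borel_measurable_continuous_onI)
  define \<mu> where "\<mu> = distr M borel \<pi>"
  have "prob_space \<mu>" unfolding \<mu>_def by (intro M.prob_space_distr) simp
  moreover have "sets \<mu> = sets borel" by (simp add: \<mu>_def)
  moreover have "(\<lambda>i. (\<Sum>x\<in>#A (s i). \<phi> x) / real (size (A (s i)))) \<longlonglongrightarrow> integral\<^sup>L \<mu> \<phi>"
    if \<phi>: "continuous_on UNIV \<phi>" "bounded (range \<phi>)" for \<phi> :: "complex \<times> complex \<Rightarrow> real"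
  proof -
    have \<phi>m[measurable]: "\<phi> \<in> borel_measurable borel" using \<phi>(1) by (rule borel_measurable_continuous_onI)
    obtain C where C: "\<And>x. norm (\<phi> x) \<le> C" using \<phi>(2) by (auto simp: bounded_iff)
    have "continuous_on UNIV (\<lambda>t. \<phi> (\<pi> t))" by (rule continuous_on_compose2[OF \<phi>(1) \<pi>(1)]) auto
    then have cont: "isCont (\<lambda>t. \<phi> (\<pi> t)) t" for t by (simp add: continuous_on_eq_continuous_at)
    have "(\<lambda>n. integral\<^sup>L ((\<nu> \<circ> s) n) (\<lambda>t. \<phi> (\<pi> t))) \<longlonglongrightarrow> integral\<^sup>L M (\<lambda>t. \<phi> (\<pi> t))"
      by (rule weak_conv_imp_integral_bdd_continuous_conv[OF _ M(1,2) cont C]) (simp add: rd)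
    moreover have "integral\<^sup>L (\<nu> n) (\<lambda>t. \<phi> (\<pi> t)) = (\<Sum>x\<in>#A n. \<phi> x) / real (size (A n))" for n
    proof -
      have "integral\<^sup>L (\<nu> n) (\<lambda>t. \<phi> (\<pi> t)) = (\<integral>i. \<phi> (\<pi> (\<tau> (xs n ! i))) \<partial>measure_pmf (pmf_of_set {..<L n}))"
        unfolding \<nu>_def by (subst integral_distr) auto
      also have "\<dots> = (\<Sum>i<L n. \<phi> (\<pi> (\<tau> (xs n ! i)))) / real (L n)"
        using Lset[of n] by (subst integral_pmf_of_set) auto
      also have "(\<Sum>i<L n. \<phi> (\<pi> (\<tau> (xs n ! i)))) = (\<Sum>i<L n. map \<phi> (xs n) ! i)"
        using xsb by (intro sum.cong) (auto simp: L_def)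
      also have "\<dots> = sum_list (map \<phi> (xs n))"
        by (simp add: sum_list_sum_nth L_def atLeast0LessThan)
      also have "\<dots> = (\<Sum>x\<in>#A n. \<phi> x)" by (simp add: xs[symmetric] sum_mset_sum_list[symmetric])
      finally show ?thesis by (simp add: L(2))
    qed
    moreover have "integral\<^sup>L \<mu> \<phi> = integral\<^sup>L M (\<lambda>t. \<phi> (\<pi> t))"
      unfolding \<mu>_def by (subst integral_distr) auto
    ultimately show ?thesis by (simp add: o_def)
  qed
  ultimately show ?thesis using that s by blast
qed

section \<open>The area formula for polynomials\<close>

text \<open>An isometry from \<open>real ^ 2\<close> to the complex plane; the change of variables
  formula is phrased with determinants of matrices, hence on the former.\<close>

definition vec_complex :: "real ^ 2 \<Rightarrow> complex" where
  "vec_complex x = Complex (x $ 1) (x $ 2)"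

definition complex_vec :: "complex \<Rightarrow> real ^ 2" where
  "complex_vec w = (\<chi> i. if i = 1 then Re w else Im w)"

lemma vec_complex_inverse [simp]: "complex_vec (vec_complex x) = x" "vec_complex (complex_vec w) = w"
  by (auto simp: vec_complex_def complex_vec_def vec_eq_iff forall_2)

lemma bounded_linear_vec_complex: "bounded_linear vec_complex"
  unfolding linear_conv_bounded_linear[symmetric]
  by (rule linearI) (auto simp: vec_complex_def complex_eq_iff)

lemma bounded_linear_complex_vec: "bounded_linear complex_vec"
  unfolding linear_conv_bounded_linear[symmetric]
  by (rule linearI) (auto simp: complex_vec_def vec_eq_iff)

lemma continuous_on_vec_complex: "continuous_on S vec_complex" "continuous_on S' complex_vec"
  by (auto intro: linear_continuous_on bounded_linear_vec_complex bounded_linear_complex_vec)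

lemma measurable_vec_complex [measurable]:
  "vec_complex \<in> borel_measurable borel" "complex_vec \<in> borel_measurable borel"
  by (auto intro!: borel_measurable_continuous_onI continuous_on_vec_complex)

lemma lborel_vec_complex: "distr lborel borel vec_complex = lborel"
proof (rule lborel_eqI[symmetric])
  fix l u :: complex assume lu: "\<And>b. b \<in> Basis \<Longrightarrow> l \<bullet> b \<le> u \<bullet> b"
  have lu': "Re l \<le> Re u" "Im l \<le> Im u" using lu[of 1] lu[of \<i>] by (auto simp: Basis_complex_def)
  have "vec_complex -` box l u = box (complex_vec l) (complex_vec u)"
    by (auto simp: mem_box Basis_complex_def vec_complex_def complex_vec_def Basis_vec_def inner_axis forall_2)
  then have "emeasure (distr lborel borel vec_complex) (box l u) = emeasure lborel (box (complex_vec l) (complex_vec u))"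
    by (subst emeasure_distr) auto
  also have "\<dots> = ennreal (\<Prod>b\<in>Basis. (complex_vec u - complex_vec l) \<bullet> b)"
    using lu' by (intro emeasure_lborel_box) (auto simp: Basis_vec_def inner_axis complex_vec_def)
  also have "(\<Prod>b\<in>Basis. (complex_vec u - complex_vec l) \<bullet> b) = (Re u - Re l) * (Im u - Im l)"
  proof -
    have Bs: "(Basis :: (real ^ 2) set) = {axis 1 1, axis 2 1}"
      by (auto simp: Basis_vec_def UNIV_2)
    have "axis 1 1 \<noteq> (axis 2 1 :: real ^ 2)" by (simp add: axis_eq_axis)
    then show ?thesis unfolding Bs by (simp add: inner_axis complex_vec_def)
  qed
  finally show "emeasure (distr lborel borel vec_complex) (box l u) = (\<Prod>b\<in>Basis. (u - l) \<bullet> b)"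
    by (simp add: Basis_complex_def)
qed simp

text \<open>Change of variables: by the Cauchy-Riemann equations the real Jacobian determinant of
  \<open>p\<close> is |p'|^2. Boundedness of \<open>S\<close> makes it integrable.\<close>

lemma emeasure_poly_image:
  fixes p :: "complex poly"
  assumes S: "S \<in> sets borel" "bounded S" and inj: "inj_on (poly p) S" and im: "poly p ` S \<in> sets borel"
  shows "emeasure lborel (poly p ` S) = (\<integral>\<^sup>+u. ennreal ((cmod (poly (pderiv p) u))\<^sup>2) * indicator S u \<partial>lborel)"
proof -
  define f where "f x = complex_vec (poly p (vec_complex x))" for x
  define S' where "S' = vec_complex -` S"
  define J where "J x = (cmod (poly (pderiv p) (vec_complex x)))\<^sup>2" for x
  define f' where "f' x h = complex_vec (poly (pderiv p) (vec_complex x) * vec_complex h)" for x h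
  have S'b: "S' \<in> sets borel" unfolding S'_def using S(1) measurable_sets[OF measurable_vec_complex(1), of S] by simp
  have S'img: "S' = complex_vec ` S" unfolding S'_def by (auto simp: image_iff) (metis vec_complex_inverse(1))
  have bS': "bounded S'" unfolding S'img by (rule bounded_linear_image[OF S(2) bounded_linear_complex_vec])
  have der: "(f has_derivative f' x) (at x within S')" for x
  proof -
    have "((\<lambda>x. poly p (vec_complex x)) has_derivative (\<lambda>h. poly (pderiv p) (vec_complex x) * vec_complex h)) (at x within S')"
      using has_derivative_compose[OF bounded_linear_imp_has_derivative[OF bounded_linear_vec_complex]
          has_field_derivative_imp_has_derivative[OF poly_DERIV[of p "vec_complex x"]]] by simp
    then show ?thesis unfolding f_def f'_def by (rule bounded_linear.has_derivative[OF bounded_linear_complex_vec])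
  qed
  have det: "\<bar>det (matrix (f' x))\<bar> = J x" for x
    unfolding J_def cmod_power2
    by (simp add: det_2 matrix_def f'_def complex_vec_def vec_complex_def axis_def power2_eq_square)
  have injf: "inj_on f S'"
    using inj unfolding f_def S'_def inj_on_def by (metis vec_complex_inverse vimage_eq)
  have Jc: "continuous_on A J" for A unfolding J_def
    by (intro continuous_intros continuous_on_vec_complex)
  obtain a b where ab: "S' \<subseteq> cbox a b" using bounded_subset_cbox_symmetric[OF bS'] by blast
  have "J absolutely_integrable_on cbox a b"
    by (rule absolutely_integrable_continuous[OF Jc])
  then have "J absolutely_integrable_on S'"
    by (rule set_integrable_subset[OF _ _ ab]) (use S'b in simp)
  then have int: "J integrable_on S'" using set_lebesgue_integral_eq_integral(1) by blast
  have S'l: "S' \<in> sets lebesgue" using S'b by simp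
  have int': "(\<lambda>x. \<bar>det (matrix (f' x))\<bar>) integrable_on S'" using int by (simp only: det)
  have meas: "f ` S' \<in> lmeasurable" "measure lebesgue (f ` S') = integral S' J"
    using measurable_differentiable_image_eq[OF S'l der injf] int'
      measure_differentiable_image_eq[OF S'l der injf int'] by (simp_all only: det)
  have fS: "f ` S' = vec_complex -` (poly p ` S)"
    unfolding S'_def
  proof safe
    fix x assume "vec_complex x \<in> S"
    then show "f x \<in> vec_complex -` (poly p ` S)" by (simp add: f_def)
  next
    fix x u assume "vec_complex x = poly p u" "u \<in> S"
    then show "x \<in> f ` vec_complex -` S"
      by (intro image_eqI[of _ _ "complex_vec u"]) (simp_all add: f_def flip: \<open>vec_complex x = poly p u\<close>)
  qed
  have fSb: "f ` S' \<in> sets borel"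
    unfolding fS using measurable_sets[OF measurable_vec_complex(1) im] by simp
  have [measurable]: "poly (pderiv p) \<in> borel_measurable borel"
    by (rule borel_measurable_continuous_onI) (intro continuous_intros)
  have mS: "(\<lambda>u. ennreal ((cmod (poly (pderiv p) u))\<^sup>2) * indicator S u) \<in> borel_measurable borel"
    using S(1) by measurable
  have "emeasure lborel (poly p ` S) = emeasure (distr lborel borel vec_complex) (poly p ` S)"
    by (simp only: lborel_vec_complex)
  also have "\<dots> = emeasure lborel (f ` S')" using im by (subst emeasure_distr) (auto simp: fS)
  also have "\<dots> = emeasure lebesgue (f ` S')" using fSb by simp
  also have "\<dots> = ennreal (integral S' J)" by (simp only: emeasure_eq_measure2[OF meas(1)] meas(2))
  also have "\<dots> = (\<integral>\<^sup>+x. ennreal (J x * indicator S' x) \<partial>lborel)"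
  proof (rule nn_integral_has_integral_lborel[symmetric])
    show "(\<lambda>x. J x * indicator S' x) \<in> borel_measurable borel"
      using borel_measurable_continuous_onI[OF Jc] S'b by measurable
    have "((\<lambda>x. if x \<in> S' then J x else 0) has_integral integral S' J) UNIV"
      using integrable_integral[OF int] by (simp only: has_integral_restrict_UNIV)
    moreover have "(\<lambda>x. if x \<in> S' then J x else 0) = (\<lambda>x. J x * indicator S' x)" by auto
    ultimately show "((\<lambda>x. J x * indicator S' x) has_integral integral S' J) UNIV" by simp
  qed (simp add: J_def)
  also have "\<dots> = (\<integral>\<^sup>+x. ennreal ((cmod (poly (pderiv p) (vec_complex x)))\<^sup>2) * indicator S (vec_complex x) \<partial>lborel)"
    by (intro nn_integral_cong) (auto simp: J_def S'_def indicator_def)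
  also have "\<dots> = (\<integral>\<^sup>+u. ennreal ((cmod (poly (pderiv p) u))\<^sup>2) * indicator S u \<partial>distr lborel borel vec_complex)"
    by (subst nn_integral_distr) (use mS in simp_all)
  finally show ?thesis by (simp only: lborel_vec_complex)
qed

lemma measurable_poly [measurable]: "poly p \<in> borel_measurable (borel :: complex measure)"
  by (rule borel_measurable_continuous_onI) (intro continuous_intros)

lemma nn_integral_poly_injective:
  fixes p :: "complex poly" and h :: "complex \<Rightarrow> ennreal"
  assumes B: "open B" "bounded B" and inj: "inj_on (poly p) B" and op: "open (poly p ` B)"
    and h[measurable]: "h \<in> borel_measurable borel"
  shows "(\<integral>\<^sup>+u. h (poly p u) * (ennreal ((cmod (poly (pderiv p) u))\<^sup>2) * indicator B u) \<partial>lborel) =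
    (\<integral>\<^sup>+v. h v * indicator (poly p ` B) v \<partial>lborel)"
proof -
  have Bm[measurable]: "B \<in> sets borel" "poly p ` B \<in> sets borel" using B(1) op by auto
  let ?w = "\<lambda>u. ennreal ((cmod (poly (pderiv p) u))\<^sup>2) * indicator B u"
  have "distr (density lborel ?w) borel (poly p) = density lborel (indicator (poly p ` B))"
  proof (rule measure_eqI)
    fix E assume "E \<in> sets (distr (density lborel ?w) borel (poly p))"
    then have E[measurable]: "E \<in> sets borel" by simp
    have pE: "poly p -` E \<in> sets borel" using measurable_sets[OF measurable_poly E] by simp
    have "emeasure (distr (density lborel ?w) borel (poly p)) E = (\<integral>\<^sup>+u. ?w u * indicator (poly p -` E) u \<partial>lborel)"
      using pE by (subst emeasure_distr) (auto simp: emeasure_density)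
    also have "\<dots> = (\<integral>\<^sup>+u. ennreal ((cmod (poly (pderiv p) u))\<^sup>2) * indicator (B \<inter> poly p -` E) u \<partial>lborel)"
      by (intro nn_integral_cong) (auto simp: indicator_def)
    also have "\<dots> = emeasure lborel (poly p ` (B \<inter> poly p -` E))"
    proof (rule emeasure_poly_image[symmetric])
      have "poly p ` (B \<inter> poly p -` E) = poly p ` B \<inter> E" by auto
      then show "poly p ` (B \<inter> poly p -` E) \<in> sets borel" by simp
      show "bounded (B \<inter> poly p -` E)" using B(2) by (rule bounded_subset) auto
      show "inj_on (poly p) (B \<inter> poly p -` E)" using inj by (rule inj_on_subset) auto
    qed (use pE in simp)
    also have "poly p ` (B \<inter> poly p -` E) = poly p ` B \<inter> E" by auto
    also have "emeasure lborel (poly p ` B \<inter> E) = emeasure (density lborel (indicator (poly p ` B))) E"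
      by (subst emeasure_density) (auto simp: indicator_inter_arith[symmetric] nn_integral_indicator)
    finally show "emeasure (distr (density lborel ?w) borel (poly p)) E = emeasure (density lborel (indicator (poly p ` B))) E" .
  qed simp
  then have "(\<integral>\<^sup>+v. h v \<partial>distr (density lborel ?w) borel (poly p)) = (\<integral>\<^sup>+v. h v \<partial>density lborel (indicator (poly p ` B)))"
    by simp
  then show ?thesis
    by (simp add: nn_integral_distr nn_integral_density mult.commute)
qed

text \<open>Off the finitely many critical points the plane is covered by countably many discs on
  which \<open>p\<close> is injective; made disjoint, each contributes a change of variables. Summed
  over the pieces, a regular value collects \<open>g\<close> over all its preimages, and the
  critical values form a null set.\<close>

lemma nn_integral_poly_area:
  fixes p :: "complex poly" and g :: "complex \<Rightarrow> ennreal"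
  assumes deg: "degree p > 0" and g[measurable]: "g \<in> borel_measurable borel"
  shows "(\<integral>\<^sup>+u. g u * ennreal ((cmod (poly (pderiv p) u))\<^sup>2) \<partial>lborel) =
    (\<integral>\<^sup>+v. (\<Sum>u\<in>#proots (p - [:v:]). g u) \<partial>lborel)"
proof -
  define crit where "crit = {u. poly (pderiv p) u = 0}"
  have "pderiv p \<noteq> 0" using deg by (simp add: pderiv_eq_0_iff)
  then have fin: "finite crit" unfolding crit_def by (rule poly_roots_finite)
  define \<F> where "\<F> = {ball u r | u r. 0 < r \<and> inj_on (poly p) (ball u r)}"
  have cov: "- crit \<subseteq> \<Union>\<F>"
  proof
    fix u assume "u \<in> - crit"
    then obtain r where "r > 0" "inj_on (poly p) (ball u r)"
      using has_complex_derivative_locally_injective[of "poly p" UNIV u] poly_holomorphic_on[OF holomorphic_on_ident, of p UNIV]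
      by (auto simp: deriv_poly crit_def)
    then show "u \<in> \<Union>\<F>" unfolding \<F>_def by (intro UnionI[of "ball u r"]) auto
  qed
  obtain \<F>' where \<F>': "\<F>' \<subseteq> \<F>" "countable \<F>'" "\<Union>\<F>' = \<Union>\<F>"
    by (rule Lindelof[of \<F>]) (auto simp: \<F>_def)
  have ne: "\<F>' \<noteq> {}"
  proof
    assume "\<F>' = {}"
    then have "- crit = {}" using cov \<F>'(3) by auto
    then have "finite (UNIV :: complex set)" using fin by (metis Compl_empty_eq double_compl)
    then show False by (simp add: infinite_UNIV_char_0)
  qed
  define B where "B = from_nat_into \<F>'"
  have BF: "B k \<in> \<F>" for k using from_nat_into[OF ne] \<F>'(1) by (auto simp: B_def)
  have BU: "- crit \<subseteq> (\<Union>k. B k)" using cov \<F>'(3) range_from_nat_into[OF ne \<F>'(2)] by (auto simp: B_def)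
  have B: "open (B k)" "bounded (B k)" "inj_on (poly p) (B k)" for k using BF[of k] by (auto simp: \<F>_def)
  have Bop: "open (poly p ` B k)" for k
    by (rule open_mapping_thm3[OF _ B(1,3)]) (intro holomorphic_intros)
  define D where "D = disjointed B"
  have Dsub: "D k \<subseteq> B k" for k unfolding D_def by (rule disjointed_subset)
  have Ddisj: "disjoint_family D" unfolding D_def by (rule disjoint_family_disjointed)
  have DU: "(\<Union>k. D k) = (\<Union>k. B k)" unfolding D_def by (rule UN_disjointed_eq)
  have Dm[measurable]: "D k \<in> sets borel" for k
    unfolding D_def disjointed_def using B(1) by auto
  let ?J = "\<lambda>u. ennreal ((cmod (poly (pderiv p) u))\<^sup>2)"
  have "\<exists>q. q holomorphic_on (poly p ` B k) \<and> (\<forall>u\<in>B k. q (poly p u) = u)" for k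
    by (rule holomorphic_has_inverse[OF _ B(1,3), of k]) (auto intro!: holomorphic_intros)
  then obtain q0 where q0: "\<And>k. q0 k holomorphic_on (poly p ` B k)" "\<And>k u. u \<in> B k \<Longrightarrow> q0 k (poly p u) = u" by metis
  define q where "q k v = (if v \<in> poly p ` B k then q0 k v else 0)" for k v
  have qm[measurable]: "q k \<in> borel_measurable borel" for k
    unfolding q_def using Bop[of k] holomorphic_on_imp_continuous_on[OF q0(1)]
    by (intro borel_measurable_continuous_on_if) auto
  have qp: "q k (poly p u) = u" if "u \<in> B k" for k u using that q0(2) by (auto simp: q_def)
  \<comment> \<open>What piece \<open>k\<close> contributes to the value \<open>v\<close>:
    \<open>g\<close> at the preimage of \<open>v\<close> in the k-th disc, provided that it lies in
    the disjoint piece \<open>D k\<close>. Outside the image of the disc \<open>q k\<close> has the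
    default value 0, hence the last indicator.\<close>
  define s where "s k v = g (q k v) * indicator (D k) (q k v) * indicator (poly p ` B k) v" for k v
  have [measurable]: "poly p ` B k \<in> sets borel" for k using Bop[of k] by simp
  have sm[measurable]: "s k \<in> borel_measurable borel" for k
    unfolding s_def by measurable
  have piece: "(\<integral>\<^sup>+u. g u * ?J u * indicator (D k) u \<partial>lborel) = (\<integral>\<^sup>+v. s k v \<partial>lborel)" for k
  proof -
    have "(\<integral>\<^sup>+u. g u * ?J u * indicator (D k) u \<partial>lborel) =
        (\<integral>\<^sup>+u. (g (q k (poly p u)) * indicator (D k) (q k (poly p u))) * (?J u * indicator (B k) u) \<partial>lborel)"
      using Dsub[of k] qp[of _ k] by (intro nn_integral_cong) (auto simp: indicator_def)
    also have "\<dots> = (\<integral>\<^sup>+v. (g (q k v) * indicator (D k) (q k v)) * indicator (poly p ` B k) v \<partial>lborel)"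
      by (rule nn_integral_poly_injective[OF B Bop]) measurable
    finally show ?thesis by (simp only: s_def)
  qed
  have one: "(\<Sum>k. indicator (D k) u :: ennreal) = 1" if "u \<notin> crit" for u
  proof -
    have "u \<in> (\<Union>k. B k)" using BU that by blast
    then show ?thesis using suminf_indicator[OF Ddisj, of u] unfolding DU by simp
  qed
  have "(\<integral>\<^sup>+u. g u * ?J u \<partial>lborel) = (\<integral>\<^sup>+u. (\<Sum>k. g u * ?J u * indicator (D k) u) \<partial>lborel)"
  proof (intro nn_integral_cong)
    fix u
    show "g u * ?J u = (\<Sum>k. g u * ?J u * indicator (D k) u)"
      by (cases "u \<in> crit") (auto simp: crit_def one)
  qed
  also have "\<dots> = (\<Sum>k. \<integral>\<^sup>+u. g u * ?J u * indicator (D k) u \<partial>lborel)"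
    by (intro nn_integral_suminf) measurable
  also have "\<dots> = (\<Sum>k. \<integral>\<^sup>+v. s k v \<partial>lborel)" by (simp only: piece)
  also have "\<dots> = (\<integral>\<^sup>+v. (\<Sum>k. s k v) \<partial>lborel)" by (intro nn_integral_suminf[symmetric]) measurable
  also have "\<dots> = (\<integral>\<^sup>+v. (\<Sum>u\<in>#proots (p - [:v:]). g u) \<partial>lborel)"
  proof (rule nn_integral_cong_AE)
    have "AE v in lborel. v \<notin> poly p ` crit"
      using fin by (intro AE_not_in finite_imp_null_set_lborel) auto
    then show "AE v in lborel. (\<Sum>k. s k v) = (\<Sum>u\<in>#proots (p - [:v:]). g u)"
    proof eventually_elim
      case (elim v)
      define W where "W = {u. poly (p - [:v:]) u = 0}"
      have nz: "p - [:v:] \<noteq> 0" using deg by (metis degree_diff_const degree_0 less_irrefl)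
      have W: "finite W" unfolding W_def using nz by (rule poly_roots_finite)
      have Wc: "u \<notin> crit" if "u \<in> W" for u using that elim by (auto simp: W_def)
      have "proots (p - [:v:]) = mset_set W"
        unfolding W_def using Wc by (intro proots_simple(1) nz) (auto simp: W_def crit_def pderiv_diff pderiv_pCons)
      then have "(\<Sum>u\<in>#proots (p - [:v:]). g u) = (\<Sum>u\<in>W. g u)" by (simp add: sum_unfold_sum_mset)
      also have "\<dots> = (\<Sum>u\<in>W. \<Sum>k. g u * indicator (D k) u)"
        using Wc by (intro sum.cong) (auto simp: one)
      also have "\<dots> = (\<Sum>k. \<Sum>u\<in>W. g u * indicator (D k) u)" by (simp add: suminf_sum)
      also have "(\<lambda>k. \<Sum>u\<in>W. g u * indicator (D k) u) = (\<lambda>k. s k v)"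
      proof
        fix k
        show "(\<Sum>u\<in>W. g u * indicator (D k) u) = s k v"
        proof (cases "\<exists>u\<in>B k. poly p u = v")
          case True
          then obtain u where u: "u \<in> B k" "poly p u = v" by blast
          have "indicator (D k) u' = (0::ennreal)" if "u' \<in> W - {u}" for u'
            using that u B(3)[of k] Dsub[of k] by (auto simp: W_def indicator_def inj_on_def)
          then have "(\<Sum>u\<in>W. g u * indicator (D k) u) = g u * indicator (D k) u"
            using u W by (subst sum.remove[of W u]) (auto simp: W_def)
          also have "\<dots> = s k v"
          proof -
            have "v \<in> poly p ` B k" using u by auto
            moreover have "q k v = u" using qp[OF u(1)] u(2) by simp
            ultimately show ?thesis by (simp add: s_def)
          qed
          finally show ?thesis .
        next
          case False
          then have "indicator (D k) u = (0::ennreal)" if "u \<in> W" for u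
            using that Dsub[of k] by (auto simp: W_def indicator_def)
          moreover have "v \<notin> poly p ` B k" using False by auto
          then have "s k v = 0" by (simp add: s_def)
          ultimately show ?thesis by simp
        qed
      qed
      finally show ?case by simp
    qed
  qed
  finally show ?thesis .
qed

section \<open>The equilibrium measure of a skew product\<close>

definition fs_density :: "complex \<times> complex \<Rightarrow> ennreal" where
  "fs_density y = ennreal (2 / pi\<^sup>2 / (1 + (norm y)\<^sup>2) ^ 3)"

lemma one_plus_norm_nz: "1 + (norm (y :: 'a :: real_normed_vector))\<^sup>2 \<noteq> 0" "(1 + (norm y)\<^sup>2) ^ 3 \<noteq> 0"
proof -
  have "1 + (norm y)\<^sup>2 > 0" by (intro add_pos_nonneg) auto
  then show "1 + (norm y)\<^sup>2 \<noteq> 0" "(1 + (norm y)\<^sup>2) ^ 3 \<noteq> 0" by simp_all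
qed

lemma measurable_fs_density [measurable]: "fs_density \<in> borel_measurable borel"
proof -
  have "(\<lambda>y::complex \<times> complex. 2 / pi\<^sup>2 / (1 + (norm y)\<^sup>2) ^ 3) \<in> borel_measurable borel"
    by (rule borel_measurable_continuous_onI) (intro continuous_intros ballI; simp add: one_plus_norm_nz)
  then show ?thesis unfolding fs_density_def by measurable
qed

text \<open>The disc of radius sqrt(t) has area pi t, so |w|^2 is distributed with constant density
  pi. This stands in for polar coordinates.\<close>

lemma distr_cmod_square:
  "distr lborel borel (\<lambda>w::complex. (cmod w)\<^sup>2) = density lborel (\<lambda>t. ennreal pi * indicator {0..} t)"
proof (rule measure_eqI_generator_eq[where E = "range (\<lambda>a::real. {..a})" and A = "\<lambda>i. {..real i}" and \<Omega> = UNIV])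
  have vol: "emeasure (distr lborel borel (\<lambda>w::complex. (cmod w)\<^sup>2)) {..t} = ennreal (pi * max 0 t)" for t
  proof (cases "t \<ge> 0")
    case True
    have eq: "(\<lambda>w::complex. (cmod w)\<^sup>2) -` {..t} = cball 0 (sqrt t)"
      using True by (auto simp: real_le_rsqrt real_sqrt_ge_0_iff intro: order.trans[OF power_mono])
        (metis norm_ge_zero power_mono real_sqrt_pow2)
    have "emeasure (distr lborel borel (\<lambda>w::complex. (cmod w)\<^sup>2)) {..t} = emeasure lborel (cball (0::complex) (sqrt t))"
      by (subst emeasure_distr) (auto simp: eq)
    also have "\<dots> = ennreal (pi * t)"
      using True by (subst emeasure_cball) (auto simp: unit_ball_vol_2 DIM_complex)
    finally show ?thesis using True by simp
  next
    case False
    then have "(\<lambda>w::complex. (cmod w)\<^sup>2) -` {..t} = {}"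
      using zero_le_power2 by (auto simp del: zero_le_power2) (smt (verit) zero_le_power2)
    then show ?thesis using False by (subst emeasure_distr) auto
  qed
  have vol2: "emeasure (density lborel (\<lambda>t. ennreal pi * indicator {0..} t)) {..t} = ennreal (pi * max 0 t)" for t :: real
  proof -
    have "emeasure (density lborel (\<lambda>t. ennreal pi * indicator {0..} t)) {..t} = (\<integral>\<^sup>+s. ennreal pi * indicator {0..t} s \<partial>lborel)"
      by (subst emeasure_density) (auto intro!: nn_integral_cong simp: indicator_def)
    also have "\<dots> = ennreal pi * emeasure lborel {0..t}" by (simp add: nn_integral_cmult)
    also have "\<dots> = ennreal (pi * max 0 t)" by (cases "t \<ge> 0") (auto simp: ennreal_mult' )
    finally show ?thesis .
  qed
  show "emeasure (distr lborel borel (\<lambda>w::complex. (cmod w)\<^sup>2)) X = emeasure (density lborel (\<lambda>t. ennreal pi * indicator {0..} t)) X"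
    if "X \<in> range (\<lambda>a::real. {..a})" for X using that vol vol2 by auto
  show "emeasure (distr lborel borel (\<lambda>w::complex. (cmod w)\<^sup>2)) {..real i} \<noteq> \<infinity>" for i by (simp add: vol)
  show "Int_stable (range (\<lambda>a::real. {..a}))" by (auto simp: Int_stable_def)
  show "(\<Union>i. {..real i}) = UNIV" by (auto intro: real_arch_simple)
  have "sets (borel :: real measure) = sigma_sets UNIV (range (\<lambda>a::real. {..a}))"
    unfolding borel_eq_atMost by (simp add: sets_measure_of)
  then show "sets (distr lborel borel (\<lambda>w::complex. (cmod w)\<^sup>2)) = sigma_sets UNIV (range (\<lambda>a::real. {..a}))"
    "sets (density lborel (\<lambda>t::real. ennreal pi * indicator {0..} t)) = sigma_sets UNIV (range (\<lambda>a::real. {..a}))" by simp_all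
qed auto

lemma nn_integral_radial:
  assumes [measurable]: "h \<in> borel_measurable borel"
  shows "(\<integral>\<^sup>+w. h ((cmod w)\<^sup>2) \<partial>lborel) = ennreal pi * (\<integral>\<^sup>+t. h t * indicator {0..} t \<partial>lborel)"
proof -
  have "(\<integral>\<^sup>+w. h ((cmod w)\<^sup>2) \<partial>lborel) = (\<integral>\<^sup>+t. h t \<partial>distr lborel borel (\<lambda>w::complex. (cmod w)\<^sup>2))"
    by (subst nn_integral_distr) auto
  also have "\<dots> = (\<integral>\<^sup>+t. ennreal pi * (h t * indicator {0..} t) \<partial>lborel)"
    unfolding distr_cmod_square by (subst nn_integral_density) (auto simp: mult_ac)
  finally show ?thesis by (simp add: nn_integral_cmult)
qed

lemma nn_integral_radial_power:
  assumes c: "c > 0" and m: "m > 0"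
  shows "(\<integral>\<^sup>+w. ennreal (1 / (c + (cmod w)\<^sup>2) ^ Suc m) \<partial>lborel) = ennreal (pi / (real m * c ^ m))"
proof -
  have "(\<integral>\<^sup>+t. ennreal (1 / (c + t) ^ Suc m) * indicator {0..} t \<partial>lborel) = ennreal (0 - (- 1 / (real m * (c + 0) ^ m)))"
  proof (rule nn_integral_FTC_atLeast)
    show "(\<lambda>t. 1 / (c + t) ^ Suc m) \<in> borel_measurable borel" by measurable
    fix x :: real assume x: "0 \<le> x"
    have "((\<lambda>t. - 1 / (real m * (c + t) ^ m)) has_real_derivative
        (real m * (real m * (c + x) ^ (m - 1))) / (real m * (c + x) ^ m)\<^sup>2) (at x)"
      using c m x by (auto intro!: derivative_eq_intros simp: power2_eq_square)
    moreover have "(real m * (real m * (c + x) ^ (m - 1))) / (real m * (c + x) ^ m)\<^sup>2 = 1 / (c + x) ^ Suc m"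
    proof -
      have "(c + x) ^ m = (c + x) * (c + x) ^ (m - 1)" using m by (metis power_eq_if less_irrefl)
      moreover have "M * (M * X) / (M * (s * X))\<^sup>2 = 1 / (s * (s * X))" if "s > 0" "X > 0" "M > 0" for s X M :: real
        using that by (simp add: power2_eq_square)
      ultimately show ?thesis using c m x by simp
    qed
    ultimately show "((\<lambda>t. - 1 / (real m * (c + t) ^ m)) has_real_derivative 1 / (c + x) ^ Suc m) (at x)" by simp
    show "0 \<le> 1 / (c + x) ^ Suc m" using c x by simp
  next
    have "filterlim (\<lambda>t. c + t) at_top at_top" by (rule filterlim_tendsto_add_at_top[OF tendsto_const filterlim_ident])
    then have "filterlim (\<lambda>t. (c + t) ^ m) at_top at_top" using m by (intro filterlim_pow_at_top)
    then have "filterlim (\<lambda>t. real m * (c + t) ^ m) at_top at_top"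
      using m by (intro filterlim_tendsto_pos_mult_at_top[OF tendsto_const]) auto
    then show "((\<lambda>t. - 1 / (real m * (c + t) ^ m)) \<longlongrightarrow> 0) at_top"
      by (intro tendsto_divide_0[OF tendsto_const] filterlim_at_top_imp_at_infinity)
  qed
  then show ?thesis
    by (subst nn_integral_radial[of "\<lambda>t. ennreal (1 / (c + t) ^ Suc m)"]) (use c in \<open>auto simp: ennreal_mult'[symmetric]\<close>)
qed

text \<open>Confirms the normalising constant: integrating out w leaves a multiple of (1 +
  |z|^2)^(-2), and both integrals are radial power integrals.\<close>

lemma nn_integral_fs_density: "(\<integral>\<^sup>+y. fs_density y \<partial>lborel) = 1"
proof -
  have pos: "1 + (cmod z)\<^sup>2 > 0" for z using zero_le_power2[of "cmod z"] by linarith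
  have "(\<integral>\<^sup>+y. fs_density y \<partial>lborel) = (\<integral>\<^sup>+y. fs_density y \<partial>(lborel \<Otimes>\<^sub>M lborel))" by (simp only: lborel_prod)
  also have "\<dots> = (\<integral>\<^sup>+z. \<integral>\<^sup>+w. fs_density (z, w) \<partial>lborel \<partial>lborel)"
    by (rule lborel.nn_integral_fst[symmetric]) (unfold lborel_prod, measurable)
  also have "\<dots> = (\<integral>\<^sup>+z. \<integral>\<^sup>+w. ennreal (2 / pi\<^sup>2) * ennreal (1 / ((1 + (cmod z)\<^sup>2) + (cmod w)\<^sup>2) ^ Suc 2) \<partial>lborel \<partial>lborel)"
    by (intro nn_integral_cong) (simp add: fs_density_def norm_Pair ennreal_mult'[symmetric] eval_nat_numeral add.assoc)
  also have "\<dots> = (\<integral>\<^sup>+z. ennreal (2 / pi\<^sup>2) * ennreal (pi / (real 2 * (1 + (cmod z)\<^sup>2) ^ 2)) \<partial>lborel)"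
    using pos by (intro nn_integral_cong) (subst nn_integral_cmult, simp, subst nn_integral_radial_power, auto)
  also have "\<dots> = (\<integral>\<^sup>+z. ennreal (1 / pi) * ennreal (1 / (1 + (cmod z)\<^sup>2) ^ Suc 1) \<partial>lborel)"
    by (intro nn_integral_cong) (simp add: ennreal_mult'[symmetric] power2_eq_square)
  also have "\<dots> = ennreal (1 / pi) * ennreal (pi / (real 1 * 1 ^ 1))"
    by (subst nn_integral_cmult, measurable, subst nn_integral_radial_power) auto
  also have "\<dots> = 1" by (simp add: ennreal_mult'[symmetric])
  finally show ?thesis .
qed

lemma complex_jacobian_skew_product:
  "complex_jacobian (skew_product d a ^^ n) (z, w) =
     poly (pderiv (monom 1 (d ^ n))) z * fibre_deriv d a z n w"
proof -
  have "deriv (\<lambda>u. u ^ (d ^ n)) z = poly (pderiv (monom 1 (d ^ n))) z"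
  proof -
    have "poly (monom 1 (d ^ n)) = (\<lambda>u::complex. u ^ (d ^ n))" by (auto simp: poly_monom)
    then show ?thesis using deriv_poly[of "monom 1 (d ^ n)" z] by simp
  qed
  moreover have "deriv (fibre_iterate d a z n) w = fibre_deriv d a z n w"
    by (rule DERIV_imp_deriv) (rule fibre_iterate_DERIV)
  ultimately show ?thesis by (simp add: complex_jacobian_def skew_product_iterate)
qed

lemma continuous_on_pullback_average:
  assumes d: "d \<ge> 2" and \<phi>: "continuous_on UNIV \<phi>"
  shows "continuous_on UNIV (pullback_average d a n \<phi>)"
proof -
  have D: "d ^ n > 0" using d by simp
  have "(\<lambda>i. pullback_average d a n \<phi> (x i)) \<longlonglongrightarrow> pullback_average d a n \<phi> (z0, v0)"
    if x: "x \<longlonglongrightarrow> (z0, v0)" for x :: "nat \<Rightarrow> complex \<times> complex" and z0 v0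
  proof -
    have zl: "(\<lambda>i. fst (x i)) \<longlonglongrightarrow> z0" and vl: "(\<lambda>i. snd (x i)) \<longlonglongrightarrow> v0"
      using tendsto_fst[OF x] tendsto_snd[OF x] by auto
    have lc: "lead_coeff (monom 1 (d ^ n) - [:c:]) = (1::complex)" for c
      using D by (subst lead_coeff_diff_const) (auto simp: degree_monom_eq)
    have "\<forall>\<^sub>F i in sequentially. rel_mset (\<lambda>x y. dist x y \<le> \<epsilon>)
        (proots (monom 1 (d ^ n) - [:fst (x i):])) (proots (monom 1 (d ^ n) - [:z0:]))" if "\<epsilon> > 0" for \<epsilon>
    proof (rule proots_tendsto[where n = "d ^ n"])
      fix j
      have "(\<lambda>i. coeff [:fst (x i):] j) \<longlonglongrightarrow> coeff [:z0:] j" using zl by (cases j) auto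
      then show "(\<lambda>i. coeff (monom 1 (d ^ n) - [:fst (x i):]) j) \<longlonglongrightarrow> coeff (monom 1 (d ^ n) - [:z0:]) j"
        unfolding coeff_diff by (intro tendsto_diff tendsto_const)
    qed (use that lc in \<open>simp_all only: degree_diff_const, auto simp: degree_monom_eq\<close>)
    from sum_mset_tendsto[OF this continuous_on_fibre_average[OF d \<phi>, of a n] vl]
    show ?thesis
      unfolding pullback_average_def case_prod_beta fst_conv snd_conv
      by (intro tendsto_divide tendsto_const) (use d in auto)
  qed
  then show ?thesis by (auto simp: continuous_on_sequentially o_def)
qed

lemma sum_mset_ennreal:
  assumes "\<And>x. 0 \<le> f x" shows "(\<Sum>x\<in>#A. ennreal (f x)) = ennreal (\<Sum>x\<in>#A. f x)"
proof (induction A)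
  case (add x A)
  have "0 \<le> (\<Sum>x\<in>#A. f x)" using assms by (induction A) auto
  then show ?case using add assms by (simp add: ennreal_plus)
qed simp

text \<open>The Jacobian matrix of the iterate is triangular, so the change of variables splits: for
  fixed \<open>z\<close> the area formula in the fibre passes from w to v = Q^n(w) and produces
  fibre averages; then, for fixed \<open>v\<close>, the area formula for z^(d^n) averages these over
  the roots.\<close>

lemma fubini_study_nn_integral:
  assumes d: "d \<ge> 2" and \<phi>: "continuous_on UNIV \<phi>" "\<And>x. 0 \<le> \<phi> x"
  shows "(\<integral>\<^sup>+x. ennreal (\<phi> x) \<partial>fubini_study_pullback (skew_product d a ^^ n)) =
    (\<integral>\<^sup>+y. ennreal ((real (d ^ n))\<^sup>2 * pullback_average d a n \<phi> y) * fs_density y \<partial>lborel)"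
proof -
  define N where "N = d ^ n"
  have N: "N > 0" using d by (simp add: N_def)
  define P where "P z = fibre_iterate_poly d a z n" for z
  define p1 where "p1 = monom (1::complex) N"
  define J1 where "J1 z = ennreal ((cmod (poly (pderiv p1) z))\<^sup>2)" for z
  define J2 where "J2 z w = ennreal ((cmod (poly (pderiv (P z)) w))\<^sup>2)" for z w
  define H where "H z v = fibre_average d a n \<phi> z v" for z v
  have \<phi>m[measurable]: "\<phi> \<in> borel_measurable borel" using \<phi>(1) by (rule borel_measurable_continuous_onI)
  have H0: "0 \<le> H z v" for z v
  proof -
    have "0 \<le> (\<Sum>u\<in>#A. \<phi> (z, u))" for A using \<phi>(2) by (induction A) auto
    then show ?thesis by (simp add: H_def fibre_average_def)
  qed
  have pd: "poly p1 z = z ^ N" for z by (simp add: p1_def poly_monom)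
  have Pd: "poly (P z) w = fibre_iterate d a z n w" for z w by (simp add: P_def)
  have cJ1: "continuous_on UNIV (\<lambda>x::complex \<times> complex. (cmod (poly (pderiv p1) (fst x)))\<^sup>2)" by (intro continuous_intros)
  have cJ2: "continuous_on UNIV (\<lambda>x. (cmod (poly (pderiv (P (fst x))) (snd x)))\<^sup>2)"
    unfolding P_def by (intro continuous_intros continuous_on_fibre_deriv)
  have cF: "continuous_on UNIV (\<lambda>x. (fst x ^ N, fibre_iterate d a (fst x) n (snd x)))" by (intro continuous_intros)
  have mJ1[measurable]: "(\<lambda>x::complex \<times> complex. J1 (fst x)) \<in> borel_measurable borel"
    unfolding J1_def using borel_measurable_continuous_onI[OF cJ1] by measurable
  have mJ2[measurable]: "(\<lambda>x. J2 (fst x) (snd x)) \<in> borel_measurable borel"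
    unfolding J2_def using borel_measurable_continuous_onI[OF cJ2] by measurable
  have mF[measurable]: "(\<lambda>x. fs_density (fst x ^ N, fibre_iterate d a (fst x) n (snd x))) \<in> borel_measurable borel"
    using measurable_compose[OF borel_measurable_continuous_onI[OF cF] measurable_fs_density] .
  have dens: "ennreal (2 / pi\<^sup>2 * (cmod (complex_jacobian (skew_product d a ^^ n) x))\<^sup>2 / (1 + (norm ((skew_product d a ^^ n) x))\<^sup>2) ^ 3)
      = J1 (fst x) * (J2 (fst x) (snd x) * fs_density (fst x ^ N, fibre_iterate d a (fst x) n (snd x)))" for x
  proof (cases x)
    case (Pair z w)
    have "J1 z * (J2 z w * fs_density (z ^ N, fibre_iterate d a z n w)) =
      ennreal ((cmod (poly (pderiv p1) z))\<^sup>2 * ((cmod (poly (pderiv (P z)) w))\<^sup>2 * (2 / pi\<^sup>2 / (1 + (norm (z ^ N, fibre_iterate d a z n w))\<^sup>2) ^ 3)))"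
      unfolding J1_def J2_def fs_density_def by (subst ennreal_mult', simp)+ simp
    then show ?thesis
      unfolding Pair complex_jacobian_skew_product
      by (simp add: skew_product_iterate N_def p1_def P_def norm_mult power_mult_distrib mult_ac)
  qed
  let ?G = "\<lambda>x. J1 (fst x) * (J2 (fst x) (snd x) * fs_density (fst x ^ N, fibre_iterate d a (fst x) n (snd x))) * ennreal (\<phi> x)"
  have "(\<integral>\<^sup>+x. ennreal (\<phi> x) \<partial>fubini_study_pullback (skew_product d a ^^ n)) = (\<integral>\<^sup>+x. ?G x \<partial>lborel)"
    unfolding fubini_study_pullback_def dens by (subst nn_integral_density) auto
  also have "\<dots> = (\<integral>\<^sup>+x. ?G x \<partial>(lborel \<Otimes>\<^sub>M lborel))" by (simp only: lborel_prod)
  also have "\<dots> = (\<integral>\<^sup>+z. \<integral>\<^sup>+w. ?G (z, w) \<partial>lborel \<partial>lborel)"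
    by (rule lborel.nn_integral_fst[symmetric]) (unfold lborel_prod, measurable)
  also have "\<dots> = (\<integral>\<^sup>+z. \<integral>\<^sup>+v. J1 z * (fs_density (z ^ N, v) * ennreal (real N * H z v)) \<partial>lborel \<partial>lborel)"
  proof (rule nn_integral_cong)
    fix z :: complex
    have m2[measurable]: "(\<lambda>w. fs_density (z ^ N, w)) \<in> borel_measurable borel"
      by (rule measurable_compose[OF _ measurable_fs_density]) (auto intro!: borel_measurable_continuous_onI continuous_intros)
    have "fibre_iterate d a z n \<in> borel_measurable borel"
      by (intro borel_measurable_continuous_onI continuous_intros)
    then have m6[measurable]: "(\<lambda>w. fs_density (z ^ N, fibre_iterate d a z n w)) \<in> borel_measurable borel"
      by (rule measurable_compose[OF _ m2])
    have m3[measurable]: "(\<lambda>w. \<phi> (z, w)) \<in> borel_measurable borel"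
      by (rule measurable_compose[OF _ \<phi>m]) (auto intro!: borel_measurable_continuous_onI continuous_intros)
    have m4[measurable]: "(\<lambda>v. H z v) \<in> borel_measurable borel"
    proof (rule borel_measurable_continuous_onI)
      have "continuous_on UNIV (\<lambda>v::complex. (z, v))"
        by (intro continuous_on_Pair continuous_on_const continuous_on_id)
      from continuous_on_compose2[OF continuous_on_fibre_average[OF d \<phi>(1), of a n] this]
      show "continuous_on UNIV (H z)" unfolding H_def by simp
    qed
    have m5[measurable]: "J2 z \<in> borel_measurable borel"
      unfolding J2_def by measurable
    have "(\<integral>\<^sup>+w. ?G (z, w) \<partial>lborel) = (\<integral>\<^sup>+w. J1 z * (fs_density (z ^ N, poly (P z) w) * ennreal (\<phi> (z, w)) * J2 z w) \<partial>lborel)"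
      by (intro nn_integral_cong) (simp add: Pd mult_ac)
    also have "\<dots> = J1 z * (\<integral>\<^sup>+w. (fs_density (z ^ N, poly (P z) w) * ennreal (\<phi> (z, w))) * J2 z w \<partial>lborel)"
      by (subst nn_integral_cmult) auto
    also have "(\<integral>\<^sup>+w. (fs_density (z ^ N, poly (P z) w) * ennreal (\<phi> (z, w))) * J2 z w \<partial>lborel)
        = (\<integral>\<^sup>+v. (\<Sum>u\<in>#proots (P z - [:v:]). fs_density (z ^ N, poly (P z) u) * ennreal (\<phi> (z, u))) \<partial>lborel)"
      unfolding J2_def by (rule nn_integral_poly_area) (use d in \<open>auto simp: P_def degree_fibre_iterate_poly\<close>)
    also have "\<dots> = (\<integral>\<^sup>+v. fs_density (z ^ N, v) * ennreal (real N * H z v) \<partial>lborel)"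
    proof (rule nn_integral_cong)
      fix v
      have "(\<Sum>u\<in>#proots (P z - [:v:]). fs_density (z ^ N, poly (P z) u) * ennreal (\<phi> (z, u))) =
          (\<Sum>u\<in>#fibre_preimages d a z n v. fs_density (z ^ N, v) * ennreal (\<phi> (z, u)))"
        unfolding P_def fibre_preimages_def[symmetric]
        by (intro arg_cong[of _ _ sum_mset] image_mset_cong) (auto simp: set_fibre_preimages[OF d])
      also have "\<dots> = fs_density (z ^ N, v) * (\<Sum>u\<in>#fibre_preimages d a z n v. ennreal (\<phi> (z, u)))"
        by (simp add: sum_mset_distrib_left)
      also have "(\<Sum>u\<in>#fibre_preimages d a z n v. ennreal (\<phi> (z, u))) = ennreal (real N * H z v)"
        using N by (simp add: sum_mset_ennreal[OF \<phi>(2)] H_def fibre_average_def N_def)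
      finally show "(\<Sum>u\<in>#proots (P z - [:v:]). fs_density (z ^ N, poly (P z) u) * ennreal (\<phi> (z, u))) =
        fs_density (z ^ N, v) * ennreal (real N * H z v)" .
    qed
    finally show "(\<integral>\<^sup>+w. ?G (z, w) \<partial>lborel) = (\<integral>\<^sup>+v. J1 z * (fs_density (z ^ N, v) * ennreal (real N * H z v)) \<partial>lborel)"
      by (subst nn_integral_cmult) auto
  qed
  \<comment> \<open>The order of integration is exchanged because the second change of variables is
    in \<open>z\<close> with \<open>v\<close> fixed.\<close>
  also have "\<dots> = (\<integral>\<^sup>+v. \<integral>\<^sup>+z. J1 z * (fs_density (z ^ N, v) * ennreal (real N * H z v)) \<partial>lborel \<partial>lborel)"
  proof (rule lborel_pair.Fubini'[symmetric])
    have "continuous_on UNIV (\<lambda>x::complex \<times> complex. (fst x ^ N, snd x))" by (intro continuous_intros)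
    then have [measurable]: "(\<lambda>x::complex \<times> complex. fs_density (fst x ^ N, snd x)) \<in> borel_measurable borel"
      by (intro measurable_compose[OF borel_measurable_continuous_onI measurable_fs_density])
    have [measurable]: "(\<lambda>x. H (fst x) (snd x)) \<in> borel_measurable borel"
      unfolding H_def by (rule borel_measurable_continuous_onI) (rule continuous_on_fibre_average[OF d \<phi>(1)])
    have "(\<lambda>x. J1 (fst x) * (fs_density (fst x ^ N, snd x) * ennreal (real N * H (fst x) (snd x)))) \<in> borel_measurable (borel :: (complex \<times> complex) measure)"
      by measurable
    then show "(\<lambda>(z, v). J1 z * (fs_density (z ^ N, v) * ennreal (real N * H z v))) \<in> borel_measurable (lborel \<Otimes>\<^sub>M lborel)"
      unfolding lborel_prod by (simp add: case_prod_beta)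
  qed
  also have "\<dots> = (\<integral>\<^sup>+v. \<integral>\<^sup>+z0. ennreal ((real N)\<^sup>2 * pullback_average d a n \<phi> (z0, v)) * fs_density (z0, v) \<partial>lborel \<partial>lborel)"
  proof (rule nn_integral_cong)
    fix v :: complex
    have m2[measurable]: "(\<lambda>z. fs_density (z, v)) \<in> borel_measurable borel"
      by (rule measurable_compose[OF _ measurable_fs_density]) (auto intro!: borel_measurable_continuous_onI continuous_intros)
    have m4[measurable]: "(\<lambda>z. H z v) \<in> borel_measurable borel"
    proof (rule borel_measurable_continuous_onI)
      have "continuous_on UNIV (\<lambda>z::complex. (z, v))"
        by (intro continuous_on_Pair continuous_on_const continuous_on_id)
      from continuous_on_compose2[OF continuous_on_fibre_average[OF d \<phi>(1), of a n] this]
      show "continuous_on UNIV (\<lambda>z. H z v)" unfolding H_def by simp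
    qed
    have "(\<integral>\<^sup>+z. J1 z * (fs_density (z ^ N, v) * ennreal (real N * H z v)) \<partial>lborel) =
        (\<integral>\<^sup>+z. (fs_density (poly p1 z, v) * ennreal (real N * H z v)) * ennreal ((cmod (poly (pderiv p1) z))\<^sup>2) \<partial>lborel)"
      by (intro nn_integral_cong) (simp add: pd J1_def mult_ac)
    also have "\<dots> = (\<integral>\<^sup>+z0. (\<Sum>z\<in>#proots (p1 - [:z0:]). fs_density (poly p1 z, v) * ennreal (real N * H z v)) \<partial>lborel)"
      by (rule nn_integral_poly_area) (use N in \<open>auto simp: p1_def degree_monom_eq\<close>)
    also have "\<dots> = (\<integral>\<^sup>+z0. ennreal ((real N)\<^sup>2 * pullback_average d a n \<phi> (z0, v)) * fs_density (z0, v) \<partial>lborel)"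
    proof (rule nn_integral_cong)
      fix z0
      have nz: "p1 - [:z0:] \<noteq> 0"
        using N unfolding p1_def by (metis degree_diff_const degree_0 degree_monom_eq less_irrefl one_neq_zero)
      have "(\<Sum>z\<in>#proots (p1 - [:z0:]). fs_density (poly p1 z, v) * ennreal (real N * H z v)) =
          (\<Sum>z\<in>#proots (p1 - [:z0:]). fs_density (z0, v) * ennreal (real N * H z v))"
        using set_count_proots[OF nz] by (intro arg_cong[of _ _ sum_mset] image_mset_cong) auto
      also have "\<dots> = fs_density (z0, v) * (\<Sum>z\<in>#proots (p1 - [:z0:]). ennreal (real N * H z v))"
        by (simp add: sum_mset_distrib_left)
      also have "(\<Sum>z\<in>#proots (p1 - [:z0:]). ennreal (real N * H z v)) = ennreal ((real N)\<^sup>2 * pullback_average d a n \<phi> (z0, v))"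
        using N H0 by (subst sum_mset_ennreal)
          (auto simp: pullback_average_def H_def N_def p1_def power2_eq_square sum_mset_distrib_left[symmetric])
      finally show "(\<Sum>z\<in>#proots (p1 - [:z0:]). fs_density (poly p1 z, v) * ennreal (real N * H z v)) =
        ennreal ((real N)\<^sup>2 * pullback_average d a n \<phi> (z0, v)) * fs_density (z0, v)" by (simp add: mult.commute)
    qed
    finally show "(\<integral>\<^sup>+z. J1 z * (fs_density (z ^ N, v) * ennreal (real N * H z v)) \<partial>lborel) =
      (\<integral>\<^sup>+z0. ennreal ((real N)\<^sup>2 * pullback_average d a n \<phi> (z0, v)) * fs_density (z0, v) \<partial>lborel)" .
  qed
  also have "\<dots> = (\<integral>\<^sup>+y. ennreal ((real N)\<^sup>2 * pullback_average d a n \<phi> y) * fs_density y \<partial>(lborel \<Otimes>\<^sub>M lborel))"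
  proof (rule lborel_pair.nn_integral_snd)
    have [measurable]: "pullback_average d a n \<phi> \<in> borel_measurable borel"
      by (rule borel_measurable_continuous_onI[OF continuous_on_pullback_average[OF d \<phi>(1)]])
    have "(\<lambda>y. ennreal ((real N)\<^sup>2 * pullback_average d a n \<phi> y) * fs_density y) \<in> borel_measurable borel"
      by measurable
    then show "(\<lambda>y. ennreal ((real N)\<^sup>2 * pullback_average d a n \<phi> y) * fs_density y) \<in> borel_measurable (lborel \<Otimes>\<^sub>M lborel)"
      unfolding lborel_prod by simp
  qed
  finally show ?thesis by (simp only: lborel_prod N_def)
qed

section \<open>Weak convergence of the Fubini-Study pullbacks\<close>

lemma pullback_average_const:
  assumes "d \<ge> 2" shows "pullback_average d a n (\<lambda>_. c) y = c"
proof -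
  have D: "d ^ n > 0" using assms by simp
  have "fibre_average d a n (\<lambda>_. c) z v = c" for z v
    using assms by (simp add: fibre_average_def size_fibre_preimages)
  then show ?thesis
    using D assms by (cases y) (simp add: pullback_average_def size_proots_complex degree_monom_eq)
qed

lemma pullback_average_add:
  "pullback_average d a n (\<lambda>x. f x + g x) y = pullback_average d a n f y + pullback_average d a n g y"
  by (cases y) (simp add: pullback_average_def fibre_average_def sum_mset.distrib add_divide_distrib)

lemma pullback_average_mono:
  assumes "\<And>x. f x \<le> g x"
  shows "pullback_average d a n f y \<le> pullback_average d a n g y"
proof -
  have mono: "(\<Sum>x\<in>#A. f' x) \<le> (\<Sum>x\<in>#A. g' x)" if "\<And>x. f' x \<le> g' x" for f' g' :: "complex \<Rightarrow> real" and A
    using that by (induction A) (auto intro: add_mono)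
  show ?thesis
    by (cases y) (auto simp: pullback_average_def fibre_average_def intro!: divide_right_mono mono assms)
qed

lemma pullback_average_bounded:
  assumes "d \<ge> 2" "\<And>x. \<bar>\<phi> x\<bar> \<le> C"
  shows "\<bar>pullback_average d a n \<phi> y\<bar> \<le> C"
proof -
  have b: "\<phi> x \<le> C" "- C \<le> \<phi> x" for x using assms(2)[of x] by auto
  have "pullback_average d a n \<phi> y \<le> C"
    using pullback_average_mono[of \<phi> "\<lambda>_. C", OF b(1)] pullback_average_const[OF assms(1), of a n C y] by metis
  moreover have "- C \<le> pullback_average d a n \<phi> y"
    using pullback_average_mono[of "\<lambda>_. - C" \<phi>, OF b(2)] pullback_average_const[OF assms(1), of a n "- C" y] by metis
  ultimately show ?thesis by linarith
qed

abbreviation fs_measure :: "(complex \<times> complex) measure" where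
  "fs_measure \<equiv> density lborel fs_density"

lemma prob_space_fs_measure: "prob_space fs_measure"
  by (rule prob_spaceI) (simp add: emeasure_density nn_integral_fs_density)

text \<open>The identity for nonnegative functions passes to bounded \<phi> by adding a constant
  \<open>C\<close>, whose own integral is known because averaging preserves constants.\<close>

lemma fubini_study_integral:
  assumes d: "d \<ge> 2" and \<phi>: "continuous_on UNIV \<phi>" "bounded (range \<phi>)"
  shows "integral\<^sup>L (fubini_study_pullback (skew_product d a ^^ n)) \<phi> / real d ^ (2 * n) =
    integral\<^sup>L fs_measure (pullback_average d a n \<phi>)"
proof -
  interpret fs: prob_space fs_measure by (rule prob_space_fs_measure)
  let ?F = "fubini_study_pullback (skew_product d a ^^ n)"
  define K where "K = real (d ^ n) ^ 2"
  have K: "K > 0" "real d ^ (2 * n) = K" using d by (simp_all add: K_def power_mult mult.commute)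
  have sets: "sets ?F = sets borel" "sets fs_measure = sets borel" by (simp_all add: fubini_study_pullback_def)
  have meas: "f \<in> borel_measurable ?F" "f \<in> borel_measurable fs_measure" if "continuous_on UNIV f" for f :: "complex \<times> complex \<Rightarrow> real"
    using borel_measurable_continuous_onI[OF that] by (simp_all cong: measurable_cong_sets add: sets)
  have pos: "integral\<^sup>L ?F \<psi> = K * integral\<^sup>L fs_measure (pullback_average d a n \<psi>)"
    and fin: "(\<integral>\<^sup>+x. ennreal (\<psi> x) \<partial>?F) < \<infinity>"
    if \<psi>: "continuous_on UNIV \<psi>" "\<And>x. 0 \<le> \<psi> x" "\<And>x. \<psi> x \<le> C" for \<psi> C
  proof -
    have A0: "0 \<le> pullback_average d a n \<psi> y" for y
      using pullback_average_mono[of "\<lambda>_. 0" \<psi> d a n y] pullback_average_const[OF d, of a n 0 y] \<psi>(2) by simp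
    have C: "\<bar>\<psi> x\<bar> \<le> C" for x using \<psi>(2)[of x] \<psi>(3)[of x] by simp
    note Ac = continuous_on_pullback_average[OF d \<psi>(1), of a n]
    have eq: "(\<integral>\<^sup>+x. ennreal (\<psi> x) \<partial>?F) = (\<integral>\<^sup>+y. ennreal (K * pullback_average d a n \<psi> y) \<partial>fs_measure)"
      unfolding fubini_study_nn_integral[OF d \<psi>(1,2)] K_def
      using borel_measurable_continuous_onI[OF Ac]
      by (subst nn_integral_density) (use measurable_fs_density in \<open>auto simp: mult.commute intro!: measurable_compose[OF _ measurable_ennreal]\<close>)
    have "(\<integral>\<^sup>+y. ennreal (K * pullback_average d a n \<psi> y) \<partial>fs_measure) \<le> (\<integral>\<^sup>+y. ennreal (K * C) \<partial>fs_measure)"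
      using pullback_average_bounded[OF d C, of a n] K by (intro nn_integral_mono ennreal_leI mult_left_mono) (auto simp: abs_le_iff)
    also have "\<dots> < \<infinity>" using fs.emeasure_space_1 by (simp add: ennreal_mult_less_top)
    finally show "(\<integral>\<^sup>+x. ennreal (\<psi> x) \<partial>?F) < \<infinity>" unfolding eq .
    have "integral\<^sup>L ?F \<psi> = enn2real (\<integral>\<^sup>+x. ennreal (\<psi> x) \<partial>?F)"
      using \<psi>(2) by (intro integral_eq_nn_integral meas \<psi>(1)) auto
    also have "\<dots> = integral\<^sup>L fs_measure (\<lambda>y. K * pullback_average d a n \<psi> y)"
      unfolding eq using K A0 by (intro integral_eq_nn_integral[symmetric] meas continuous_intros Ac) auto
    finally show "integral\<^sup>L ?F \<psi> = K * integral\<^sup>L fs_measure (pullback_average d a n \<psi>)" by simp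
  qed
  obtain C where C: "\<And>x. \<bar>\<phi> x\<bar> \<le> C" using \<phi>(2) by (auto simp: bounded_iff)
  have C': "0 \<le> C" using C[of "(0, 0)"] abs_ge_zero[of "\<phi> (0, 0)"] by linarith
  have "emeasure ?F (space ?F) < \<infinity>"
    using fin[of "\<lambda>_. 1" 1] by (simp add: continuous_on_const)
  then interpret F: finite_measure ?F by (intro finite_measureI) simp
  have int: "integrable ?F f" if "continuous_on UNIV f" "\<And>x. \<bar>f x\<bar> \<le> B" for f :: "complex \<times> complex \<Rightarrow> real" and B :: real
    using that by (intro F.integrable_const_bound[of _ B] meas) auto
  have intA: "integrable fs_measure (pullback_average d a n \<phi>)"
    using pullback_average_bounded[OF d C, of a n]
    by (intro fs.integrable_const_bound[of _ C] meas continuous_on_pullback_average[OF d \<phi>(1)]) auto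
  have pC: "integral\<^sup>L ?F (\<lambda>x. C) = K * C"
  proof -
    have "pullback_average d a n (\<lambda>_. C) = (\<lambda>_. C)" by (rule ext) (rule pullback_average_const[OF d])
    moreover have "integral\<^sup>L ?F (\<lambda>x. C) = K * integral\<^sup>L fs_measure (pullback_average d a n (\<lambda>_. C))"
      using C' by (intro pos[of _ C]) auto
    moreover have "integral\<^sup>L fs_measure (\<lambda>_. C) = C" using fs.prob_space by simp
    ultimately show ?thesis by (simp only:)
  qed
  have "integral\<^sup>L ?F \<phi> + integral\<^sup>L ?F (\<lambda>x. C) = integral\<^sup>L ?F (\<lambda>x. \<phi> x + C)"
    using int[OF \<phi>(1) C] by (subst Bochner_Integration.integral_add) auto
  also have "\<dots> = K * integral\<^sup>L fs_measure (pullback_average d a n (\<lambda>x. \<phi> x + C))"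
  proof (rule pos[of _ "2 * C"])
    fix x show "0 \<le> \<phi> x + C" "\<phi> x + C \<le> 2 * C" using C[of x] by linarith+
  qed (intro continuous_intros \<phi>(1))
  also have "integral\<^sup>L fs_measure (pullback_average d a n (\<lambda>x. \<phi> x + C)) = integral\<^sup>L fs_measure (pullback_average d a n \<phi>) + C"
  proof -
    have "pullback_average d a n (\<lambda>x. \<phi> x + C) = (\<lambda>y. pullback_average d a n \<phi> y + C)"
      by (auto simp: pullback_average_add pullback_average_const[OF d])
    then show ?thesis using intA fs.prob_space by simp
  qed
  finally have "integral\<^sup>L ?F \<phi> = K * integral\<^sup>L fs_measure (pullback_average d a n \<phi>)"
    unfolding pC by (simp add: algebra_simps)
  then show ?thesis using K by simp
qed

text \<open>Dominated convergence: the averages inherit the bound of \<phi>, and the exceptional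
  fibre z0 = 0 is a null set of the Fubini-Study measure.\<close>

lemma fubini_study_integral_tendsto:
  assumes d: "d \<ge> 2" and \<phi>: "continuous_on UNIV \<phi>" "bounded (range \<phi>)"
    and L: "\<And>z0 v. z0 \<noteq> 0 \<Longrightarrow> (\<lambda>n. pullback_average d a n \<phi> (z0, v)) \<longlonglongrightarrow> L"
  shows "(\<lambda>n. integral\<^sup>L (fubini_study_pullback (skew_product d a ^^ n)) \<phi> / real d ^ (2 * n)) \<longlonglongrightarrow> L"
proof -
  interpret fs: prob_space fs_measure by (rule prob_space_fs_measure)
  obtain C where C: "\<And>x. \<bar>\<phi> x\<bar> \<le> C" using \<phi>(2) by (auto simp: bounded_iff)
  have "(\<lambda>n. integral\<^sup>L fs_measure (pullback_average d a n \<phi>)) \<longlonglongrightarrow> integral\<^sup>L fs_measure (\<lambda>_. L)"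
  proof (rule integral_dominated_convergence[where w = "\<lambda>_. C"])
    show "pullback_average d a n \<phi> \<in> borel_measurable fs_measure" for n
      using borel_measurable_continuous_onI[OF continuous_on_pullback_average[OF d \<phi>(1)]]
      by (simp cong: measurable_cong_sets)
    show "AE x in fs_measure. norm (pullback_average d a n \<phi> x) \<le> C" for n
      using pullback_average_bounded[OF d C] by auto
    have "AE x in (lborel :: (complex \<times> complex) measure). fst x \<noteq> 0"
    proof -
      have "AE z in lborel. AE w in lborel. fst (z :: complex, w :: complex) \<noteq> 0"
        using AE_lborel_singleton[of "0::complex"] by eventually_elim simp
      moreover have "{x \<in> space (lborel \<Otimes>\<^sub>M lborel). fst x \<noteq> (0::complex)} \<in> sets (lborel \<Otimes>\<^sub>M (lborel :: complex measure))"
        unfolding lborel_prod by (simp, intro borel_open open_Collect_neq continuous_intros)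
      ultimately have "AE x in (lborel \<Otimes>\<^sub>M (lborel :: complex measure)). fst x \<noteq> (0::complex)"
        by (intro lborel_pair.AE_pair_measure) simp_all
      then show ?thesis by (simp only: lborel_prod)
    qed
    then have "AE x in lborel. 0 < fs_density x \<longrightarrow> (\<lambda>n. pullback_average d a n \<phi> x) \<longlonglongrightarrow> L"
    proof eventually_elim
      case (elim x)
      then show ?case using L[of "fst x" "snd x"] by simp
    qed
    then show "AE x in fs_measure. (\<lambda>n. pullback_average d a n \<phi> x) \<longlonglongrightarrow> L"
      by (subst AE_density) (use measurable_fs_density in simp_all)
  qed auto
  then show ?thesis
    unfolding fubini_study_integral[OF d \<phi>] using fs.prob_space by simp
qed

section \<open>Existence, uniqueness and support of the equilibrium measure\<close>

lemma prob_measure_eqI_continuous: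
  fixes \<mu> \<nu> :: "'a::metric_space measure"
  assumes "prob_space \<mu>" "prob_space \<nu>" and sets: "sets \<mu> = sets borel" "sets \<nu> = sets borel"
    and eq: "\<And>\<phi> :: 'a \<Rightarrow> real. continuous_on UNIV \<phi> \<Longrightarrow> bounded (range \<phi>) \<Longrightarrow> integral\<^sup>L \<mu> \<phi> = integral\<^sup>L \<nu> \<phi>"
  shows "\<mu> = \<nu>"
proof -
  interpret \<mu>: prob_space \<mu> by fact
  interpret \<nu>: prob_space \<nu> by fact
  have "measure \<mu> U = measure \<nu> U" if U: "open U" for U
  \<comment> \<open>\<open>infdist\<close> to the empty set is 0 by convention, so the functions
    approximating the indicator of \<open>U\<close> would vanish for the whole space.\<close>
  proof (cases "U = UNIV")
    case True
    then show ?thesis using \<mu>.prob_space \<nu>.prob_space sets_eq_imp_space_eq[OF sets(1)] sets_eq_imp_space_eq[OF sets(2)] by simp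
  next
    case False
    define \<phi> where "\<phi> n x = min 1 (real n * infdist x (- U))" for n :: nat and x
    have \<phi>c: "continuous_on UNIV (\<phi> n)" for n unfolding \<phi>_def by (intro continuous_intros)
    have \<phi>b: "0 \<le> \<phi> n x" "\<phi> n x \<le> 1" for n x by (auto simp: \<phi>_def infdist_nonneg)
    have bd: "bounded (range (\<phi> n))" for n using \<phi>b by (intro boundedI[of _ 1]) auto
    have lim: "(\<lambda>n. \<phi> n x) \<longlonglongrightarrow> indicator U x" for x
    proof (cases "x \<in> U")
      case True
      then have "infdist x (- U) > 0" using U False
        by (intro infdist_pos_not_in_closed) auto
      then obtain m :: nat where m: "1 < real m * infdist x (- U)" using reals_Archimedean3 by blast
      have "\<forall>\<^sub>F n in sequentially. \<phi> n x = indicator U x"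
        using eventually_ge_at_top[of m]
      proof eventually_elim
        case (elim n)
        have "real m * infdist x (- U) \<le> real n * infdist x (- U)"
          using elim infdist_nonneg by (intro mult_right_mono) auto
        then show ?case using m True by (simp add: \<phi>_def)
      qed
      then show ?thesis by (rule tendsto_eventually)
    next
      case False
      then show ?thesis by (simp add: \<phi>_def)
    qed
    have conv: "(\<lambda>n. integral\<^sup>L M (\<phi> n)) \<longlonglongrightarrow> measure M U" if "prob_space M" "sets M = sets borel" for M
    proof -
      interpret M: prob_space M by fact
      have "(\<lambda>n. integral\<^sup>L M (\<phi> n)) \<longlonglongrightarrow> integral\<^sup>L M (indicator U)"
      proof (rule integral_dominated_convergence[where w = "\<lambda>_. 1"])
        show "indicator U \<in> borel_measurable M"
          by (intro borel_measurable_indicator) (use U that(2) in simp)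
        show "\<phi> n \<in> borel_measurable M" for n
          using borel_measurable_continuous_onI[OF \<phi>c[of n]] that(2) by (simp cong: measurable_cong_sets)
      qed (use lim \<phi>b in auto)
      then show ?thesis using U that(2) by simp
    qed
    show ?thesis
      using LIMSEQ_unique[OF conv[OF assms(1) sets(1)]] conv[OF assms(2) sets(2)] eq[OF \<phi>c bd] by simp
  qed
  then have em: "emeasure \<mu> U = emeasure \<nu> U" if "open U" for U
    using that by (simp add: \<mu>.emeasure_eq_measure \<nu>.emeasure_eq_measure)
  show ?thesis
  proof (rule measure_eqI_generator_eq[where E = "Collect open" and A = "\<lambda>_. UNIV" and \<Omega> = UNIV])
    show "sets \<mu> = sigma_sets UNIV (Collect open)" "sets \<nu> = sigma_sets UNIV (Collect open)"
      by (simp_all add: sets borel_def)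
  qed (use em in \<open>auto simp: Int_stable_def\<close>)
qed

text \<open>The counting measures on f^(-n)(1, 0) live in a fixed bounded set, so a subsequence
  converges weakly to some \<mu>. As the averages converge along the whole sequence, to a limit
  common to all base points with z0 \<noteq> 0, that limit is the integral against \<mu>.\<close>

lemma ex_equilibrium_measure:
  assumes d: "d \<ge> 2" and a: "a \<in> escape_locus d"
  obtains \<mu> where "is_equilibrium_measure d (skew_product d a) \<mu>"
    "\<And>\<phi> z0 v. continuous_on UNIV \<phi> \<Longrightarrow> bounded (range \<phi>) \<Longrightarrow> z0 \<noteq> 0 \<Longrightarrow>
      (\<lambda>n. pullback_average d a n \<phi> (z0, v)) \<longlonglongrightarrow> integral\<^sup>L \<mu> \<phi>"
proof -
  obtain U R0 where UR0: "open U" "a \<in> U" "\<And>b. b \<in> U \<Longrightarrow> escape_radius d b 1 R0"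
    by (rule ex_escape_radius[OF d order_refl]) (rule that)
  have esc: "escape_radius d a 1 R0" by (rule UR0(3)[OF UR0(2)])
  have R0: "R0 > 0" using esc by (simp add: escape_radius_def)
  define A where "A n = (\<Sum>z\<in>#proots (monom 1 (d ^ n) - [:1:]). image_mset (Pair z) (fibre_preimages d a z n 0))" for n
  have D: "d ^ n > 0" for n using d by simp
  have nz: "monom 1 (d ^ n) - [:1:] \<noteq> (0 :: complex poly)" for n
    using D[of n] by (metis degree_diff_const degree_0 degree_monom_eq less_irrefl one_neq_zero)
  have sz: "size (\<Sum>z\<in>#B. image_mset (Pair z) (fibre_preimages d a z n 0)) = size B * d ^ n" for B n
    by (induction B) (simp_all add: size_fibre_preimages[OF d])
  have sm: "(\<Sum>x\<in>#(\<Sum>z\<in>#B. image_mset (Pair z) (fibre_preimages d a z n 0)). \<phi> x) =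
      (\<Sum>z\<in>#B. \<Sum>u\<in>#fibre_preimages d a z n 0. \<phi> (z, u))" for B n and \<phi> :: "complex \<times> complex \<Rightarrow> real"
    by (induction B) (simp_all add: image_mset.compositionality o_def)
  have dv: "(\<Sum>z\<in>#B. f z / c) = (\<Sum>z\<in>#B. f z) / c" for B and f :: "complex \<Rightarrow> real" and c
    by (induction B) (simp_all add: add_divide_distrib)
  have size: "size (A n) = d ^ n * d ^ n" for n
    unfolding A_def sz size_proots_complex by (simp add: degree_monom_eq)
  have avg: "(\<Sum>x\<in>#A n. \<phi> x) / real (size (A n)) = pullback_average d a n \<phi> (1, 0)" for n \<phi>
    unfolding size by (simp add: A_def sm pullback_average_def fibre_average_def dv)
  have ne: "A n \<noteq> {#}" for n
  proof
    assume "A n = {#}"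
    then have "d ^ n * d ^ n = 0" using size[of n] by simp
    then show False using D[of n] by simp
  qed
  have memB: "\<exists>z\<in>#B. fst x = z \<and> snd x \<in># fibre_preimages d a z n 0"
    if "x \<in># (\<Sum>z\<in>#B. image_mset (Pair z) (fibre_preimages d a z n 0))" for B n x
    using that by (induction B) auto
  have mem: "cmod (fst x) = 1 \<and> cmod (snd x) < R0" if xA: "x \<in># A n" for n x
  proof -
    obtain z where z: "z \<in># proots (monom 1 (d ^ n) - [:1:])" "fst x = z" "snd x \<in># fibre_preimages d a z n 0"
      using memB[OF xA[unfolded A_def]] by blast
    have "z ^ (d ^ n) = 1" using z(1) set_count_proots[OF nz[of n]] by (auto simp: poly_monom)
    from power_eq_1_iff[OF this] have zc: "cmod z = 1" using d by simp
    then show ?thesis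
      using z escape_backward_circle[OF esc zc, of 0 n "snd x"] R0 by (simp add: set_fibre_preimages[OF d])
  qed
  have m1: "cmod (fst x) < max 2 R0" "cmod (snd x) < max 2 R0" if "x \<in># A n" for n x
    using mem[OF that] by auto
  obtain \<mu> s where \<mu>: "prob_space \<mu>" "sets \<mu> = sets borel" and s: "strict_mono (s :: nat \<Rightarrow> nat)"
    and lim: "\<And>\<phi> :: complex \<times> complex \<Rightarrow> real. continuous_on UNIV \<phi> \<Longrightarrow> bounded (range \<phi>) \<Longrightarrow>
       (\<lambda>i. (\<Sum>x\<in>#A (s i). \<phi> x) / real (size (A (s i)))) \<longlonglongrightarrow> integral\<^sup>L \<mu> \<phi>"
    by (rule weak_limit_of_multisets[OF ne m1]) (assumption+, rule that)
  have conv: "(\<lambda>n. pullback_average d a n \<phi> (z0, v)) \<longlonglongrightarrow> integral\<^sup>L \<mu> \<phi>"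
    if \<phi>: "continuous_on UNIV \<phi>" "bounded (range \<phi>)" and z0: "z0 \<noteq> 0" for \<phi> z0 v
  proof -
    obtain L where L: "\<And>z0 v. z0 \<noteq> 0 \<Longrightarrow> (\<lambda>n. pullback_average d a n \<phi> (z0, v)) \<longlonglongrightarrow> L"
      by (rule pullback_average_convergent[OF d a \<phi>(1)]) (rule that)
    have "(\<lambda>i. pullback_average d a (s i) \<phi> (1, 0)) \<longlonglongrightarrow> L"
      using LIMSEQ_subseq_LIMSEQ[OF L[of 1 0] s] by (simp add: o_def)
    then have "L = integral\<^sup>L \<mu> \<phi>" using LIMSEQ_unique lim[OF \<phi>] unfolding avg by blast
    then show ?thesis using L[OF z0] by simp
  qed
  have "is_equilibrium_measure d (skew_product d a) \<mu>"
    unfolding is_equilibrium_measure_def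
    using \<mu> fubini_study_integral_tendsto[OF d] conv by blast
  then show ?thesis using that conv by blast
qed

lemma compact_filled_set: "d \<ge> 2 \<Longrightarrow> compact (filled_set d a)"
proof -
  assume d: "d \<ge> 2"
  obtain U R where UR: "open U" "a \<in> U" "\<And>b. b \<in> U \<Longrightarrow> escape_radius d b 1 R"
    by (rule ex_escape_radius[OF d order_refl]) (rule that)
  have esc: "escape_radius d a 1 R" by (rule UR(3)[OF UR(2)])
  have R: "R > 0" using esc by (simp add: escape_radius_def)
  \<comment> \<open>Strict bounds may be relaxed to closed ones: |Q^n| \<ge> R would give |Q^(n+1)|
    \<ge> 2R > R. This exhibits the set as an intersection of closed sets.\<close>
  have "filled_set d a = (sphere 0 1 \<times> cball 0 R) \<inter> (\<Inter>n. {x. cmod (fibre_iterate d a (fst x) n (snd x)) \<le> R})"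
  proof safe
    fix z w assume "(z, w) \<in> filled_set d a"
    then have *: "cmod z = 1" "\<forall>n. cmod (fibre_iterate d a z n w) < R" by (auto simp: filled_set_eq[OF esc])
    then show "z \<in> sphere 0 1" "w \<in> cball 0 R" using *(2)[rule_format, of 0] by auto
    show "cmod (fibre_iterate d a (fst (z, w)) n (snd (z, w))) \<le> R" for n using *(2)[rule_format, of n] by simp
  next
    fix z w assume z: "z \<in> sphere 0 1" and w: "(z, w) \<in> (\<Inter>n. {x. cmod (fibre_iterate d a (fst x) n (snd x)) \<le> R})"
    have "cmod (fibre_iterate d a z n w) < R" for n
    proof (rule ccontr)
      assume "\<not> ?thesis"
      then have "2 * R \<le> cmod (fibre_iterate d a z (Suc n) w)" using z by (intro escape_step[OF esc]) auto
      moreover have "cmod (fibre_iterate d a z m w) \<le> R" for m using w by auto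
      note this[of "Suc n"]
      ultimately show False using R by linarith
    qed
    then show "(z, w) \<in> filled_set d a" using z by (auto simp: filled_set_eq[OF esc])
  qed
  moreover have "closed (\<Inter>n. {x. cmod (fibre_iterate d a (fst x) n (snd x)) \<le> R})"
    by (intro closed_INT ballI closed_Collect_le continuous_intros)
  ultimately show "compact (filled_set d a)" by (auto intro!: compact_Int_closed compact_Times)
qed

text \<open>The base point 1 is fixed by z^d, and a fixed point of the fibre polynomial over it has
  a constant orbit.\<close>

lemma filled_set_fibre_nonempty:
  assumes d: "d \<ge> 2" obtains v where "(1, v) \<in> filled_set d a"
proof -
  have "degree (fibre_poly d a 1 + (- [:0, 1:])) = degree (fibre_poly d a 1)"
    by (rule degree_add_eq_left) (use d in \<open>simp add: degree_fibre_poly\<close>)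
  then have "degree (fibre_poly d a 1 - [:0, 1:]) = d"
    by (simp only: diff_conv_add_uminus degree_fibre_poly[OF d])
  then obtain v where "poly (fibre_poly d a 1 - [:0, 1:]) v = 0"
    using fundamental_theorem_of_algebra[of "fibre_poly d a 1 - [:0, 1:]"] constant_degree[of "fibre_poly d a 1 - [:0, 1:]"] d by auto
  then have "poly (fibre_poly d a 1) v = v" by simp
  then have "fibre_iterate d a 1 n v = v" for n by (induction n) (auto simp: iterate_power)
  then have "(1, v) \<in> filled_set d a" by (simp add: filled_set_def)
  then show ?thesis by (rule that)
qed

text \<open>The limit of the averages does not depend on the base point, so each inclusion may
  choose its own. From (1, v) in the filled set all preimages stay in that set, and a test function
  vanishing on it has integral 0. From (1, 0), \<open>pullback_average_bump_positive\<close> gives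
  every neighbourhood of a filled point positive mass.\<close>

theorem julia_set_eq_filled_set:
  assumes d: "d \<ge> 2" and a: "a \<in> escape_locus d"
  shows "julia_set d (skew_product d a) = filled_set d a"
proof -
  obtain \<mu> where \<mu>: "is_equilibrium_measure d (skew_product d a) \<mu>"
    and conv: "\<And>\<phi> z0 v. continuous_on UNIV \<phi> \<Longrightarrow> bounded (range \<phi>) \<Longrightarrow> z0 \<noteq> 0 \<Longrightarrow>
      (\<lambda>n. pullback_average d a n \<phi> (z0, v)) \<longlonglongrightarrow> integral\<^sup>L \<mu> \<phi>"
    by (rule ex_equilibrium_measure[OF d a]) (rule that)
  interpret prob_space \<mu> using \<mu> by (simp add: is_equilibrium_measure_def)
  have sets[measurable_cong]: "sets \<mu> = sets borel" using \<mu> by (simp add: is_equilibrium_measure_def)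
  have "equilibrium_measure d (skew_product d a) = \<mu>"
    unfolding equilibrium_measure_def
  proof (rule the_equality[where P = "is_equilibrium_measure d (skew_product d a)", OF \<mu>])
    fix \<nu> assume \<nu>: "is_equilibrium_measure d (skew_product d a) \<nu>"
    show "\<nu> = \<mu>"
    proof (rule prob_measure_eqI_continuous)
      fix \<phi> :: "complex \<times> complex \<Rightarrow> real" assume "continuous_on UNIV \<phi>" "bounded (range \<phi>)"
      then show "integral\<^sup>L \<nu> \<phi> = integral\<^sup>L \<mu> \<phi>"
        using \<mu> \<nu> unfolding is_equilibrium_measure_def by (blast intro: LIMSEQ_unique)
    qed (use \<mu> \<nu> in \<open>auto simp: is_equilibrium_measure_def\<close>)
  qed
  then have "julia_set d (skew_product d a) = measure_support \<mu>" by (simp add: julia_set_def)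
  also have "\<dots> = filled_set d a"
  proof
    define X where "X = filled_set d a"
    have X: "closed X" "X \<noteq> {}"
      using compact_filled_set[OF d] compact_imp_closed filled_set_fibre_nonempty[OF d, of a] by (auto simp: X_def)
    define \<phi> where "\<phi> x = min 1 (infdist x X)" for x
    have \<phi>c: "continuous_on UNIV \<phi>" unfolding \<phi>_def by (intro continuous_intros)
    have \<phi>01: "0 \<le> \<phi> x" "\<phi> x \<le> 1" for x by (auto simp: \<phi>_def infdist_nonneg)
    have bd: "bounded (range \<phi>)" using \<phi>01 by (intro boundedI[of _ 1]) auto
    obtain v where v: "(1, v) \<in> filled_set d a" by (rule filled_set_fibre_nonempty[OF d])
    have zero: "pullback_average d a n \<phi> (1, v) = 0" for n
    proof -
      have "fibre_average d a n \<phi> z v = 0" if z: "z ^ (d ^ n) = 1" for z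
      proof -
        from power_eq_1_iff[OF z] have zc: "cmod z = 1" using d by simp
        have "\<phi> (z, u) = 0" if u: "u \<in># fibre_preimages d a z n v" for u
        proof -
          have uv: "fibre_iterate d a z n u = v" using u by (simp add: set_fibre_preimages[OF d])
          have "range (\<lambda>m. fibre_iterate d a z m u) \<subseteq>
              (\<lambda>m. fibre_iterate d a z m u) ` {..n} \<union> range (\<lambda>m. fibre_iterate d a 1 m v)"
          proof safe
            fix m assume *: "fibre_iterate d a z m u \<notin> range (\<lambda>m. fibre_iterate d a 1 m v)"
            have "m \<le> n"
            proof (rule ccontr)
              assume "\<not> m \<le> n"
              then have "fibre_iterate d a z m u = fibre_iterate d a 1 (m - n) v"
                using fibre_iterate_add[of d a z n "m - n" u] z uv by simp
              then show False using * by blast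
            qed
            then show "fibre_iterate d a z m u \<in> (\<lambda>m. fibre_iterate d a z m u) ` {..n}" by blast
          qed
          moreover have "bounded ((\<lambda>m. fibre_iterate d a z m u) ` {..n} \<union> range (\<lambda>m. fibre_iterate d a 1 m v))"
            using v by (simp add: filled_set_def finite_imp_bounded)
          ultimately have "bounded (range (\<lambda>m. fibre_iterate d a z m u))" by (metis bounded_subset)
          then have "(z, u) \<in> X" using zc by (simp add: X_def filled_set_def)
          then show ?thesis by (simp add: \<phi>_def)
        qed
        then have "(\<Sum>u\<in>#fibre_preimages d a z n v. \<phi> (z, u)) = (\<Sum>u\<in>#fibre_preimages d a z n v. 0)"
          by (intro arg_cong[of _ _ sum_mset] image_mset_cong) auto
        then show ?thesis by (simp add: fibre_average_def)
      qed
      then show ?thesis by (simp add: pullback_average_eq[OF d])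
    qed
    have int0: "integral\<^sup>L \<mu> \<phi> = 0"
      using conv[OF \<phi>c bd, of 1 v] unfolding zero by (simp add: LIMSEQ_const_iff)
    have \<phi>m: "\<phi> \<in> borel_measurable \<mu>"
      using borel_measurable_continuous_onI[OF \<phi>c] by (simp cong: measurable_cong_sets add: sets)
    have "integrable \<mu> \<phi>" using \<phi>01 by (intro integrable_const_bound[of _ 1] \<phi>m) auto
    then have "AE x in \<mu>. \<phi> x = 0"
      using integral_nonneg_eq_0_iff_AE[of \<mu> \<phi>] int0 \<phi>01 by auto
    then have "AE x in \<mu>. x \<notin> - X"
    proof eventually_elim
      case (elim x)
      then have "infdist x X = 0" by (auto simp: \<phi>_def min_def split: if_splits)
      then show ?case using X by (simp add: in_closed_iff_infdist_zero)
    qed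
    moreover have "- X \<in> sets \<mu>" using X(1) by (simp add: sets)
    ultimately have "- X \<in> null_sets \<mu>" using AE_iff_null_sets[of "- X" \<mu>] by blast
    then have "emeasure \<mu> (- X) = 0" by (rule null_setsD1)
    then show "measure_support \<mu> \<subseteq> filled_set d a"
      using X(1) unfolding measure_support_def X_def by (auto dest!: spec[of _ "- filled_set d a"])
    show "filled_set d a \<subseteq> measure_support \<mu>"
    proof
      fix x assume x: "x \<in> filled_set d a"
      show "x \<in> measure_support \<mu>" unfolding measure_support_def
      proof (intro CollectI allI impI, elim conjE)
        fix U assume U: "open U" "x \<in> U"
        then obtain \<epsilon> where \<epsilon>: "\<epsilon> > 0" "ball x \<epsilon> \<subseteq> U" by (meson open_contains_ball)
        define \<psi> where "\<psi> y = max 0 (1 - dist y x / \<epsilon>)" for y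
        have "\<psi> = (\<lambda>y. max 0 (1 - dist y x * (1 / \<epsilon>)))" by (auto simp: \<psi>_def)
        then have \<psi>c: "continuous_on UNIV \<psi>" by (simp only:) (intro continuous_intros)
        have \<psi>01: "0 \<le> \<psi> y" "\<psi> y \<le> indicator U y" for y
        proof -
          have "\<epsilon> \<le> dist y x" if "y \<notin> U"
          proof -
            have "y \<notin> ball x \<epsilon>" using \<epsilon>(2) that by blast
            then show ?thesis by (simp add: dist_commute)
          qed
          then show "0 \<le> \<psi> y" "\<psi> y \<le> indicator U y" using \<epsilon>(1) by (auto simp: \<psi>_def indicator_def)
        qed
        have \<psi>1: "\<psi> y \<le> 1" for y
          using \<psi>01(2)[of y] indicator_le_1[of U y, where 'a = real] by linarith
        have bd: "bounded (range \<psi>)" using \<psi>01(1) \<psi>1 by (intro boundedI[of _ 1]) auto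
        have "(\<lambda>n. pullback_average d a n \<psi> (1, 0)) \<longlonglongrightarrow> integral\<^sup>L \<mu> \<psi>" by (rule conv[OF \<psi>c bd]) simp
        then have "integral\<^sup>L \<mu> \<psi> > 0"
          using pullback_average_bump_positive[OF d a, of "fst x" "snd x" \<epsilon> "integral\<^sup>L \<mu> \<psi>"] x \<epsilon>(1)
          unfolding \<psi>_def[abs_def] by simp
        also have "integral\<^sup>L \<mu> \<psi> \<le> integral\<^sup>L \<mu> (indicator U)"
        proof (rule integral_mono)
          show "integrable \<mu> \<psi>"
            using \<psi>01(1) \<psi>1 borel_measurable_continuous_onI[OF \<psi>c]
            by (intro integrable_const_bound[of _ 1]) (auto cong: measurable_cong_sets simp: sets)
          show "integrable \<mu> (indicator U :: _ \<Rightarrow> real)"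
            using U(1) by (intro integrable_real_indicator) (auto simp: sets less_top[symmetric])
        qed (rule \<psi>01(2))
        also have "\<dots> = measure \<mu> U" using U(1) by (simp add: sets)
        finally show "0 < emeasure \<mu> U" by (simp add: emeasure_eq_measure)
      qed
    qed
  qed
  finally show ?thesis .
qed

section \<open>Structural stability\<close>

lemma filled_set_image:
  assumes "(z, w) \<in> filled_set d a"
  shows "(z ^ (d ^ n), fibre_iterate d a z n w) \<in> filled_set d a"
proof -
  have "range (\<lambda>m. fibre_iterate d a (z ^ (d ^ n)) m (fibre_iterate d a z n w)) \<subseteq> range (\<lambda>m. fibre_iterate d a z m w)"
    by (auto simp: fibre_iterate_add[symmetric])
  then show ?thesis using assms by (auto simp: filled_set_def norm_power intro: bounded_subset)
qed

text \<open>The conditions are symmetric in the two parameters, so every result below can be used in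
  both directions; this yields the inverse of the shadow map.\<close>

locale close_pair =
  b: expanding_fibres d b R k N \<delta> + c: expanding_fibres d c R k N \<delta> for d b c R k N \<delta> +
  assumes escape_half: "escape_radius d b 1 (R / 2)" "escape_radius d c 1 (R / 2)"
    and close_k: "\<And>z w. cmod z = 1 \<Longrightarrow> cmod w \<le> R \<Longrightarrow>
      dist (fibre_iterate d b z k w) (fibre_iterate d c z k w) \<le> \<delta> / 2"
    and close_N: "\<And>z w. cmod z = 1 \<Longrightarrow> cmod w \<le> R \<Longrightarrow>
      dist (fibre_iterate d b z N w) (fibre_iterate d c z N w) \<le> R / 4"
begin

text \<open>Orbits are compared only at multiples of \<open>k\<close>, the steps at which expansion
  is guaranteed.\<close>

definition shadows :: "complex \<Rightarrow> complex \<Rightarrow> complex \<Rightarrow> bool" where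
  "shadows z u v \<longleftrightarrow> (\<forall>n. dist (fibre_iterate d b z (k * n) u) (fibre_iterate d c z (k * n) v) \<le> \<delta>)"

text \<open>A bounded orbit of \<open>b\<close> stays below R / 2 and closeness adds at most R / 4,
  so its points lie in the tube of \<open>c\<close> too. This makes inverse branches of
  \<open>c\<close> available along orbits of \<open>b\<close>.\<close>

lemma in_both_tubes:
  assumes "(z, u) \<in> filled_set d b"
  shows "cmod z = 1" "cmod u \<le> R" "cmod (fibre_iterate d c z N u) < R"
proof -
  have *: "cmod z = 1" "\<forall>n. cmod (fibre_iterate d b z n u) < R / 2"
    using assms by (auto simp: filled_set_eq[OF escape_half(1)])
  show z: "cmod z = 1" by fact
  show u: "cmod u \<le> R" using *(2)[rule_format, of 0] b.R_pos by simp
  have "cmod (fibre_iterate d b z N u) < R / 2" using *(2) by blast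
  moreover have "dist (fibre_iterate d b z N u) (fibre_iterate d c z N u) \<le> R / 4" by (rule close_N[OF z u])
  ultimately show "cmod (fibre_iterate d c z N u) < R"
    using norm_triangle_ineq2[of "fibre_iterate d c z N u" "fibre_iterate d b z N u"] b.R_pos
    by (simp add: dist_norm norm_minus_commute)
qed

text \<open>Constructed backwards: shadow the orbit from time \<open>k\<close> on by some
  \<open>v'\<close>, then pull \<open>v'\<close> back along the inverse branch of \<open>c\<close>
  near \<open>u\<close>. The branch reaches \<open>v'\<close>, which is within \<delta> + \<delta> /
  2 < 4 \<delta> of the \<open>c\<close>-image of \<open>u\<close>.\<close>

lemma finite_shadow:
  assumes "(z, u) \<in> filled_set d b"
  shows "\<exists>v. \<forall>n\<le>m. dist (fibre_iterate d b z (k * n) u) (fibre_iterate d c z (k * n) v) \<le> \<delta>"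
  using assms
proof (induction m arbitrary: z u)
  case 0
  then show ?case using b.\<delta> by (intro exI[of _ u]) simp
next
  case (Suc m)
  note tube = in_both_tubes[OF Suc.prems]
  define z' u' where "z' = z ^ (d ^ k)" and "u' = fibre_iterate d b z k u"
  have split: "fibre_iterate d a z (k * Suc n) x = fibre_iterate d a z' (k * n) (fibre_iterate d a z k x)" for a n x
    by (simp add: z'_def fibre_iterate_add[symmetric])
  have "(z', u') \<in> filled_set d b" unfolding z'_def u'_def by (rule filled_set_image[OF Suc.prems])
  then obtain v' where v': "\<forall>n\<le>m. dist (fibre_iterate d b z' (k * n) u') (fibre_iterate d c z' (k * n) v') \<le> \<delta>"
    using Suc.IH by blast
  have "dist u' v' \<le> \<delta>" using v'[rule_format, of 0] by simp
  moreover have "dist u' (fibre_iterate d c z k u) \<le> \<delta> / 2" unfolding u'_def by (rule close_k[OF tube(1,2)])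
  ultimately have "dist (fibre_iterate d c z k u) v' < 4 * \<delta>"
    using dist_triangle3[of "fibre_iterate d c z k u" v' u'] b.\<delta> by simp
  then obtain v where v: "dist u v < \<delta>" "fibre_iterate d c z k v = v'"
    by (rule c.inverse_step[OF tube(1,3)])
  have "dist (fibre_iterate d b z (k * n) u) (fibre_iterate d c z (k * n) v) \<le> \<delta>" if "n \<le> Suc m" for n
  proof (cases n)
    case 0
    then show ?thesis using v(1) by simp
  next
    case (Suc j)
    then have "j \<le> m" using that by simp
    then show ?thesis unfolding Suc split v(2) u'_def[symmetric] using v' by blast
  qed
  then show ?case by blast
qed

text \<open>For \<open>k = 0\<close> the identity would have to expand distances by 4.\<close>

lemma k_pos:
  assumes "(z, u) \<in> filled_set d b" shows "k > 0"
proof (rule ccontr)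
  assume "\<not> k > 0"
  then have "4 * dist u (u + of_real \<delta>) \<le> dist u (u + of_real \<delta>)"
    using c.expand[OF in_both_tubes(1,3)[OF assms], of u "u + of_real \<delta>"] b.\<delta> by (simp add: dist_norm)
  then show False using b.\<delta> by (simp add: dist_norm)
qed

text \<open>The nested compact sets of finite shadows have a common point \<open>v\<close>. Its
  orbit is bounded a priori only at multiples of \<open>k\<close>; if it left the disc of radius
  \<open>R\<close> at any time, it would double at each further step and violate this bound at a
  later multiple.\<close>

lemma ex_shadow:
  assumes u: "(z, u) \<in> filled_set d b"
  shows "\<exists>v. (z, v) \<in> filled_set d c \<and> shadows z u v"
proof -
  define F where "F m = cball u \<delta> \<inter> (\<Inter>n\<in>{..m}. {v. dist (fibre_iterate d b z (k * n) u) (fibre_iterate d c z (k * n) v) \<le> \<delta>})" for m :: nat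
  have "\<Inter> (range F) \<noteq> {}"
  proof (rule compact_nest)
    show "compact (F m)" for m unfolding F_def
      by (intro compact_Int_closed compact_cball closed_INT ballI closed_Collect_le continuous_intros)
    show "F m \<noteq> {}" for m
    proof -
      obtain v where v: "\<forall>n\<le>m. dist (fibre_iterate d b z (k * n) u) (fibre_iterate d c z (k * n) v) \<le> \<delta>"
        using finite_shadow[OF u] by blast
      then have "v \<in> F m" using v[rule_format, of 0] by (auto simp: F_def)
      then show ?thesis by blast
    qed
    show "F n \<subseteq> F m" if "m \<le> n" for m n using that by (auto simp: F_def)
  qed
  then obtain v where v: "\<And>m. v \<in> F m" by auto
  then have sh: "shadows z u v" unfolding shadows_def F_def by blast
  have z: "cmod z = 1" by (rule in_both_tubes(1)[OF u])
  have bR: "cmod (fibre_iterate d c z (k * n) v) < 2 * R + \<delta>" for n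
  proof -
    have "cmod (fibre_iterate d b z (k * n) u) < R / 2"
      using u by (auto simp: filled_set_eq[OF escape_half(1)])
    then show ?thesis
      using sh[unfolded shadows_def, rule_format, of n] b.R_pos
        norm_triangle_ineq2[of "fibre_iterate d c z (k * n) v" "fibre_iterate d b z (k * n) u"]
      by (simp add: dist_norm norm_minus_commute)
  qed
  have "cmod (fibre_iterate d c z n v) < R" for n
  proof (rule ccontr)
    assume "\<not> ?thesis"
    then have n: "R \<le> cmod (fibre_iterate d c z n v)" by simp
    obtain m where "(2 * R + \<delta>) / R < 2 ^ m" using real_arch_pow[of 2] by auto
    then have m: "2 * R + \<delta> < 2 ^ m * R" using b.R_pos by (simp add: field_simps)
    \<comment> \<open>\<open>k * (n + m)\<close> is a multiple of \<open>k\<close> at least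
      \<open>m\<close> steps after \<open>n\<close>, enough for the doubling to exceed 2R +
      \<delta>.\<close>
    have le: "n + m \<le> k * (n + m)" using k_pos[OF u] by (cases k) auto
    define j where "j = k * (n + m) - n"
    have "n \<le> k * (n + m)" using le by (rule order.trans[OF le_add1])
    then have j1: "n + j = k * (n + m)" unfolding j_def by (rule le_add_diff_inverse)
    have "n + m \<le> n + j" unfolding j1 by (rule le)
    then have "m \<le> j" by simp
    note j = j1 this
    have "2 ^ j * R \<le> cmod (fibre_iterate d c z (n + j) v)"
      using z by (intro escape_doubling[OF c.escape n]) (simp add: norm_power)
    moreover have "2 ^ m * R \<le> 2 ^ j * R" using j(2) b.R_pos by (intro mult_right_mono power_increasing) auto
    ultimately show False using bR[of "n + m"] m unfolding j(1) by linarith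
  qed
  then have "(z, v) \<in> filled_set d c" using z by (simp add: filled_set_eq[OF c.escape])
  then show ?thesis using sh by blast
qed

text \<open>The distance of two shadows grows at least by the factor 4 every \<open>k\<close> steps,
  yet remains at most 2 \<delta>.\<close>

lemma shadow_unique:
  assumes u: "(z, u) \<in> filled_set d b" and v: "shadows z u v" "shadows z u v'"
  shows "v = v'"
proof -
  define y y' where "y n = fibre_iterate d c z (k * n) v" and "y' n = fibre_iterate d c z (k * n) v'" for n
  have step: "4 * dist (y n) (y' n) \<le> dist (y (Suc n)) (y' (Suc n))" for n
  proof -
    define z' u' where "z' = z ^ (d ^ (k * n))" and "u' = fibre_iterate d b z (k * n) u"
    have "(z', u') \<in> filled_set d b" unfolding z'_def u'_def by (rule filled_set_image[OF u])
    note tube = in_both_tubes[OF this]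
    have "dist u' (y n) \<le> \<delta>" "dist u' (y' n) \<le> \<delta>"
      using v by (auto simp: shadows_def u'_def y_def y'_def)
    then have "4 * dist (y n) (y' n) \<le> dist (fibre_iterate d c z' k (y n)) (fibre_iterate d c z' k (y' n))"
      by (rule c.expand[OF tube(1,3)])
    moreover have "fibre_iterate d c z' k (fibre_iterate d c z (k * n) x) = fibre_iterate d c z (k * Suc n) x" for x
      unfolding z'_def fibre_iterate_add[symmetric] by (simp add: add.commute)
    ultimately show ?thesis by (simp add: y_def y'_def)
  qed
  have grow: "4 ^ n * dist v v' \<le> dist (y n) (y' n)" for n
  proof (induction n)
    case (Suc n)
    then show ?case using step[of n] by simp
  qed (simp add: y_def y'_def)
  have bd: "dist (y n) (y' n) \<le> 2 * \<delta>" for n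
    using v dist_triangle3[of "y n" "y' n" "fibre_iterate d b z (k * n) u"]
    unfolding shadows_def y_def y'_def by (smt (verit))
  show ?thesis
  proof (rule ccontr)
    assume "v \<noteq> v'"
    then have "dist v v' > 0" by simp
    moreover obtain n where "2 * \<delta> / dist v v' < 4 ^ n" using real_arch_pow[of 4] by auto
    ultimately have "2 * \<delta> < 4 ^ n * dist v v'" by (simp add: field_simps)
    then show False using grow[of n] bd[of n] by linarith
  qed
qed

text \<open>A closed graph argument with compact target: by uniqueness, being the shadow of
  \<open>u\<close> amounts to countably many closed conditions on the pair.\<close>

lemma continuous_shadow_map:
  assumes \<theta>: "\<And>z u. (z, u) \<in> filled_set d b \<Longrightarrow> (z, \<theta> z u) \<in> filled_set d c \<and> shadows z u (\<theta> z u)"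
  shows "continuous_on (filled_set d b) (\<lambda>(z, u). (z, \<theta> z u))"
proof (rule continuous_from_closed_graph[of "filled_set d c"])
  let ?f = "\<lambda>(z, u). (z, \<theta> z u)"
  show "compact (filled_set d c)" by (rule compact_filled_set[OF b.d])
  show "?f \<in> filled_set d b \<rightarrow> filled_set d c" using \<theta> by auto
  define G where "G = {p :: (complex \<times> complex) \<times> (complex \<times> complex). fst (fst p) = fst (snd p)} \<inter>
    (\<Inter>n. {p. dist (fibre_iterate d b (fst (fst p)) (k * n) (snd (fst p))) (fibre_iterate d c (fst (snd p)) (k * n) (snd (snd p))) \<le> \<delta>})"
  have "closed G" unfolding G_def
    by (intro closed_Int closed_INT ballI closed_Collect_le closed_Collect_eq continuous_intros)
  moreover have "(\<lambda>x. (x, ?f x)) ` filled_set d b = (filled_set d b \<times> filled_set d c) \<inter> G"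
  proof safe
    fix z u assume "(z, u) \<in> filled_set d b"
    note * = \<theta>[OF this]
    then show "(z, \<theta> z u) \<in> filled_set d c" "((z, u), (z, \<theta> z u)) \<in> G"
      by (auto simp: G_def shadows_def)
  next
    fix z u z' v assume p: "(z, u) \<in> filled_set d b" "(z', v) \<in> filled_set d c" "((z, u), (z', v)) \<in> G"
    then have "z' = z" "shadows z u v" by (auto simp: G_def shadows_def)
    moreover have "v = \<theta> z u" using shadow_unique[OF p(1)] \<theta>[OF p(1)] calculation by blast
    ultimately show "((z, u), (z', v)) \<in> (\<lambda>x. (x, ?f x)) ` filled_set d b" using p(1) by (intro image_eqI[of _ _ "(z, u)"]) auto
  qed
  ultimately show "closed ((\<lambda>x. (x, ?f x)) ` filled_set d b)"
    using compact_filled_set[OF b.d] by (simp add: closed_Int closed_Times compact_imp_closed)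
qed

end

lemma close_pair_swap: "close_pair d b c R k N \<delta> \<Longrightarrow> close_pair d c b R k N \<delta>"
proof -
  assume "close_pair d b c R k N \<delta>"
  then interpret close_pair d b c R k N \<delta> .
  show ?thesis
  proof (intro close_pair.intro close_pair_axioms.intro)
    show "expanding_fibres d c R k N \<delta>" "expanding_fibres d b R k N \<delta>"
      by (rule c.expanding_fibres_axioms b.expanding_fibres_axioms)+
    fix z w :: complex assume zw: "cmod z = 1" "cmod w \<le> R"
    show "dist (fibre_iterate d c z k w) (fibre_iterate d b z k w) \<le> \<delta> / 2"
      using close_k[OF zw] by (subst dist_commute)
    show "dist (fibre_iterate d c z N w) (fibre_iterate d b z N w) \<le> R / 4"
      using close_N[OF zw] by (subst dist_commute)
  qed (rule escape_half)+
qed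

text \<open>Shadowing is a symmetric relation, so the shadow maps in the two directions are mutually
  inverse by uniqueness.\<close>

lemma close_pair_homeomorphic:
  assumes "close_pair d b c R k N \<delta>"
  shows "filled_set d b homeomorphic filled_set d c"
proof -
  interpret bc: close_pair d b c R k N \<delta> by fact
  interpret cb: close_pair d c b R k N \<delta> using assms by (rule close_pair_swap)
  define \<theta> where "\<theta> z u = (SOME v. (z, v) \<in> filled_set d c \<and> bc.shadows z u v)" for z u
  define \<eta> where "\<eta> z u = (SOME v. (z, v) \<in> filled_set d b \<and> cb.shadows z u v)" for z u
  have \<theta>: "(z, \<theta> z u) \<in> filled_set d c \<and> bc.shadows z u (\<theta> z u)" if "(z, u) \<in> filled_set d b" for z u
    unfolding \<theta>_def by (rule someI_ex) (rule bc.ex_shadow[OF that])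
  have \<eta>: "(z, \<eta> z u) \<in> filled_set d b \<and> cb.shadows z u (\<eta> z u)" if "(z, u) \<in> filled_set d c" for z u
    unfolding \<eta>_def by (rule someI_ex) (rule cb.ex_shadow[OF that])
  have swap: "bc.shadows z u v \<longleftrightarrow> cb.shadows z v u" for z u v
    unfolding bc.shadows_def cb.shadows_def by (subst dist_commute) (rule refl)
  have left: "\<eta> z (\<theta> z u) = u" if u: "(z, u) \<in> filled_set d b" for z u
  proof (rule cb.shadow_unique)
    show "(z, \<theta> z u) \<in> filled_set d c" using \<theta>[OF u] by blast
    then show "cb.shadows z (\<theta> z u) (\<eta> z (\<theta> z u))" using \<eta> by blast
    show "cb.shadows z (\<theta> z u) u" using \<theta>[OF u] unfolding swap by blast
  qed
  have right: "\<theta> z (\<eta> z v) = v" if v: "(z, v) \<in> filled_set d c" for z v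
  proof (rule bc.shadow_unique)
    show "(z, \<eta> z v) \<in> filled_set d b" using \<eta>[OF v] by blast
    then show "bc.shadows z (\<eta> z v) (\<theta> z (\<eta> z v))" using \<theta> by blast
    show "bc.shadows z (\<eta> z v) v" using \<eta>[OF v] unfolding swap by blast
  qed
  show ?thesis
    unfolding homeomorphic_minimal
  proof (intro exI conjI ballI)
    show "continuous_on (filled_set d b) (\<lambda>(z, u). (z, \<theta> z u))" by (rule bc.continuous_shadow_map[OF \<theta>])
    show "continuous_on (filled_set d c) (\<lambda>(z, u). (z, \<eta> z u))" by (rule cb.continuous_shadow_map[OF \<eta>])
  next
    fix x assume "x \<in> filled_set d b"
    then show "(case x of (z, u) \<Rightarrow> (z, \<theta> z u)) \<in> filled_set d c"
      "(case (case x of (z, u) \<Rightarrow> (z, \<theta> z u)) of (z, u) \<Rightarrow> (z, \<eta> z u)) = x"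
      by (cases x; simp add: \<theta> left)+
  next
    fix x assume "x \<in> filled_set d c"
    then show "(case x of (z, u) \<Rightarrow> (z, \<eta> z u)) \<in> filled_set d b"
      "(case (case x of (z, u) \<Rightarrow> (z, \<eta> z u)) of (z, u) \<Rightarrow> (z, \<theta> z u)) = x"
      by (cases x; simp add: \<eta> right)+
  qed
qed

lemma filled_set_locally_stable:
  assumes d: "d \<ge> 2" and a: "a \<in> escape_locus d"
  obtains U where "open U" "a \<in> U" "\<And>b. b \<in> U \<Longrightarrow> filled_set d a homeomorphic filled_set d b"
proof -
  obtain R where R: "R > 0" "\<And>R'. R \<le> R' \<Longrightarrow> \<exists>k N \<delta> U. \<delta> > 0 \<and> open U \<and> a \<in> U \<and>
      (\<forall>b\<in>U. escape_radius d b 1 (R' / 2)) \<and>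
      (\<forall>b\<in>U. \<forall>z w y1 y2. cmod z = 1 \<longrightarrow> cmod (fibre_iterate d b z N w) < R' \<longrightarrow>
         dist w y1 \<le> \<delta> \<longrightarrow> dist w y2 \<le> \<delta> \<longrightarrow>
         4 * dist y1 y2 \<le> dist (fibre_iterate d b z k y1) (fibre_iterate d b z k y2)) \<and>
      (\<forall>b\<in>U. \<forall>c\<in>U. \<forall>z w. cmod z = 1 \<longrightarrow> cmod w \<le> R' \<longrightarrow>
         dist (fibre_iterate d b z k w) (fibre_iterate d c z k w) \<le> \<delta> / 2 \<and>
         dist (fibre_iterate d b z N w) (fibre_iterate d c z N w) \<le> R' / 4)"
    by (rule fibre_expansion[OF d a]) (rule that)
  from R(2)[OF order_refl] obtain k N \<delta> U where *: "\<delta> > 0" "open U" "a \<in> U"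
      "\<forall>b\<in>U. escape_radius d b 1 (R / 2)"
      "\<forall>b\<in>U. \<forall>z w y1 y2. cmod z = 1 \<longrightarrow> cmod (fibre_iterate d b z N w) < R \<longrightarrow>
         dist w y1 \<le> \<delta> \<longrightarrow> dist w y2 \<le> \<delta> \<longrightarrow>
         4 * dist y1 y2 \<le> dist (fibre_iterate d b z k y1) (fibre_iterate d b z k y2)"
      "\<forall>b\<in>U. \<forall>c\<in>U. \<forall>z w. cmod z = 1 \<longrightarrow> cmod w \<le> R \<longrightarrow>
         dist (fibre_iterate d b z k w) (fibre_iterate d c z k w) \<le> \<delta> / 2 \<and>
         dist (fibre_iterate d b z N w) (fibre_iterate d c z N w) \<le> R / 4"
    by (elim exE conjE) (rule that)
  have esc: "escape_radius d b 1 R" if "b \<in> U" for b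
    using *(4) that R(1) escape_radius_mono[of d b 1 "R / 2" 1 R] by auto
  have ef: "expanding_fibres d b R k N \<delta>" if "b \<in> U" for b
    by (rule expanding_fibres.intro[OF d esc[OF that] *(1)]) (rule *(5)[rule_format, OF that])
  have cp: "close_pair d a b R k N \<delta>" if b: "b \<in> U" for b
  proof (intro close_pair.intro close_pair_axioms.intro ef b *(3))
    show "escape_radius d a 1 (R / 2)" "escape_radius d b 1 (R / 2)" using *(3,4) b by blast+
    fix z w :: complex assume zw: "cmod z = 1" "cmod w \<le> R"
    show "dist (fibre_iterate d a z k w) (fibre_iterate d b z k w) \<le> \<delta> / 2"
      "dist (fibre_iterate d a z N w) (fibre_iterate d b z N w) \<le> R / 4"
      using *(6)[rule_format, OF *(3) b zw] by blast+
  qed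
  show ?thesis by (rule that[OF *(2,3)]) (rule close_pair_homeomorphic[OF cp])
qed

text \<open>On a connected set an equivalence relation with relatively open classes has only one
  class.\<close>

lemma filled_set_stable:
  assumes d: "d \<ge> 2" and \<Lambda>: "\<Lambda> \<subseteq> escape_locus d" "connected \<Lambda>" and ab: "a \<in> \<Lambda>" "b \<in> \<Lambda>"
  shows "filled_set d a homeomorphic filled_set d b"
proof (rule connected_equivalence_relation[OF \<Lambda>(2) ab])
  fix x assume x: "x \<in> \<Lambda>"
  then have "x \<in> escape_locus d" using \<Lambda>(1) by blast
  then obtain U where U: "open U" "x \<in> U" "\<And>y. y \<in> U \<Longrightarrow> filled_set d x homeomorphic filled_set d y"
    by (rule filled_set_locally_stable[OF d]) (rule that)
  then show "\<exists>T. openin (top_of_set \<Lambda>) T \<and> x \<in> T \<and> (\<forall>y\<in>T. filled_set d x homeomorphic filled_set d y)"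
    using x by (intro exI[of _ "\<Lambda> \<inter> U"]) auto
qed (blast intro: homeomorphic_trans homeomorphic_sym[THEN iffD1])+

section \<open>Coding of admissible parameters\<close>

lemma mem_tube:
  assumes "d \<ge> 2"
  shows "(z, w) \<in> tube d a R n \<longleftrightarrow> cmod z = 1 \<and> cmod (fibre_iterate d a z n w) < R"
proof -
  have "cmod (z ^ (d ^ n)) = 1 \<longleftrightarrow> cmod z = 1"
  proof
    assume "cmod (z ^ (d ^ n)) = 1"
    then have "cmod z ^ (d ^ n) = 1" by (simp only: norm_power)
    from power_eq_1_iff[OF this] show "cmod z = 1" using assms by simp
  qed (simp add: norm_power)
  then show ?thesis by (simp add: tube_def skew_product_iterate)
qed

lemma quotient_maps_homeomorphic_space:
  assumes f: "quotient_map X Y f" and g: "quotient_map X Z g"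
    and eq: "\<And>x y. x \<in> topspace X \<Longrightarrow> y \<in> topspace X \<Longrightarrow> f x = f y \<longleftrightarrow> g x = g y"
  shows "Y homeomorphic_space Z"
proof -
  obtain h where h: "continuous_map Y Z h" "\<And>x. x \<in> topspace X \<Longrightarrow> h (f x) = g x"
    by (rule quotient_map_lift_exists[OF f quotient_imp_continuous_map[OF g]]) (use eq in auto)
  obtain k where k: "continuous_map Z Y k" "\<And>x. x \<in> topspace X \<Longrightarrow> k (g x) = f x"
    by (rule quotient_map_lift_exists[OF g quotient_imp_continuous_map[OF f]]) (use eq in auto)
  have "homeomorphic_maps Y Z h k" unfolding homeomorphic_maps_def
  proof (intro conjI ballI h(1) k(1))
    show "k (h y) = y" if "y \<in> topspace Y" for y
      using that h(2) k(2) unfolding quotient_imp_surjective_map[OF f, symmetric] by auto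
    show "h (k y) = y" if "y \<in> topspace Z" for y
      using that h(2) k(2) unfolding quotient_imp_surjective_map[OF g, symmetric] by auto
  qed
  then show ?thesis by (auto simp: homeomorphic_space_def)
qed

lemma Collect_equivclp_eq_iff: "Collect (equivclp r x) = Collect (equivclp r y) \<longleftrightarrow> equivclp r x y"
proof
  assume "Collect (equivclp r x) = Collect (equivclp r y)"
  moreover have "y \<in> Collect (equivclp r y)" by simp
  ultimately have "y \<in> Collect (equivclp r x)" by (simp only:)
  then show "equivclp r x y" by simp
next
  assume xy: "equivclp r x y"
  show "Collect (equivclp r x) = Collect (equivclp r y)"
    using equivclp_trans[OF xy] equivclp_trans[OF equivclp_sym[OF xy]] by (intro Collect_cong iffI)
qed

lemma topspace_symbol_space: "topspace (symbol_space d) = PiE {1..} (\<lambda>_. {1..d})"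
  by (simp add: symbol_space_def)

lemma compact_space_symbol_space: "compact_space (symbol_space d)"
  by (simp add: symbol_space_def compact_space_product_topology compact_space_discrete_topology)

lemma continuous_map_symbol_map:
  assumes S: "\<And>i. i \<in> {1..d} \<Longrightarrow> S i \<in> {1..d}"
  shows "continuous_map (symbol_space d) (symbol_space d) (symbol_map d S)"
proof -
  have pow: "(S ^^ m) i \<in> {1..d}" if "i \<in> {1..d}" for m i
    using that by (induction m) (use S in auto)
  have "continuous_map (symbol_space d) (discrete_topology {1..d}) (\<lambda>x. symbol_map d S x n)" if n: "n \<in> {1..}" for n
  proof -
    have "continuous_map (symbol_space d) (discrete_topology {1..d}) (\<lambda>x. x n)"
      unfolding symbol_space_def by (rule continuous_map_product_projection[OF n])
    moreover have "continuous_map (discrete_topology {1..d}) (discrete_topology {1..d}) (S ^^ (d ^ (n - 1)))"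
      using pow by auto
    ultimately have "continuous_map (symbol_space d) (discrete_topology {1..d}) ((S ^^ (d ^ (n - 1))) \<circ> (\<lambda>x. x n))"
      by (rule continuous_map_compose)
    then show ?thesis using n by (simp add: symbol_map_def comp_def)
  qed
  then show ?thesis unfolding symbol_space_def[of d] continuous_map_componentwise
    by (auto simp: symbol_map_def)
qed

lemma homeomorphic_map_symbol_map:
  assumes S: "S permutes {1..d}"
  shows "homeomorphic_map (symbol_space d) (symbol_space d) (symbol_map d S)"
  unfolding homeomorphic_map_maps
proof (rule exI[of _ "symbol_map d (inv S)"], unfold homeomorphic_maps_def, intro conjI ballI)
  have S': "inv S permutes {1..d}" using S by (rule permutes_inv)
  show "continuous_map (symbol_space d) (symbol_space d) (symbol_map d S)"
    "continuous_map (symbol_space d) (symbol_space d) (symbol_map d (inv S))"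
    by (auto intro!: continuous_map_symbol_map simp only: permutes_in_image[OF S] permutes_in_image[OF S'])
  have bij: "bij S" using S by (rule permutes_bij)
  have 1: "(inv S ^^ m) ((S ^^ m) i) = i" "(S ^^ m) ((inv S ^^ m) i) = i" for m i
    using bij_fn[OF bij, of m] inv_fn[OF bij, of m] by (metis bij_inv_eq_iff)+
  fix x assume x: "x \<in> topspace (symbol_space d)"
  show "symbol_map d (inv S) (symbol_map d S x) = x" "symbol_map d S (symbol_map d (inv S) x) = x"
    using PiE_arb[OF x[unfolded topspace_symbol_space]] by (auto simp: symbol_map_def 1 fun_eq_iff restrict_def)
qed

text \<open>What the coding uses of admissibility: the covering, and a radius R' < R bounding the
  first tube. The gap R - R' is the margin behind the contraction.\<close>

locale admissible_coding =
  fixes d :: nat and a :: param and R R' :: real and r :: "nat \<Rightarrow> complex"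
  assumes d: "d \<ge> 2" and R': "0 \<le> R'" "R' < R"
    and cov: "covering_space (tube d a R 1) (skew_product d a) (tube d a R 0)"
    and tube_le: "\<And>z w. (z, w) \<in> tube d a R 1 \<Longrightarrow> cmod w \<le> R'"
    and lab: "root_labelling d a r"
    and compact_inter: "compact (\<Inter>n. tube d a R n)"
begin

abbreviation "q z \<equiv> fibre_poly d a z"
abbreviation "e t \<equiv> cis (2 * pi * t)"

lemma R_pos: "R > 0" using R' by simp

lemma mem_tube_0_1:
  "(z, w) \<in> tube d a R 0 \<longleftrightarrow> cmod z = 1 \<and> cmod w < R"
  "(z, w) \<in> tube d a R 1 \<longleftrightarrow> cmod z = 1 \<and> cmod (poly (q z) w) < R"
  using mem_tube[OF d, of z w a R 0] mem_tube[OF d, of z w a R 1] by (simp_all add: iterate_power)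

lemma tube_step: "cmod z = 1 \<Longrightarrow> cmod (poly (q z) w) < R \<Longrightarrow> cmod w \<le> R'"
  using tube_le[of z w] by (simp only: mem_tube_0_1)

text \<open>A covering is locally injective; restricted to a fibre this makes \<open>q z\<close>
  injective near \<open>w\<close>, and an injective holomorphic function has no critical
  point.\<close>

lemma tube_pderiv_nz:
  assumes z: "cmod z = 1" and w: "cmod (poly (q z) w) < R"
  shows "poly (pderiv (q z)) w \<noteq> 0"
proof -
  have x: "(z, w) \<in> tube d a R 1" using z w by (simp only: mem_tube_0_1)
  obtain T u g where T: "(z, w) \<in> T" "openin (top_of_set (tube d a R 1)) T" "homeomorphism T u (skew_product d a) g"
    by (rule covering_space_local_homeomorphism[OF cov x])
  obtain W where W: "open W" "T = tube d a R 1 \<inter> W" using T(2) by (auto simp: openin_open)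
  obtain e1 where e1: "e1 > 0" "ball (z, w) e1 \<subseteq> W" using W T(1) by (meson IntD2 open_contains_ball)
  have "open {v. cmod (poly (q z) v) < R}" by (intro open_Collect_less continuous_intros)
  then obtain e2 where e2: "e2 > 0" "ball w e2 \<subseteq> {v. cmod (poly (q z) v) < R}"
    using w by (metis mem_Collect_eq open_contains_ball)
  define s where "s = min e1 e2"
  have sub: "(z, v) \<in> T" if "v \<in> ball w s" for v
  proof -
    have "(z, v) \<in> ball (z, w) e1" using that by (simp add: s_def dist_prod_def)
    moreover have "(z, v) \<in> tube d a R 1" using that e2(2) z by (auto simp: s_def mem_tube_0_1 simp del: One_nat_def)
    ultimately show ?thesis using e1(2) W(2) by blast
  qed
  have "inj_on (poly (q z)) (ball w s)"
  proof (rule inj_onI)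
    fix x y assume "x \<in> ball w s" "y \<in> ball w s" and eq: "poly (q z) x = poly (q z) y"
    then have "(z, x) \<in> T" "(z, y) \<in> T" using sub by auto
    moreover have "skew_product d a (z, x) = skew_product d a (z, y)" using eq by (simp add: skew_product_def)
    ultimately have "(z, x) = (z, y)" using homeomorphism_apply1[OF T(3)] by metis
    then show "x = y" by simp
  qed
  moreover have "poly (q z) holomorphic_on ball w s" by (intro holomorphic_intros)
  ultimately have "deriv (poly (q z)) w \<noteq> 0"
    by (intro holomorphic_injective_imp_regular[of _ "ball w s"]) (use e1 e2 in \<open>auto simp: s_def\<close>)
  then show ?thesis by (simp add: deriv_poly)
qed

lemma card_roots:
  assumes "cmod z = 1" "cmod v < R"
  shows "card {w. poly (q z) w = v} = d" "finite {w. poly (q z) w = v}"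
proof -
  have nz: "q z - [:v:] \<noteq> 0"
    using d degree_diff_const[of "q z" v] degree_fibre_poly[OF d, of a z] by (metis degree_0 not_numeral_le_zero)
  have eq: "{w. poly (q z) w = v} = {w. poly (q z - [:v:]) w = 0}" by auto
  show "finite {w. poly (q z) w = v}" unfolding eq using nz by (rule poly_roots_finite)
  show "card {w. poly (q z) w = v} = d" unfolding eq
    using proots_simple(2)[OF _ nz] tube_pderiv_nz[OF assms(1)] assms(2)
    by (simp add: pderiv_diff pderiv_pCons degree_fibre_poly[OF d])
qed

lemma e_props: "cmod (e t) = 1" "e t ^ (d ^ n) = e (real (d ^ n) * t)" "e (t + 1) = e t"
proof -
  show "e t ^ (d ^ n) = e (real (d ^ n) * t)" using Complex.DeMoivre[of "2 * pi * t" "d ^ n"] by (simp only: mult_ac)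
  have "e (t + 1) = e t * cis (2 * pi)" unfolding cis_mult by (simp add: algebra_simps)
  then show "e (t + 1) = e t" by simp
qed simp

text \<open>The map (t, v) \<mapsto> (e(t), \<gamma>(t, v)) lifts (t, v) \<mapsto> (e(t)^d, v)
  through the covering, and lifts on a connected set are determined by one value. \<open>T\<close>
  is the whole of \<open>domain\<close> for branches and a segment for monodromy paths.\<close>

lemma lift_unique:
  fixes T :: "(real \<times> complex) set"
  assumes T: "connected T" "T \<subseteq> UNIV \<times> ball 0 R"
    and \<gamma>1: "continuous_on T \<gamma>1" "\<And>y. y \<in> T \<Longrightarrow> poly (q (e (fst y))) (\<gamma>1 y) = snd y"
    and \<gamma>2: "continuous_on T \<gamma>2" "\<And>y. y \<in> T \<Longrightarrow> poly (q (e (fst y))) (\<gamma>2 y) = snd y"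
    and y0: "y0 \<in> T" "\<gamma>1 y0 = \<gamma>2 y0" and y: "y \<in> T"
  shows "\<gamma>1 y = \<gamma>2 y"
proof -
  let ?f = "\<lambda>y. (e (fst y) ^ d, snd y)"
  have ce: "continuous_on T (\<lambda>y. e (fst y))" by (intro continuous_intros)
  have im: "(\<lambda>y. (e (fst y), \<gamma> y)) \<in> T \<rightarrow> tube d a R 1" if "\<And>y. y \<in> T \<Longrightarrow> poly (q (e (fst y))) (\<gamma> y) = snd y" for \<gamma>
    using that T(2) by (auto simp: mem_tube_0_1 subset_iff simp del: One_nat_def)
  have "(e (fst y), \<gamma>1 y) = (e (fst y), \<gamma>2 y)"
  proof (rule covering_space_lift_unique[OF cov, of "\<lambda>y. (e (fst y), \<gamma>1 y)" y0 "\<lambda>y. (e (fst y), \<gamma>2 y)" T ?f])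
    show "continuous_on T ?f" by (intro continuous_intros ce)
    show "?f \<in> T \<rightarrow> tube d a R 0"
      using T(2) by (auto simp: mem_tube_0_1 subset_iff norm_power)
    show "continuous_on T (\<lambda>y. (e (fst y), \<gamma>1 y))" "continuous_on T (\<lambda>y. (e (fst y), \<gamma>2 y))"
      by (intro continuous_intros ce \<gamma>1(1) \<gamma>2(1))+
    show "(\<lambda>y. (e (fst y), \<gamma>1 y)) \<in> T \<rightarrow> tube d a R 1" by (rule im[OF \<gamma>1(2)])
    show "(\<lambda>y. (e (fst y), \<gamma>2 y)) \<in> T \<rightarrow> tube d a R 1" by (rule im[OF \<gamma>2(2)])
    show "?f x = skew_product d a (e (fst x), \<gamma>1 x)" if "x \<in> T" for x
      using \<gamma>1(2)[OF that] by (simp add: skew_product_def)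
    show "?f x = skew_product d a (e (fst x), \<gamma>2 x)" if "x \<in> T" for x
      using \<gamma>2(2)[OF that] by (simp add: skew_product_def)
  qed (use T y0 y in auto)
  then show ?thesis by simp
qed

section \<open>Inverse branches over the universal cover of the solid torus\<close>

abbreviation domain :: "(real \<times> complex) set" where "domain \<equiv> UNIV \<times> ball 0 R"

lemma connected_domain: "connected domain" "simply_connected domain" "locally path_connected domain"
proof -
  have "convex domain" by (intro convex_Times) auto
  then show "connected domain" "simply_connected domain" "locally path_connected domain"
    by (auto intro: convex_connected convex_imp_simply_connected convex_imp_locally_path_connected)
qed

lemma label_root: "i \<in> {1..d} \<Longrightarrow> poly (q 1) (r i) = 0"
  using lab by (auto simp: root_labelling_def bij_betw_def)

text \<open>As \<open>domain\<close> is simply connected, (t, v) \<mapsto> (e(t)^d, v) lifts through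
  the covering. The base coordinate of the lift is e(t) up to a d-th root of unity; this factor is
  continuous with finitely many values and equals 1 at (0, 0).\<close>

lemma ex_branch:
  assumes i: "i \<in> {1..d}"
  shows "\<exists>g. continuous_on domain g \<and> g (0, 0) = r i \<and>
    (\<forall>y\<in>domain. poly (q (e (fst y))) (g y) = snd y)"
proof -
  let ?f = "\<lambda>y. (e (fst y) ^ d, snd y)"
  have cf: "continuous_on domain ?f" by (intro continuous_intros)
  have fim: "?f \<in> domain \<rightarrow> tube d a R 0" by (auto simp: mem_tube_0_1 norm_power)
  have base: "(1, r i) \<in> tube d a R 1" using label_root[OF i] R_pos by (simp add: mem_tube_0_1 del: One_nat_def)
  have z0: "(0, 0) \<in> domain" using R_pos by simp
  have feq: "?f (0, 0) = skew_product d a (1, r i)" using label_root[OF i] by (simp add: skew_product_def)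
  obtain L where L: "continuous_on domain L" "L \<in> domain \<rightarrow> tube d a R 1" "L (0, 0) = (1, r i)"
    "\<And>y. y \<in> domain \<Longrightarrow> skew_product d a (L y) = ?f y"
    using covering_space_lift_strong[OF cov base z0 connected_domain(2,3) cf fim feq] by blast
  have Lsplit: "fst (L y) ^ d = e (fst y) ^ d" "poly (q (fst (L y))) (snd (L y)) = snd y" if "y \<in> domain" for y
    using L(4)[OF that] by (auto simp: skew_product_def case_prod_beta)
  define c where "c y = fst (L y) * cis (- (2 * pi * fst y))" for y
  have cc: "continuous_on domain c"
    unfolding c_def cis_conv_exp by (intro continuous_intros continuous_on_fst L(1))
  have "c y ^ d = 1" if "y \<in> domain" for y
  proof -
    have "c y ^ d = (e (fst y) * cis (- (2 * pi * fst y))) ^ d"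
      unfolding c_def power_mult_distrib Lsplit(1)[OF that] by simp
    then show ?thesis by (simp add: cis_mult)
  qed
  then have "c ` domain \<subseteq> {x. x ^ d = 1}" by auto
  then have "finite (c ` domain)" by (rule finite_subset) (rule finite_roots_unity, use d in simp)
  then have "c constant_on domain" by (intro continuous_finite_range_constant connected_domain(1) cc)
  moreover have "c (0, 0) = 1" using L(3) by (simp add: c_def)
  ultimately have c1: "c y = 1" if "y \<in> domain" for y using that z0 unfolding constant_on_def by metis
  have fstL: "fst (L y) = e (fst y)" if "y \<in> domain" for y
  proof -
    have "fst (L y) = fst (L y) * (cis (- (2 * pi * fst y)) * e (fst y))" by (simp add: cis_mult)
    also have "\<dots> = c y * e (fst y)" by (simp add: c_def)
    finally show ?thesis using c1[OF that] by simp
  qed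
  show ?thesis
  proof (intro exI[of _ "\<lambda>y. snd (L y)"] conjI ballI)
    show "continuous_on domain (\<lambda>y. snd (L y))" by (intro continuous_on_snd L(1))
    show "snd (L (0, 0)) = r i" using L(3) by simp
    show "poly (q (e (fst y))) (snd (L y)) = snd y" if "y \<in> domain" for y
      using Lsplit(2)[OF that] fstL[OF that] by simp
  qed
qed

definition branch :: "nat \<Rightarrow> real \<Rightarrow> complex \<Rightarrow> complex" where
  "branch i t v = (SOME g. continuous_on domain g \<and> g (0, 0) = r i \<and>
    (\<forall>y\<in>domain. poly (q (e (fst y))) (g y) = snd y)) (t, v)"

lemma
  assumes i: "i \<in> {1..d}"
  shows continuous_on_branch: "continuous_on domain (\<lambda>y. branch i (fst y) (snd y))"
    and branch_0: "branch i 0 0 = r i"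
    and poly_branch: "cmod v < R \<Longrightarrow> poly (q (e t)) (branch i t v) = v"
    and norm_branch: "cmod v < R \<Longrightarrow> cmod (branch i t v) \<le> R'"
proof -
  note * = someI_ex[OF ex_branch[OF i]]
  show "continuous_on domain (\<lambda>y. branch i (fst y) (snd y))" "branch i 0 0 = r i"
    using * by (simp_all add: branch_def)
  show **: "poly (q (e t)) (branch i t v) = v" if "cmod v < R"
    using * that unfolding branch_def by force
  show "cmod (branch i t v) \<le> R'" if "cmod v < R"
    by (rule tube_step[of "e t"]) (simp_all add: **[OF that] that)
qed

text \<open>Branches that meet once coincide everywhere by \<open>lift_unique\<close>, in particular
  at (0, 0), where their labels tell them apart.\<close>

lemma branch_inj:
  assumes ij: "i \<in> {1..d}" "j \<in> {1..d}" and v: "cmod v < R" and eq: "branch i t v = branch j t v"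
  shows "i = j"
proof -
  have poly: "poly (q (e (fst y))) (branch k (fst y) (snd y)) = snd y" if "y \<in> domain" "k \<in> {1..d}" for y k
    using poly_branch[OF that(2), of "snd y" "fst y"] that(1) by auto
  have "branch i (fst y) (snd y) = branch j (fst y) (snd y)" if "y \<in> domain" for y
  proof (rule lift_unique[of domain "\<lambda>y. branch i (fst y) (snd y)" "\<lambda>y. branch j (fst y) (snd y)" "(t, v)" y])
    show "(t, v) \<in> domain" using v by simp
    show "branch i (fst (t, v)) (snd (t, v)) = branch j (fst (t, v)) (snd (t, v))" using eq by simp
  qed (rule connected_domain order_refl continuous_on_branch[OF ij(1)] continuous_on_branch[OF ij(2)]
      poly[OF _ ij(1)] poly[OF _ ij(2)] that, assumption?)+
  from this[of "(0, 0)"] have "branch i 0 0 = branch j 0 0" using R_pos by simp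
  then have "r i = r j" unfolding branch_0[OF ij(1)] branch_0[OF ij(2)] .
  moreover have "inj_on r {1..d}" using lab by (simp add: root_labelling_def bij_betw_def)
  ultimately show ?thesis using ij by (metis inj_onD)
qed

text \<open>The \<open>d\<close> branches take distinct values among the \<open>d\<close> roots,
  hence all of them.\<close>

lemma branch_surj:
  assumes v: "cmod v < R" and w: "poly (q (e t)) w = v"
  shows "\<exists>i\<in>{1..d}. w = branch i t v"
proof -
  have "(\<lambda>i. branch i t v) ` {1..d} = {w. poly (q (e t)) w = v}"
  proof (rule card_subset_eq)
    show "finite {w. poly (q (e t)) w = v}" by (rule card_roots(2)) (use v in auto)
    show "(\<lambda>i. branch i t v) ` {1..d} \<subseteq> {w. poly (q (e t)) w = v}" using poly_branch v by auto
    have "inj_on (\<lambda>i. branch i t v) {1..d}" using branch_inj v by (auto intro: inj_onI)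
    then show "card ((\<lambda>i. branch i t v) ` {1..d}) = card {w. poly (q (e t)) w = v}"
      using card_roots(1)[of "e t" v] v by (simp add: card_image)
  qed
  then show ?thesis using w by blast
qed

abbreviation "S \<equiv> monodromy_perm d a r"

text \<open>Along v = 0 the branch is a path of roots from \<open>r i\<close>; uniqueness of lifts
  makes it the only one, as the \<open>THE\<close> in the monodromy demands.\<close>

lemma root_monodromy_branch:
  assumes i: "i \<in> {1..d}"
  shows "root_monodromy d a (r i) = branch i 1 0"
  unfolding root_monodromy_def
proof (rule the_equality)
  have 0: "cmod 0 < R" using R_pos by simp
  have cont: "continuous_on {0..1} (\<lambda>t. branch i t 0)"
    by (rule continuous_on_compose2[OF continuous_on_branch[OF i], of _ "\<lambda>t. (t, 0)", simplified])
      (auto intro!: continuous_intros simp: R_pos)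
  show "\<exists>\<gamma>. continuous_on {0..1} \<gamma> \<and> \<gamma> 0 = r i \<and> \<gamma> 1 = branch i 1 0 \<and>
      (\<forall>t\<in>{0..1}. poly (q (e t)) (\<gamma> t) = 0)"
    using cont branch_0[OF i] poly_branch[OF i 0] by (intro exI[of _ "\<lambda>t. branch i t 0"]) auto
  fix w' assume "\<exists>\<gamma>. continuous_on {0..1} \<gamma> \<and> \<gamma> 0 = r i \<and> \<gamma> 1 = w' \<and>
      (\<forall>t\<in>{0..1}. poly (q (e t)) (\<gamma> t) = 0)"
  then obtain \<gamma> where \<gamma>: "continuous_on {0..1} \<gamma>" "\<gamma> 0 = r i" "\<gamma> 1 = w'"
    "\<And>t. t \<in> {0..1} \<Longrightarrow> poly (q (e t)) (\<gamma> t) = 0" by blast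
  let ?T = "{0..1::real} \<times> {0::complex}"
  have "\<gamma> (fst y) = branch i (fst y) (snd y)" if "y \<in> ?T" for y
  proof (rule lift_unique[of ?T "\<lambda>y. \<gamma> (fst y)" "\<lambda>y. branch i (fst y) (snd y)" "(0, 0)" y])
    show "connected ?T" by (intro connected_Times) auto
    show "?T \<subseteq> domain" using R_pos by auto
    then show "continuous_on ?T (\<lambda>y. branch i (fst y) (snd y))"
      by (rule continuous_on_subset[OF continuous_on_branch[OF i]])
    show "continuous_on ?T (\<lambda>y. \<gamma> (fst y))"
      by (rule continuous_on_compose2[OF \<gamma>(1)]) (auto intro!: continuous_intros)
    show "poly (q (e (fst y))) (\<gamma> (fst y)) = snd y" if "y \<in> ?T" for y using \<gamma>(4)[of "fst y"] that by auto
    show "poly (q (e (fst y))) (branch i (fst y) (snd y)) = snd y" if "y \<in> ?T" for y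
      using poly_branch[OF i 0, of "fst y"] that by auto
    show "\<gamma> (fst (0, 0)) = branch i (fst (0, 0)) (snd (0, 0))" using \<gamma>(2) branch_0[OF i] by simp
  qed (use that in auto)
  from this[of "(1, 0)"] show "w' = branch i 1 0" using \<gamma>(3) by simp
qed

lemma
  assumes i: "i \<in> {1..d}"
  shows label_monodromy: "r (S i) = branch i 1 0" and monodromy_in: "S i \<in> {1..d}"
proof -
  have "poly (q 1) (branch i 1 0) = 0" using poly_branch[OF i, of 0 1] R_pos by simp
  then have *: "branch i 1 0 \<in> r ` {1..d}" using lab by (auto simp: root_labelling_def bij_betw_def)
  have Si: "S i = inv_into {1..d} r (branch i 1 0)"
    using i root_monodromy_branch[OF i] by (simp add: monodromy_perm_def)
  show "r (S i) = branch i 1 0" unfolding Si by (rule f_inv_into_f[OF *])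
  show "S i \<in> {1..d}" unfolding Si by (rule inv_into_into[OF *])
qed

text \<open>Since \<open>e\<close> has period 1, both sides are lifts of the same map; they agree at
  (0, 0), where the left side is the end point of the monodromy path of \<open>r i\<close>.\<close>

lemma branch_shift:
  assumes i: "i \<in> {1..d}" and v: "cmod v < R"
  shows "branch i (t + 1) v = branch (S i) t v"
proof -
  have "branch i (fst (t, v) + 1) (snd (t, v)) = branch (S i) (fst (t, v)) (snd (t, v))"
  proof (rule lift_unique[OF connected_domain(1) order_refl, of "\<lambda>y. branch i (fst y + 1) (snd y)" _ "(0, 0)"])
    show "continuous_on domain (\<lambda>y. branch i (fst y + 1) (snd y))"
      by (rule continuous_on_compose2[OF continuous_on_branch[OF i], of _ "\<lambda>y. (fst y + 1, snd y)", simplified])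
        (auto intro!: continuous_intros)
    show "continuous_on domain (\<lambda>y. branch (S i) (fst y) (snd y))"
      by (rule continuous_on_branch[OF monodromy_in[OF i]])
    show "poly (q (e (fst y))) (branch i (fst y + 1) (snd y)) = snd y" if "y \<in> domain" for y
      using poly_branch[OF i, of "snd y" "fst y + 1"] that e_props(3)[of "fst y"] by auto
    show "poly (q (e (fst y))) (branch (S i) (fst y) (snd y)) = snd y" if "y \<in> domain" for y
      using poly_branch[OF monodromy_in[OF i], of "snd y" "fst y"] that by auto
    show "branch i (fst (0, 0) + 1) (snd (0::real, 0)) = branch (S i) (fst (0, 0)) (snd (0::real, 0))"
      using label_monodromy[OF i] branch_0[OF monodromy_in[OF i]] by simp
  qed (use R_pos v in auto)
  then show ?thesis by simp
qed

lemma S_permutes: "S permutes {1..d}"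
proof (rule bij_imp_permutes)
  have "inj_on S {1..d}"
  proof (rule inj_onI)
    fix i j assume ij: "i \<in> {1..d}" "j \<in> {1..d}" "S i = S j"
    then have "branch i 1 0 = branch j 1 0" using label_monodromy by metis
    then show "i = j" using branch_inj[OF ij(1,2), of 0 1] R_pos by simp
  qed
  moreover have "S ` {1..d} = {1..d}"
    by (rule endo_inj_surj) (use calculation monodromy_in in auto)
  ultimately show "bij_betw S {1..d} {1..d}" by (simp add: bij_betw_def)
qed (auto simp: monodromy_perm_def)

lemma branch_shift_funpow:
  assumes i: "i \<in> {1..d}" and v: "cmod v < R"
  shows "branch i (t + real m) v = branch ((S ^^ m) i) t v"
  using i
proof (induction m arbitrary: i)
  case (Suc m)
  have "branch i (t + real (Suc m)) v = branch (S i) (t + real m) v"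
    using branch_shift[OF Suc.prems v, of "t + real m"] by (simp add: add_ac)
  also have "\<dots> = branch ((S ^^ Suc m) i) t v"
    unfolding Suc.IH[OF monodromy_in[OF Suc.prems]] funpow_Suc_right by simp
  finally show ?case .
qed simp

section \<open>Symbolic coding of bounded orbits\<close>

definition code :: "real \<Rightarrow> (nat \<Rightarrow> nat) \<Rightarrow> complex \<Rightarrow> bool" where
  "code t x w \<longleftrightarrow> (\<forall>n. cmod (fibre_iterate d a (e t) n w) < R \<and>
     fibre_iterate d a (e t) n w = branch (x (Suc n)) (real (d ^ n) * t) (fibre_iterate d a (e t) (Suc n) w))"

abbreviation words :: "(nat \<Rightarrow> nat) set" where "words \<equiv> PiE {1..} (\<lambda>_. {1..d})"

lemma word_in: "x \<in> words \<Longrightarrow> x (Suc n) \<in> {1..d}"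
  by (auto simp: PiE_def Pi_def)

text \<open>The branch at step \<open>n\<close> is taken at the unreduced time d^n t, so t + 1 adds
  d^n full turns and applies \<open>S\<close> d^n times. Letters are numbered from 1: step
  \<open>n\<close> belongs to the letter \<open>Suc n\<close>, in accordance with the exponent in
  \<open>symbol_map\<close>.\<close>

lemma code_shift:
  assumes x: "x \<in> words"
  shows "code (t + 1) x w \<longleftrightarrow> code t (symbol_map d S x) w"
proof -
  have "branch (x (Suc n)) (real (d ^ n) * (t + 1)) v = branch (symbol_map d S x (Suc n)) (real (d ^ n) * t) v"
    if "cmod v < R" for n v
    using branch_shift_funpow[OF word_in[OF x] that, of n "real (d ^ n) * t" "d ^ n"]
    by (simp add: symbol_map_def algebra_simps)
  then show ?thesis unfolding code_def e_props(3) by metis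
qed

lemma poly_next: "poly (q (e (real (d ^ n) * t))) (fibre_iterate d a (e t) n w) = fibre_iterate d a (e t) (Suc n) w"
  using e_props(2)[of t n] by (simp add: iterate_power)

lemma code_ex_word:
  assumes "\<And>n. cmod (fibre_iterate d a (e t) n w) < R"
  shows "\<exists>x\<in>words. code t x w"
proof -
  have "\<forall>n. \<exists>i\<in>{1..d}. fibre_iterate d a (e t) n w = branch i (real (d ^ n) * t) (fibre_iterate d a (e t) (Suc n) w)"
    using branch_surj[OF assms poly_next] by blast
  then have ex: "\<exists>i. i \<in> {1..d} \<and> fibre_iterate d a (e t) n w = branch i (real (d ^ n) * t) (fibre_iterate d a (e t) (Suc n) w)"
    for n unfolding Bex_def by (rule spec)
  define f where "f n = (SOME i. i \<in> {1..d} \<and>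
      fibre_iterate d a (e t) n w = branch i (real (d ^ n) * t) (fibre_iterate d a (e t) (Suc n) w))" for n
  have f: "f n \<in> {1..d}"
    "fibre_iterate d a (e t) n w = branch (f n) (real (d ^ n) * t) (fibre_iterate d a (e t) (Suc n) w)" for n
    using someI_ex[OF ex[of n]] unfolding f_def by (rule conjunct1, rule conjunct2)
  define x where "x = (\<lambda>n\<in>{1..}. f (n - 1))"
  have "x \<in> words" using f(1) by (auto simp: x_def)
  moreover have "code t x w" unfolding code_def
  proof (intro allI conjI)
    fix n
    have "x (Suc n) = f n" by (simp add: x_def)
    then show "fibre_iterate d a (e t) n w = branch (x (Suc n)) (real (d ^ n) * t) (fibre_iterate d a (e t) (Suc n) w)"
      using f(2)[of n] by (simp only:)
  qed (rule assms)
  ultimately show ?thesis by blast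
qed

lemma code_word_unique:
  assumes x: "x \<in> words" "x' \<in> words" and c: "code t x w" "code t x' w"
  shows "x = x'"
proof (rule PiE_ext[OF x])
  fix m :: nat assume "m \<in> {1..}"
  then obtain n where m: "m = Suc n" by (cases m) auto
  have "cmod (fibre_iterate d a (e t) (Suc n) w) < R" using c unfolding code_def by blast
  moreover have "branch (x (Suc n)) (real (d ^ n) * t) (fibre_iterate d a (e t) (Suc n) w) =
      branch (x' (Suc n)) (real (d ^ n) * t) (fibre_iterate d a (e t) (Suc n) w)"
    using c unfolding code_def by metis
  ultimately show "x m = x' m" unfolding m using branch_inj word_in x by blast
qed

text \<open>The inverse branch of Q^n prescribed by the first \<open>n\<close> letters; the branch
  of the last letter acts first.\<close>

primrec composed_branch :: "real \<Rightarrow> (nat \<Rightarrow> nat) \<Rightarrow> nat \<Rightarrow> complex \<Rightarrow> complex" where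
  "composed_branch t x 0 v = v"
| "composed_branch t x (Suc n) v = composed_branch t x n (branch (x (Suc n)) (real (d ^ n) * t) v)"

lemma norm_branch_less: "i \<in> {1..d} \<Longrightarrow> cmod v < R \<Longrightarrow> cmod (branch i t v) < R"
  using norm_branch[of i v t] R'(2) by linarith

lemma composed_branch_props:
  assumes x: "x \<in> words" and v: "cmod v < R"
  shows "cmod (composed_branch t x n v) < R" "fibre_iterate d a (e t) n (composed_branch t x n v) = v"
proof -
  have "cmod (composed_branch t x n v) < R \<and> fibre_iterate d a (e t) n (composed_branch t x n v) = v"
    using v
  proof (induction n arbitrary: v)
    case (Suc n)
    let ?u = "branch (x (Suc n)) (real (d ^ n) * t) v"
    note IH = Suc.IH[OF norm_branch_less[OF word_in[OF x, of n] Suc.prems, of "real (d ^ n) * t"]]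
    have "fibre_iterate d a (e t) (Suc n) (composed_branch t x n ?u) =
        poly (q (e (real (d ^ n) * t))) (fibre_iterate d a (e t) n (composed_branch t x n ?u))"
      by (rule poly_next[symmetric])
    also have "\<dots> = v" using IH poly_branch[OF word_in[OF x, of n] Suc.prems, of "real (d ^ n) * t"] by simp
    finally show ?case using IH by (simp only: composed_branch.simps simp_thms)
  qed simp
  then show "cmod (composed_branch t x n v) < R" "fibre_iterate d a (e t) n (composed_branch t x n v) = v"
    by simp_all
qed

lemma continuous_on_branch_fibre: "i \<in> {1..d} \<Longrightarrow> continuous_on (ball 0 R) (branch i t)"
  by (rule continuous_on_compose2[OF continuous_on_branch, of i _ "\<lambda>v. (t, v)", simplified])
    (auto intro!: continuous_intros)

lemma continuous_on_composed_branch: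
  assumes x: "x \<in> words"
  shows "continuous_on (ball 0 R) (composed_branch t x n)"
proof (induction n)
  case 0
  then show ?case by simp
next
  case (Suc n)
  have "continuous_on (ball 0 R) (\<lambda>v. composed_branch t x n (branch (x (Suc n)) (real (d ^ n) * t) v))"
    by (rule continuous_on_compose2[OF Suc continuous_on_branch_fibre[OF word_in[OF x]]])
      (use norm_branch_less[OF word_in[OF x]] in auto)
  then show ?case by simp
qed

lemma fibre_deriv_nz:
  assumes z: "cmod z = 1" and w: "cmod (fibre_iterate d a z n w) < R"
  shows "fibre_deriv d a z n w \<noteq> 0"
  using w
proof (induction n)
  case 0
  then show ?case by (simp add: pderiv_pCons)
next
  case (Suc n)
  have z': "cmod (z ^ (d ^ n)) = 1" using z by (simp add: norm_power)
  have *: "cmod (poly (q (z ^ (d ^ n))) (fibre_iterate d a z n w)) < R" using Suc.prems by (simp add: iterate_power)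
  have "cmod (fibre_iterate d a z n w) < R" using tube_step[OF z' *] R'(2) by linarith
  then show ?case unfolding fibre_deriv_Suc using Suc.IH tube_pderiv_nz[OF z' *] by simp
qed

text \<open>The growth factor of \<open>fibre_deriv_growth\<close> for the margin s = R -
  R'.\<close>

definition rate :: real where "rate = 1 + (R - R') / (2 * R)"

lemma rate: "rate > 1" using R' by (simp add: rate_def)

text \<open>The composed branch is a continuous lift of the identity through the covering Q^n, hence
  holomorphic, and its derivative is the reciprocal of a fibre derivative that grows like
  \<open>rate ^ n\<close>. On the disc of radius R' the margin R - R' is available, so the mean
  value inequality is applied there.\<close>

lemma composed_branch_contracts:
  assumes x: "x \<in> words" and v: "cmod v \<le> R'" "cmod v' \<le> R'"
  shows "cmod (composed_branch t x n v - composed_branch t x n v') \<le> 2 * R / ((R - R') * rate ^ n) * cmod (v - v')"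
proof -
  let ?B = "composed_branch t x n" and ?P = "fibre_iterate_poly d a (e t) n"
  have deg: "degree ?P > 0" using d by (simp add: degree_fibre_iterate_poly)
  have nz: "poly (pderiv ?P) w \<noteq> 0" if "poly ?P w \<in> ball 0 R" for w
    using that fibre_deriv_nz[of "e t" n w] by simp
  note covP = covering_space_poly[OF deg open_ball nz]
  have hol: "?B holomorphic_on ball 0 R"
  proof (rule covering_space_lift_is_holomorphic[OF covP])
    show "open (poly ?P -` ball 0 R)" by (intro open_vimage continuous_intros open_ball)
    show "poly ?P holomorphic_on poly ?P -` ball 0 R" by (intro holomorphic_intros)
    show "(\<lambda>v. v) holomorphic_on ball 0 R" by (intro holomorphic_intros)
    show "?B \<in> ball 0 R \<rightarrow> poly ?P -` ball 0 R" using composed_branch_props(2)[OF x] by auto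
    show "continuous_on (ball 0 R) ?B" by (rule continuous_on_composed_branch[OF x])
    show "poly ?P (?B v) = v" if "v \<in> ball 0 R" for v using composed_branch_props(2)[OF x] that by simp
  qed auto
  have step: "ball w (R - R') \<subseteq> ball 0 R \<and> poly (pderiv (q z)) w \<noteq> 0"
    if "cmod z = 1" "poly (q z) w \<in> ball 0 R" for z w
  proof
    have w: "cmod w \<le> R'" using tube_step that by simp
    show "ball w (R - R') \<subseteq> ball 0 R"
    proof
      fix u assume "u \<in> ball w (R - R')"
      then show "u \<in> ball 0 R" using w norm_triangle_ineq2[of u w] by (simp add: dist_norm norm_minus_commute)
    qed
    show "poly (pderiv (q z)) w \<noteq> 0" using tube_pderiv_nz that by simp
  qed
  show ?thesis
  proof (rule field_differentiable_bound[of "cball 0 R'" ?B "deriv ?B"])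
    fix u assume "u \<in> cball (0::complex) R'"
    then have u: "cmod u \<le> R'" "u \<in> ball 0 R" using R'(2) by auto
    have dB: "(?B has_field_derivative deriv ?B u) (at u)" using hol u(2) by (intro holomorphic_derivI) auto
    then show "(?B has_field_derivative deriv ?B u) (at u within cball 0 R')" by (rule has_field_derivative_at_within)
    have "((\<lambda>v. fibre_iterate d a (e t) n (?B v)) has_field_derivative fibre_deriv d a (e t) n (?B u) * deriv ?B u) (at u)"
      by (rule DERIV_chain2[OF fibre_iterate_DERIV dB])
    moreover have "((\<lambda>v. fibre_iterate d a (e t) n (?B v)) has_field_derivative 1) (at u)"
    proof (rule has_field_derivative_transform_within_open[of "\<lambda>v. v" 1 u "ball 0 R"])
      show "v = fibre_iterate d a (e t) n (?B v)" if "v \<in> ball 0 R" for v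
        using composed_branch_props(2)[OF x] that by simp
    qed (use u in \<open>auto intro: derivative_intros\<close>)
    ultimately have "fibre_deriv d a (e t) n (?B u) * deriv ?B u = 1" by (rule DERIV_unique)
    then have one: "cmod (fibre_deriv d a (e t) n (?B u)) * cmod (deriv ?B u) = 1" by (metis norm_mult norm_one)
    have "ball (fibre_iterate d a (e t) n (?B u)) (R - R') \<subseteq> ball 0 R"
    proof
      fix y assume "y \<in> ball (fibre_iterate d a (e t) n (?B u)) (R - R')"
      then have "y \<in> ball u (R - R')" using composed_branch_props(2)[OF x] u(2) by simp
      then show "y \<in> ball 0 R" using u(1) norm_triangle_ineq2[of y u] by (simp add: dist_norm norm_minus_commute)
    qed
    then have "(R - R') * (1 + (R - R') / (2 * R)) ^ n \<le> 2 * R * cmod (fibre_deriv d a (e t) n (?B u))"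
      by (intro fibre_deriv_growth[where V = "\<lambda>_. ball 0 R" and a = a and d = d]) (use d R' R_pos step in auto)
    then have low: "(R - R') * rate ^ n \<le> 2 * R * cmod (fibre_deriv d a (e t) n (?B u))" by (simp only: rate_def)
    have "(R - R') * rate ^ n * cmod (deriv ?B u) \<le> 2 * R * cmod (fibre_deriv d a (e t) n (?B u)) * cmod (deriv ?B u)"
      by (rule mult_right_mono[OF low]) simp
    also have "\<dots> = 2 * R" using one by (simp add: mult.assoc)
    finally have le: "(R - R') * rate ^ n * cmod (deriv ?B u) \<le> 2 * R" .
    have "(R - R') * rate ^ n > 0" using R'(2) rate by simp
    then show "cmod (deriv ?B u) \<le> 2 * R / ((R - R') * rate ^ n)"
      using le by (simp add: pos_le_divide_eq mult.commute)
  qed (use v in auto)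
qed

lemma code_composed:
  assumes "code t x w" shows "w = composed_branch t x n (fibre_iterate d a (e t) n w)"
proof (induction n)
  case (Suc n)
  have "fibre_iterate d a (e t) n w = branch (x (Suc n)) (real (d ^ n) * t) (fibre_iterate d a (e t) (Suc n) w)"
    using assms unfolding code_def by blast
  then show ?case using Suc.IH by (metis composed_branch.simps(2))
qed simp

lemma code_norm_le:
  assumes "code t x w" shows "cmod (fibre_iterate d a (e t) n w) \<le> R'"
proof -
  have "cmod (fibre_iterate d a (e t) (Suc n) w) < R" using assms unfolding code_def by blast
  then show ?thesis by (intro tube_step[of "e (real (d ^ n) * t)"]) (simp_all only: poly_next e_props(1))
qed

text \<open>For every n the two points are images, under the same n-fold inverse branch, of points
  at distance at most 2R'; contraction forces them together.\<close>

lemma code_point_unique: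
  assumes x: "x \<in> words" and c: "code t x w" "code t x w'"
  shows "w = w'"
proof (rule ccontr)
  assume "w \<noteq> w'"
  then have pos: "cmod (w - w') > 0" by simp
  define C where "C = 4 * R * R' / (R - R')"
  have bound: "rate ^ n * cmod (w - w') \<le> C" for n
  proof -
    let ?w = "fibre_iterate d a (e t) n w" and ?w' = "fibre_iterate d a (e t) n w'"
    have K: "(R - R') * rate ^ n > 0" using R'(2) rate by simp
    have "cmod (w - w') = cmod (composed_branch t x n ?w - composed_branch t x n ?w')"
      using code_composed[OF c(1), of n] code_composed[OF c(2), of n] by metis
    also have "\<dots> \<le> 2 * R / ((R - R') * rate ^ n) * cmod (?w - ?w')"
      by (rule composed_branch_contracts[OF x code_norm_le[OF c(1)] code_norm_le[OF c(2)]])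
    also have "\<dots> \<le> 2 * R / ((R - R') * rate ^ n) * (2 * R')"
      using code_norm_le[OF c(1), of n] code_norm_le[OF c(2), of n] norm_triangle_ineq4[of ?w ?w'] K R_pos
      by (intro mult_left_mono) auto
    finally have "cmod (w - w') \<le> (4 * R * R') / ((R - R') * rate ^ n)" by simp
    then have "((R - R') * rate ^ n) * cmod (w - w') \<le> 4 * R * R'" using K by (simp add: pos_le_divide_eq mult.commute)
    then show ?thesis using R'(2) by (simp add: C_def pos_le_divide_eq mult_ac)
  qed
  obtain n where "C / cmod (w - w') < rate ^ n" using real_arch_pow[OF rate] by blast
  then have "C < rate ^ n * cmod (w - w')" using pos by (simp add: field_simps)
  then show False using bound[of n] by linarith
qed

text \<open>The images of the closed disc of radius R' under longer and longer inverse branches are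
  compact, nonempty and nested; a common point follows the prescribed branch at every step.\<close>

lemma code_ex_point:
  assumes x: "x \<in> words" shows "\<exists>w. code t x w"
proof -
  define F where "F n = composed_branch t x n ` cball 0 R'" for n
  have sub: "cball 0 R' \<subseteq> ball (0::complex) R" using R'(2) by auto
  have "\<Inter> (range F) \<noteq> {}"
  proof (rule compact_nest)
    show "compact (F n)" for n unfolding F_def
      by (intro compact_continuous_image continuous_on_subset[OF continuous_on_composed_branch[OF x] sub] compact_cball)
    show "F n \<noteq> {}" for n using R'(1) by (simp add: F_def)
    have "F (Suc n) \<subseteq> F n" for n
    proof
      fix y assume "y \<in> F (Suc n)"
      then obtain v where v: "cmod v \<le> R'" "y = composed_branch t x n (branch (x (Suc n)) (real (d ^ n) * t) v)"
        by (auto simp: F_def)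
      then have "cmod (branch (x (Suc n)) (real (d ^ n) * t) v) \<le> R'"
        using R'(2) by (intro norm_branch word_in[OF x]) simp
      then show "y \<in> F n" using v(2) by (auto simp: F_def)
    qed
    then show "F n \<subseteq> F m" if "m \<le> n" for m n using that by (rule lift_Suc_antimono_le)
  qed
  then obtain w where w: "\<And>n. w \<in> F n" by auto
  have "code t x w" unfolding code_def
  proof
    fix n
    obtain v where v: "cmod v \<le> R'" "w = composed_branch t x (Suc n) v" using w[of "Suc n"] by (auto simp: F_def)
    then have vR: "cmod v < R" using R'(2) by simp
    have step: "fibre_iterate d a (e t) (Suc n) w = v"
      unfolding v(2) by (rule composed_branch_props(2)[OF x vR])
    have "fibre_iterate d a (e t) n w = branch (x (Suc n)) (real (d ^ n) * t) v"
      unfolding v(2) composed_branch.simps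
      by (rule composed_branch_props(2)[OF x norm_branch_less[OF word_in[OF x] vR]])
    then show "cmod (fibre_iterate d a (e t) n w) < R \<and>
      fibre_iterate d a (e t) n w = branch (x (Suc n)) (real (d ^ n) * t) (fibre_iterate d a (e t) (Suc n) w)"
      unfolding step using norm_branch_less[OF word_in[OF x] vR] by simp
  qed
  then show ?thesis by blast
qed

definition point :: "real \<Rightarrow> (nat \<Rightarrow> nat) \<Rightarrow> complex" where "point t x = (THE w. code t x w)"

lemma code_iff_point: "x \<in> words \<Longrightarrow> code t x w \<longleftrightarrow> w = point t x"
proof -
  assume x: "x \<in> words"
  obtain w' where w': "code t x w'" using code_ex_point[OF x] by (rule exE)
  have "point t x = w'" unfolding point_def
    by (rule the_equality[where P = "code t x", OF w']) (rule code_point_unique[OF x _ w'])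
  then show "code t x w \<longleftrightarrow> w = point t x" using w' code_point_unique[OF x _ w', of w] by blast
qed

section \<open>The decoding map as a quotient map\<close>

abbreviation K :: "(complex \<times> complex) set" where "K \<equiv> \<Inter>n. tube d a R n"

lemma mem_K: "(z, w) \<in> K \<longleftrightarrow> cmod z = 1 \<and> (\<forall>n. cmod (fibre_iterate d a z n w) < R)"
  by (auto simp: mem_tube[OF d])

abbreviation "cylinder \<equiv> prod_topology (top_of_set {0..1::real}) (symbol_space d)"
abbreviation "h \<equiv> symbol_map d S"

lemma mem_cylinder: "(s, x) \<in> topspace cylinder \<longleftrightarrow> s \<in> {0..1} \<and> x \<in> words"
  by (simp add: topspace_symbol_space)

text \<open>The circle is run through backwards, because the torus glues \<open>(0, x)\<close> to \<open>(1, h x)\<close> whereas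
  \<open>code_shift\<close> identifies the word \<open>x\<close> at \<open>t + 1\<close> with the word \<open>h x\<close> at \<open>t\<close>.\<close>

definition decode :: "real \<times> (nat \<Rightarrow> nat) \<Rightarrow> complex \<times> complex" where
  "decode = (\<lambda>(s, x). (e (1 - s), point (1 - s) x))"

lemma decode_eq_iff:
  assumes "x \<in> words" shows "(z, w) = decode (s, x) \<longleftrightarrow> z = e (1 - s) \<and> code (1 - s) x w"
  using code_iff_point[OF assms] by (simp add: decode_def)

lemma decode_in: "p \<in> topspace cylinder \<Longrightarrow> decode p \<in> K"
proof -
  assume p: "p \<in> topspace cylinder"
  obtain s x where sx: "p = (s, x)" "x \<in> words" using p mem_cylinder by (cases p) auto
  have "code (1 - s) x (point (1 - s) x)" using code_iff_point[OF sx(2)] by simp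
  then show ?thesis unfolding sx(1) decode_def prod.case mem_K code_def by simp
qed

lemma e_surj:
  assumes "cmod z = 1" shows "\<exists>t\<in>{0..1}. z = e t"
proof -
  obtain t where t: "0 \<le> t" "t < 2 * pi" "z = Complex (cos t) (sin t)"
    using complex_unimodular_polar[OF assms] by metis
  then show ?thesis by (intro bexI[of _ "t / (2 * pi)"]) (auto simp: cis.ctr)
qed

lemma e_eq_cases:
  assumes t: "t \<in> {0..1}" "t' \<in> {0..1}" and eq: "e t = e t'"
  shows "t = t' \<or> t = 0 \<and> t' = 1 \<or> t = 1 \<and> t' = 0"
proof -
  have "exp (\<i> * of_real (2 * pi * t)) = exp (\<i> * of_real (2 * pi * t'))" using eq by (simp only: cis_conv_exp)
  then obtain n :: int where n: "\<i> * of_real (2 * pi * t) = \<i> * of_real (2 * pi * t') + (of_int (2 * n) * pi) * \<i>"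
    unfolding exp_eq by blast
  have "Im (\<i> * of_real (2 * pi * t)) = Im (\<i> * of_real (2 * pi * t') + (of_int (2 * n) * pi) * \<i>)" by (simp only: n)
  then have "2 * pi * t = 2 * pi * (t' + of_int n)" by (simp add: algebra_simps)
  then have tn: "t = t' + of_int n" by simp
  then have "real_of_int n \<le> 1" "real_of_int n \<ge> -1" using t by auto
  then have "n = 0 \<or> n = 1 \<or> n = -1" by linarith
  then show ?thesis using tn t by auto
qed

lemma decode_surj: "decode ` topspace cylinder = K"
proof
  show "decode ` topspace cylinder \<subseteq> K" using decode_in by (rule image_subsetI)
  show "K \<subseteq> decode ` topspace cylinder"
  proof
    fix y assume "y \<in> K"
    then obtain z w where y: "y = (z, w)" "(z, w) \<in> K" by (cases y) auto
    then have zw: "cmod z = 1" "\<And>n. cmod (fibre_iterate d a z n w) < R" unfolding mem_K by auto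
    obtain t where t: "t \<in> {0..1}" "z = e t" using e_surj[OF zw(1)] by blast
    obtain x where x: "x \<in> words" "code t x w" using code_ex_word[OF zw(2)[unfolded t(2)]] by blast
    have "y = decode (1 - t, x)" unfolding y decode_eq_iff[OF x(1)] using t x by simp
    moreover have "(1 - t, x) \<in> topspace cylinder" unfolding mem_cylinder using t x by simp
    ultimately show "y \<in> decode ` topspace cylinder" by (rule image_eqI)
  qed
qed

lemma h_in: "x \<in> words \<Longrightarrow> h x \<in> words"
  using continuous_map_funspace[OF continuous_map_symbol_map[of d S, OF monodromy_in]]
  unfolding topspace_symbol_space by (rule funcset_mem)

lemma decode_glue:
  assumes x: "x \<in> words" shows "decode (0, x) = decode (1, h x)"
proof -
  have "code (0 + 1) x (point 1 x)" using code_iff_point[OF x, of 1] by simp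
  then have "code 0 (h x) (point 1 x)" unfolding code_shift[OF x] .
  then have "point 1 x = point 0 (h x)" using code_iff_point[OF h_in[OF x]] by simp
  then show ?thesis using e_props(3)[of 0] by (simp add: decode_def)
qed

text \<open>Points with the same image lie at the same time or at opposite ends of the interval. In
  the first case uniqueness of words identifies them; in the second, \<open>code_shift\<close> makes
  the word at 1 the image under \<open>h\<close> of the word at 0, which is one gluing step.\<close>

lemma decode_fibres:
  assumes "p \<in> topspace cylinder" "p' \<in> topspace cylinder"
  shows "decode p = decode p' \<longleftrightarrow> equivclp (torus_glue (symbol_space d) h) p p'"
proof
  assume "equivclp (torus_glue (symbol_space d) h) p p'"
  then show "decode p = decode p'"
  proof (induction rule: equivclp_induct)
    case (step y z)
    have "decode u = decode v" if "torus_glue (symbol_space d) h u v" for u v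
      using that decode_glue by (auto simp: torus_glue_def topspace_symbol_space)
    then show ?case using step by metis
  qed simp
next
  assume eq: "decode p = decode p'"
  obtain s x where p: "p = (s, x)" "s \<in> {0..1}" "x \<in> words" using assms(1) mem_cylinder by (cases p) auto
  obtain s' x' where p': "p' = (s', x')" "s' \<in> {0..1}" "x' \<in> words" using assms(2) mem_cylinder by (cases p') auto
  define w where "w = point (1 - s) x"
  have w: "code (1 - s) x w" "code (1 - s') x' w"
    using eq code_iff_point[OF p(3)] code_iff_point[OF p'(3)] by (simp_all add: p p' decode_def w_def)
  have glue: "torus_glue (symbol_space d) h (0, u) (1, v)"
    if uv: "u \<in> words" "v \<in> words" "code 1 u w" "code 0 v w" for u v
  proof -
    have "code 0 (h u) w" using code_shift[OF uv(1), of 0] uv(3) by simp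
    then have "v = h u" using code_word_unique[OF uv(2) h_in[OF uv(1)] uv(4)] by simp
    then show ?thesis using uv(1) by (simp add: torus_glue_def topspace_symbol_space)
  qed
  have "e (1 - s) = e (1 - s')" using eq by (simp add: p p' decode_def)
  then have "1 - s = 1 - s' \<or> 1 - s = 0 \<and> 1 - s' = 1 \<or> 1 - s = 1 \<and> 1 - s' = 0"
    by (intro e_eq_cases) (use p(2) p'(2) in auto)
  then consider "s = s'" | "s = 1" "s' = 0" | "s = 0" "s' = 1" by auto
  then show "equivclp (torus_glue (symbol_space d) h) p p'"
  proof cases
    case 1
    then have "x = x'" using code_word_unique[OF p(3) p'(3) w(1)] w(2) by simp
    then show ?thesis using 1 p p' by simp
  next
    case 2
    then show ?thesis using glue[OF p'(3) p(3)] w p p' by (simp add: converse_r_into_equivclp)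
  next
    case 3
    then show ?thesis using glue[OF p(3) p'(3)] w p p' by (simp add: r_into_equivclp)
  qed
qed

text \<open>Continuity of decoding is obtained without estimates. Being the point coded by a word is
  a conjunction over n of equations, each closed once the letter is fixed; and the letter takes
  finitely many values, each on a clopen set of words.\<close>

lemma closedin_decode_graph:
  "closedin (prod_topology cylinder (top_of_set K)) {y \<in> topspace (prod_topology cylinder (top_of_set K)). snd y = decode (fst y)}"
proof -
  let ?X = "prod_topology cylinder (top_of_set K)" and ?Z = "{0..1} \<times> K"
  \<comment> \<open>For a fixed letter \<open>i\<close> the n-th condition is closed in the time and
    the point, with no word in it. Membership in \<open>K\<close> keeps the argument of the branch
    inside \<open>domain\<close>.\<close>
  define A where "A n i = {y \<in> ?Z. fst (snd y) - e (1 - fst y) = 0} \<inter>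
    {y \<in> ?Z. fibre_iterate d a (fst (snd y)) n (snd (snd y)) -
      branch i (real (d ^ n) * (1 - fst y)) (fibre_iterate d a (fst (snd y)) (Suc n) (snd (snd y))) = 0}" for n i
  have A: "closedin (top_of_set ?Z) (A n i)" if i: "i \<in> {1..d}" for n i
  proof -
    have c1: "continuous_on ?Z (\<lambda>y. fst (snd y) - e (1 - fst y))" by (intro continuous_intros)
    have c2: "continuous_on ?Z (\<lambda>y. (real (d ^ n) * (1 - fst y), fibre_iterate d a (fst (snd y)) (Suc n) (snd (snd y))))"
      by (intro continuous_on_Pair continuous_on_fibre_iterate continuous_intros)
    have "fibre_iterate d a (fst (snd y)) (Suc n) (snd (snd y)) \<in> ball 0 R" if "y \<in> ?Z" for y
    proof -
      have "(fst (snd y), snd (snd y)) \<in> K" using that by (simp only: mem_Times_iff prod.collapse)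
      then have "cmod (fibre_iterate d a (fst (snd y)) (Suc n) (snd (snd y))) < R" unfolding mem_K by blast
      then show ?thesis by (simp only: mem_ball_0)
    qed
    then have im: "(\<lambda>y. (real (d ^ n) * (1 - fst y), fibre_iterate d a (fst (snd y)) (Suc n) (snd (snd y)))) ` ?Z \<subseteq> domain"
      by blast
    have c3: "continuous_on ?Z (\<lambda>y. branch i (real (d ^ n) * (1 - fst y)) (fibre_iterate d a (fst (snd y)) (Suc n) (snd (snd y))))"
      using continuous_on_compose2[OF continuous_on_branch[OF i] c2 im] by (simp only: fst_conv snd_conv)
    have c4: "continuous_on ?Z (\<lambda>y. fibre_iterate d a (fst (snd y)) n (snd (snd y)))"
      by (intro continuous_on_fibre_iterate continuous_intros)
    show ?thesis unfolding A_def
      by (intro closedin_Int continuous_closedin_preimage_constant c1 continuous_on_diff[OF c4 c3])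
  qed
  have proj: "continuous_map ?X (top_of_set ?Z) (\<lambda>y. (fst (fst y), snd y))"
    unfolding prod_topology_subtopology_eu[symmetric]
    by (intro continuous_map_pairedI continuous_map_fst_of[unfolded comp_def] continuous_map_fst continuous_map_snd continuous_map_compose[OF continuous_map_fst continuous_map_fst, unfolded comp_def])
  have symb: "continuous_map ?X (discrete_topology {1..d}) (\<lambda>y. snd (fst y) (Suc n))" for n
  proof -
    have "continuous_map (symbol_space d) (discrete_topology {1..d}) (\<lambda>x. x (Suc n))"
      unfolding symbol_space_def by (rule continuous_map_product_projection) simp
    from continuous_map_compose[OF continuous_map_compose[OF continuous_map_fst continuous_map_snd] this]
    show ?thesis by (simp only: comp_def)
  qed
  define D where "D n i = {y \<in> topspace ?X. (fst (fst y), snd y) \<in> A n i} \<inter> {y \<in> topspace ?X. snd (fst y) (Suc n) \<in> {i}}" for n i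
  have D: "closedin ?X (\<Union>i\<in>{1..d}. D n i)" for n
  proof (rule closedin_Union)
    fix T assume "T \<in> D n ` {1..d}"
    then obtain i where i: "i \<in> {1..d}" "T = D n i" by blast
    show "closedin ?X T" unfolding i(2) D_def
      by (intro closedin_Int closedin_continuous_map_preimage[OF proj A[OF i(1)]] closedin_continuous_map_preimage[OF symb])
        (use i(1) in simp)
  qed simp
  have "{y \<in> topspace ?X. snd y = decode (fst y)} = (\<Inter>n. \<Union>i\<in>{1..d}. D n i)"
  proof (intro set_eqI)
    fix y :: "(real \<times> (nat \<Rightarrow> nat)) \<times> complex \<times> complex"
    obtain s x z w where y: "y = ((s, x), (z, w))" by (metis surj_pair)
    show "y \<in> {y \<in> topspace ?X. snd y = decode (fst y)} \<longleftrightarrow> y \<in> (\<Inter>n. \<Union>i\<in>{1..d}. D n i)"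
    proof (cases "y \<in> topspace ?X")
      case True
      then have sx: "s \<in> {0..1}" "x \<in> words" "(z, w) \<in> K" unfolding y by (simp_all add: topspace_symbol_space)
      have A: "(s, (z, w)) \<in> A n i \<longleftrightarrow> z = e (1 - s) \<and>
          fibre_iterate d a z n w = branch i (real (d ^ n) * (1 - s)) (fibre_iterate d a z (Suc n) w)" for n i
        using sx unfolding A_def by (simp only: mem_Collect_eq Int_iff mem_Times_iff fst_conv snd_conv right_minus_eq simp_thms)
      have "y \<in> (\<Union>i\<in>{1..d}. D n i) \<longleftrightarrow> (s, (z, w)) \<in> A n (x (Suc n))" for n
        using word_in[OF sx(2), of n] True unfolding D_def y by auto
      then have "y \<in> (\<Inter>n. \<Union>i\<in>{1..d}. D n i) \<longleftrightarrow> z = e (1 - s) \<and> (\<forall>n.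
          fibre_iterate d a z n w = branch (x (Suc n)) (real (d ^ n) * (1 - s)) (fibre_iterate d a z (Suc n) w))"
        unfolding A by simp
      also have "\<dots> \<longleftrightarrow> z = e (1 - s) \<and> code (1 - s) x w"
        using sx(3) unfolding mem_K code_def by blast
      also have "\<dots> \<longleftrightarrow> snd y = decode (fst y)" unfolding y fst_conv snd_conv decode_eq_iff[OF sx(2)] ..
      finally show ?thesis using True by blast
    next
      case False
      then show ?thesis by (auto simp: D_def)
    qed
  qed
  moreover have "closedin ?X (\<Inter>n. \<Union>i\<in>{1..d}. D n i)" by (rule closedin_Inter) (use D in auto)
  ultimately show ?thesis by (simp only:)
qed

text \<open>As \<open>K\<close> is compact, projecting the product to the cylinder is a closed map,
  and the preimage of a closed set is the projection of a closed part of the graph.\<close>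

lemma continuous_map_decode: "continuous_map cylinder (top_of_set K) decode"
  unfolding continuous_map_closedin
proof (intro conjI allI impI)
  let ?X = "prod_topology cylinder (top_of_set K)"
  show "decode \<in> topspace cylinder \<rightarrow> topspace (top_of_set K)" using decode_in by simp
  fix C assume C: "closedin (top_of_set K) C"
  have comp: "compact_space (top_of_set K)" using compact_inter by (simp add: compact_space_subtopology)
  let ?G = "{y \<in> topspace ?X. snd y = decode (fst y)} \<inter> {y \<in> topspace ?X. snd y \<in> C}"
  have G: "closedin ?X ?G"
    by (intro closedin_Int closedin_decode_graph closedin_continuous_map_preimage[OF continuous_map_snd C])
  have "{p \<in> topspace cylinder. decode p \<in> C} = fst ` ?G"
  proof (intro equalityI subsetI)
    fix p assume "p \<in> {p \<in> topspace cylinder. decode p \<in> C}"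
    then have "(p, decode p) \<in> ?G" "p = fst (p, decode p)" using decode_in by auto
    then show "p \<in> fst ` ?G" by (rule rev_image_eqI)
  next
    fix p assume "p \<in> fst ` ?G"
    then show "p \<in> {p \<in> topspace cylinder. decode p \<in> C}" by auto
  qed
  then show "closedin cylinder {p \<in> topspace cylinder. decode p \<in> C}"
    using Abstract_Topological_Spaces.closed_map_fst[OF comp, of cylinder] G unfolding closed_map_def by simp
qed

text \<open>A continuous surjection from a compact space onto a Hausdorff space is a quotient map,
  and quotient maps with the same fibres have homeomorphic targets.\<close>

lemma homeomorphic_space_mapping_torus: "top_of_set K homeomorphic_space mapping_torus (symbol_space d) h"
  unfolding mapping_torus_def
proof (rule quotient_maps_homeomorphic_space)
  have "compact_space cylinder"
    by (simp add: compact_space_prod_topology compact_space_symbol_space compact_space_subtopology)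
  then have "closed_map cylinder (top_of_set K) decode"
    by (intro continuous_imp_closed_map_gen continuous_map_decode Hausdorff_imp_kc_space Hausdorff_space_subtopology Hausdorff_space_euclidean)
  then show "quotient_map cylinder (top_of_set K) decode"
    by (intro continuous_closed_imp_quotient_map continuous_map_decode)
      (simp_all only: decode_surj topspace_euclidean_subtopology)
  let ?r = "equivclp (torus_glue (symbol_space d) h)"
  show "quotient_map cylinder (quotient_topology cylinder (\<lambda>p. Collect (?r p))) (\<lambda>p. Collect (?r p))"
    by (rule quotient_map_quotient_topology)
  fix p p' assume "p \<in> topspace cylinder" "p' \<in> topspace cylinder"
  then have "decode p = decode p' \<longleftrightarrow> ?r p p'" by (rule decode_fibres)
  also have "\<dots> \<longleftrightarrow> Collect (?r p) = Collect (?r p')" by (rule Collect_equivclp_eq_iff[symmetric])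
  finally show "decode p = decode p' \<longleftrightarrow> Collect (?r p) = Collect (?r p')" .
qed

end

lemma homeomorphic_imp_homeomorphic_space:
  assumes "A homeomorphic B" shows "top_of_set A homeomorphic_space top_of_set B"
proof -
  obtain f g where "homeomorphism A B f g" using assms by (auto simp: homeomorphic_def)
  then have "homeomorphic_maps (top_of_set A) (top_of_set B) f g"
    by (auto simp: homeomorphic_maps_def homeomorphism_def continuous_map_in_subtopology)
  then show ?thesis by (auto simp: homeomorphic_space_def)
qed

lemma admissible_imp_admissible_coding:
  assumes d: "d \<ge> 2" and a: "a \<in> escape_locus d" and adm: "admissible d a" and r: "root_labelling d a r"
  shows "\<exists>R R'. admissible_coding d a R R' r \<and> filled_set d a = (\<Inter>n. tube d a R n)"
proof -
  obtain R where R0: "R > 0"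
    and cl: "\<forall>n. compact (closure (tube d a R (Suc n))) \<and> closure (tube d a R (Suc n)) \<subseteq> tube d a R n"
    and cov: "covering_space (tube d a R 1) (skew_product d a) (tube d a R 0)"
    and J: "julia_set d (skew_product d a) = (\<Inter>n. tube d a R n)"
    using adm unfolding admissible_def by (elim conjE exE)
  have R: "R > 0" "compact (closure (tube d a R 1))" "closure (tube d a R 1) \<subseteq> tube d a R 0"
    using R0 cl[rule_format, of 0] by simp_all
  have eq: "filled_set d a = (\<Inter>n. tube d a R n)" using J julia_set_eq_filled_set[OF d a] by simp
  \<comment> \<open>The maximum of the moduli over the compact closure of the first tube is below R,
    since that closure lies over the open disc. The inserted 0 keeps \<open>B\<close> nonempty and
    R' nonnegative.\<close>
  define B where "B = insert 0 ((\<lambda>y. cmod (snd y)) ` closure (tube d a R 1))"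
  have "compact B" unfolding B_def
    by (intro compact_insert compact_continuous_image continuous_intros R(2))
  moreover have "B \<noteq> {}" by (simp add: B_def)
  ultimately obtain R' where R': "R' \<in> B" "\<And>y. y \<in> B \<Longrightarrow> y \<le> R'"
    using compact_attains_sup[of B] by blast
  have "R' < R" using R'(1) R(1,3) mem_tube[OF d, of _ _ a R 0] unfolding B_def by fastforce
  moreover have "0 \<le> R'" by (rule R'(2)) (simp add: B_def)
  moreover have "cmod w \<le> R'" if "(z, w) \<in> tube d a R 1" for z w
    using that closure_subset[of "tube d a R 1"] by (intro R'(2)) (force simp: B_def)
  moreover have "compact (\<Inter>n. tube d a R n)" using compact_filled_set[OF d, of a] by (simp only: eq)
  ultimately have "admissible_coding d a R R' r" using d cov r by unfold_locales
  then show ?thesis using eq by blast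
qed

theorem theorem1p4:
  fixes d :: nat and \<Lambda> :: "param set" and a\<^sub>0 :: param
    and r :: "nat \<Rightarrow> complex" and S :: "nat \<Rightarrow> nat" and h :: "(nat \<Rightarrow> nat) \<Rightarrow> (nat \<Rightarrow> nat)"
  assumes "d \<ge> 2"
    and "\<Lambda> \<in> components (accessible_locus d)"
    and "a\<^sub>0 \<in> \<Lambda>"
    and "admissible d a\<^sub>0"
    and "root_labelling d a\<^sub>0 r"
    and "S = monodromy_perm d a\<^sub>0 r"
    and "h = symbol_map d S"
  shows "S permutes {1..d}
    \<and> homeomorphic_map (symbol_space d) (symbol_space d) h
    \<and> top_of_set (julia_set d (skew_product d a\<^sub>0)) homeomorphic_space mapping_torus (symbol_space d) h
    \<and> (\<forall>a \<in> \<Lambda>. top_of_set (julia_set d (skew_product d a)) homeomorphic_space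
          mapping_torus (symbol_space d) h)"
proof -
  have sub: "\<Lambda> \<subseteq> escape_locus d"
    using in_components_subset[OF assms(2)] by (auto simp: accessible_locus_def)
  have conn: "connected \<Lambda>" using assms(2) by (rule in_components_connected)
  have a0: "a\<^sub>0 \<in> escape_locus d" using sub assms(3) by (rule subsetD)
  obtain R R' where ac: "admissible_coding d a\<^sub>0 R R' r" and eq: "filled_set d a\<^sub>0 = (\<Inter>n. tube d a\<^sub>0 R n)"
    using admissible_imp_admissible_coding[OF assms(1) a0 assms(4,5)] by blast
  interpret admissible_coding d a\<^sub>0 R R' r by (rule ac)
  have perm: "S permutes {1..d}" unfolding assms(6) by (rule S_permutes)
  have main: "top_of_set (filled_set d a\<^sub>0) homeomorphic_space mapping_torus (symbol_space d) h"
    unfolding eq assms(6,7) by (rule homeomorphic_space_mapping_torus)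
  \<comment> \<open>Parameters of the component lie in the escape locus, so their Julia sets are
    filled sets, and stability along the connected component transports the homeomorphism found at
    the admissible parameter.\<close>
  have "top_of_set (julia_set d (skew_product d a)) homeomorphic_space mapping_torus (symbol_space d) h"
    if "a \<in> \<Lambda>" for a
  proof -
    have "filled_set d a homeomorphic filled_set d a\<^sub>0"
      by (rule filled_set_stable[OF assms(1) sub conn that assms(3)])
    then show ?thesis
      unfolding julia_set_eq_filled_set[OF assms(1) subsetD[OF sub that]]
      by (rule homeomorphic_space_trans[OF homeomorphic_imp_homeomorphic_space main])
  qed
  then show ?thesis
    using perm homeomorphic_map_symbol_map[OF perm] assms(3) unfolding assms(7) by blast
qed

end
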